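(* (Recurrence Theorem for Small Intervals) Let $\rho$ be an additively indecomposable ordinal. Assume $\alpha<\theta_1$ is of the form $\rho\cdot\lambda$ where $\lambda$ is infinite and additively indecomposable. Also assume that $\delta$ is an ordinal divisible by $\kappa_\alpha$. Then: 1. $[0,\delta]\not\leq_2[\delta+1,\delta+\kappa_\alpha)$. 2. $[1,\kappa_\alpha]\cong[\delta+1,\delta+\kappa_\alpha]$.
   Context: $ORD$ is the class of ordinals with its usual order and arithmetic; intervals are intervals of ordinals. $\rho$ is a fixed additively indecomposable ordinal (nonzero and closed under addition; $\rho=1$ is allowed). An ordinal $\beta$ is divisible by (a multiple of) $\alpha$ if $\beta=\alpha\cdot\delta$ for some $\delta$. For $\xi<\rho$ define $f_\xi:ORD\to ORD$ by $f_\xi(\rho\cdot\zeta)=\rho\cdot\zeta+\xi$ and $f_\xi(\rho\cdot\zeta+\epsilon)=\rho\cdot\zeta$ if $0<\epsilon<\rho$. A set $X$ of ordinals is closed if $\sigma\in X$ whenever $\sigma$ is divisible by $\rho$ and $\sigma+\xi\in X$ for some $\xi<\rho$. For sets of ordinals, $X<Y$ means $x<y$ for all $x\in X$, $y\in Y$. Binary relations $\leq_1,\leq_2$ on $ORD$ are defined by recursion on the larger argument $\beta$ as below. A covering of a closed set $X$ is a strictly increasing $h:X\to ORD$ such that for all $x,y\in X$: $f_\xi(x)=y$ iff $f_\xi(h(x))=h(y)$ for every $\xi<\rho$; and $x\leq_k y$ implies $h(x)\leq_k h(y)$ for $k=1,2$. A set $Z$ is a covering of $X$ if it is the range of a covering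 of $X$. "Cofinally many $\tilde Y$ below $\alpha$" with a property means: for every $\gamma<\alpha$ there is such a finite $\tilde Y\subseteq(\gamma,\alpha)$. (i) $\alpha\leq_1\beta$ iff $\alpha\leq\beta$ and for all finite $X\subseteq\alpha$ and finite $Y\subseteq[\alpha,\beta)$ with $X\cup Y$ closed there is a finite $\tilde Y\subseteq\alpha$ with $X<\tilde Y$ such that $X\cup\tilde Y$ is a covering of $X\cup Y$. (ii) $\alpha\leq_2\beta$ iff $\alpha\leq\beta$ and both of the following hold. (Up, written $\alpha\leq_2\uparrow\beta$) For all finite $X,Y\subseteq\alpha$ with $X\cup Y$ closed and $X<Y$: if there are cofinally many $\tilde Y$ below $\alpha$ such that $X\cup\tilde Y$ is a covering of $X\cup Y$, then there are cofinally many $\tilde Y$ below $\beta$ such that $X\cup\tilde Y$ is a covering of $X\cup Y$. (Down, written $\alpha\leq_2\downarrow\beta$) For all finite $X\subseteq\alpha$ and finite $Y\subseteq[\alpha,\beta)$ with $X\cup Y$ closed there is a finite $\tilde Y\subseteq\alpha$ with $X<\tilde Y$ such that $X\cup\tilde Y$ is a covering of $X\cup Y$ and, for every $i$ less than the cardinality of $Y$, if the $i$-th element of $Y$ is $\leq_1\beta$ then the $i$-th element of $\tilde Y$ is $\leq_1\alpha$. $\alpha<_k\beta$ means $\alpha\leq_k\beta$ and $\alpha\neq\beta$. For classes $A,B$ of ordinals, $A\not\leq_k B$ means $a\not\leq_k b$ for all $a\in A$, $b\in B$. $A\cong B$ means there is an order-preserving bijection $h:A\to B$ such that for all $x,y\in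 A$: $f_\xi(x)=y$ iff $f_\xi(h(x))=h(y)$ for every $\xi<\rho$, and $x\leq_k y$ iff $h(x)\leq_k h(y)$ for $k=1,2$. $(\kappa_\alpha)_{\alpha<\theta_1}$ is the increasing enumeration of all ordinals which are minimal with respect to $\leq_1$ (those $\kappa$ with no $\xi<_1\kappa$); $\theta_1$ is an ordinal, or $\infty$ if there is a proper class of them (every ordinal is $<\infty$). *)

theory Defs
  imports Main
begin

text \<open>
  HOL has no type of all ordinals. The class of ordinals is rendered by an arbitrary well-ordered
  type without largest element that satisfies Replacement for its initial segments; up to
  isomorphism these are the initial segments of the ordinals of length an infinite regular cardinal.
  They are closed under ordinal arithmetic, and all notions below (arithmetic, the relations of
  resemblance, the enumeration of the minimal elements up to a given index) only depend on the
  ordinals up to the ones involved, so they do not depend on the chosen segment. The type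
  constructor at the end of this theory provides arbitrarily long instances.
\<close>

class ordinal = wellorder + no_top +
  assumes replacement: "bdd_above (f ` {..<x})"

definition ozero :: "'o::ordinal"  ("\<zero>\<^sub>o")
  where "\<zero>\<^sub>o = (LEAST x. True)"

definition osuc :: "'o::ordinal \<Rightarrow> 'o"
  where "osuc x = (LEAST y. x < y)"

abbreviation oone :: "'o::ordinal"  ("\<one>\<^sub>o")
  where "\<one>\<^sub>o \<equiv> osuc \<zero>\<^sub>o"

text \<open>
  Arithmetic by recursion on the right argument, with the zero, successor and limit clauses merged:
  \<open>\<alpha> + \<beta>\<close> is the supremum of \<open>\<alpha>\<close> and all \<open>(\<alpha> + \<gamma>) + 1\<close>, and \<open>\<alpha> \<cdot> \<beta>\<close> that of all \<open>\<alpha> \<cdot> \<gamma> + \<alpha>\<close>,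
  for \<open>\<gamma> < \<beta>\<close>. The usual clauses are derived below.
\<close>

function oadd :: "'o::ordinal \<Rightarrow> 'o \<Rightarrow> 'o"  (infixl "+\<^sub>o" 65)
  where "\<alpha> +\<^sub>o \<beta> = (LEAST y. \<alpha> \<le> y \<and> (\<forall>\<gamma>. \<gamma> < \<beta> \<longrightarrow> \<alpha> +\<^sub>o \<gamma> < y))"
  by auto
termination
proof (relation "inv_image {(x, y). x < y} snd", goal_cases)
  case 1
  show ?case by (intro wf_inv_image wf)
qed simp

declare oadd.simps [simp del]

function omul :: "'o::ordinal \<Rightarrow> 'o \<Rightarrow> 'o"  (infixl "\<cdot>\<^sub>o" 70)
  where "\<alpha> \<cdot>\<^sub>o \<beta> = (LEAST y. \<forall>\<gamma>. \<gamma> < \<beta> \<longrightarrow> \<alpha> \<cdot>\<^sub>o \<gamma> +\<^sub>o \<alpha> \<le> y)"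
  by auto
termination
proof (relation "inv_image {(x, y). x < y} snd", goal_cases)
  case 1
  show ?case by (intro wf_inv_image wf)
qed simp

declare omul.simps [simp del]

definition olimit :: "'o::ordinal \<Rightarrow> bool"
  where "olimit \<beta> \<longleftrightarrow> \<beta> \<noteq> \<zero>\<^sub>o \<and> (\<forall>\<gamma><\<beta>. osuc \<gamma> < \<beta>)"

lemma ozero_le: "\<zero>\<^sub>o \<le> (x::'o::ordinal)"
  unfolding ozero_def by (simp add: Least_le)

lemma not_less_ozero: "\<not> x < (\<zero>\<^sub>o::'o::ordinal)"
  using ozero_le[of x] by (simp add: not_less)

lemma less_osuc: "x < osuc (x::'o::ordinal)"
  unfolding osuc_def by (rule LeastI_ex) (rule gt_ex)

lemma osuc_le_iff: "osuc x \<le> y \<longleftrightarrow> x < (y::'o::ordinal)"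
  using less_osuc[of x] unfolding osuc_def by (auto intro: Least_le)

lemma less_osuc_iff: "x < osuc y \<longleftrightarrow> x \<le> (y::'o::ordinal)"
  using osuc_le_iff[of y x] by (metis not_less)

lemma ex_strict_bound:
  fixes f :: "'o::ordinal \<Rightarrow> 'o"
  shows "\<exists>y. \<alpha> \<le> y \<and> (\<forall>\<gamma><\<beta>. f \<gamma> < y)"
proof -
  obtain u where u: "\<And>\<gamma>. \<gamma> < \<beta> \<Longrightarrow> f \<gamma> \<le> u"
    using replacement[of f \<beta>] unfolding bdd_above_def by auto
  obtain y where "max \<alpha> u < y" using gt_ex by blast
  then have "\<alpha> \<le> y \<and> (\<forall>\<gamma><\<beta>. f \<gamma> < y)" using u by fastforce
  then show ?thesis by blast
qed

lemma oadd_le_iff: "\<alpha> +\<^sub>o \<beta> \<le> y \<longleftrightarrow> \<alpha> \<le> y \<and> (\<forall>\<gamma><\<beta>. \<alpha> +\<^sub>o \<gamma> < y)"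
proof -
  have "\<alpha> \<le> \<alpha> +\<^sub>o \<beta> \<and> (\<forall>\<gamma>. \<gamma> < \<beta> \<longrightarrow> \<alpha> +\<^sub>o \<gamma> < \<alpha> +\<^sub>o \<beta>)"
    unfolding oadd.simps[of \<alpha> \<beta>] using ex_strict_bound[of \<alpha> \<beta> "oadd \<alpha>"] by (rule LeastI_ex)
  moreover have "\<alpha> +\<^sub>o \<beta> \<le> y" if "\<alpha> \<le> y \<and> (\<forall>\<gamma>. \<gamma> < \<beta> \<longrightarrow> \<alpha> +\<^sub>o \<gamma> < y)" for y
    unfolding oadd.simps[of \<alpha> \<beta>] using that by (rule Least_le)
  ultimately show ?thesis by (meson order.trans order.strict_trans2)
qed

lemma omul_le_iff: "\<alpha> \<cdot>\<^sub>o \<beta> \<le> y \<longleftrightarrow> (\<forall>\<gamma><\<beta>. \<alpha> \<cdot>\<^sub>o \<gamma> +\<^sub>o \<alpha> \<le> y)"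
proof -
  have "\<exists>y. \<forall>\<gamma>. \<gamma> < \<beta> \<longrightarrow> \<alpha> \<cdot>\<^sub>o \<gamma> +\<^sub>o \<alpha> \<le> y"
    using ex_strict_bound[of \<alpha> \<beta> "\<lambda>\<gamma>. \<alpha> \<cdot>\<^sub>o \<gamma> +\<^sub>o \<alpha>"] by (meson order.strict_implies_order)
  then have "\<forall>\<gamma>. \<gamma> < \<beta> \<longrightarrow> \<alpha> \<cdot>\<^sub>o \<gamma> +\<^sub>o \<alpha> \<le> \<alpha> \<cdot>\<^sub>o \<beta>"
    unfolding omul.simps[of \<alpha> \<beta>] by (rule LeastI_ex)
  moreover have "\<alpha> \<cdot>\<^sub>o \<beta> \<le> y" if "\<forall>\<gamma>. \<gamma> < \<beta> \<longrightarrow> \<alpha> \<cdot>\<^sub>o \<gamma> +\<^sub>o \<alpha> \<le> y" for y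
    unfolding omul.simps[of \<alpha> \<beta>] using that by (rule Least_le)
  ultimately show ?thesis by (meson order.trans)
qed

lemma oadd_strict_mono: "\<beta> < \<gamma> \<Longrightarrow> \<alpha> +\<^sub>o \<beta> < \<alpha> +\<^sub>o \<gamma>"
  using oadd_le_iff[of \<alpha> \<gamma> "\<alpha> +\<^sub>o \<gamma>"] by auto

lemma oadd_mono: "\<beta> \<le> \<gamma> \<Longrightarrow> \<alpha> +\<^sub>o \<beta> \<le> \<alpha> +\<^sub>o \<gamma>"
  using oadd_strict_mono[of \<beta> \<gamma> \<alpha>] by (metis le_less)

lemma le_oadd: "\<alpha> \<le> \<alpha> +\<^sub>o \<beta>"
  using oadd_le_iff[of \<alpha> \<beta> "\<alpha> +\<^sub>o \<beta>"] by auto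

lemma omul_step: "\<gamma> < \<beta> \<Longrightarrow> \<alpha> \<cdot>\<^sub>o \<gamma> +\<^sub>o \<alpha> \<le> \<alpha> \<cdot>\<^sub>o \<beta>"
  using omul_le_iff[of \<alpha> \<beta> "\<alpha> \<cdot>\<^sub>o \<beta>"] by auto

lemma omul_mono: "\<gamma> \<le> \<beta> \<Longrightarrow> \<alpha> \<cdot>\<^sub>o \<gamma> \<le> \<alpha> \<cdot>\<^sub>o \<beta>"
  using omul_step[of \<gamma> \<beta> \<alpha>] le_oadd[of "\<alpha> \<cdot>\<^sub>o \<gamma>" \<alpha>] by (cases "\<gamma> = \<beta>") (auto intro: order.trans)

lemma oadd_ozero: "\<alpha> +\<^sub>o \<zero>\<^sub>o = \<alpha>"
  by (rule antisym) (auto simp: oadd_le_iff not_less_ozero le_oadd)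

lemma oadd_osuc: "\<alpha> +\<^sub>o osuc \<beta> = osuc (\<alpha> +\<^sub>o \<beta>)"
proof (rule antisym)
  show "\<alpha> +\<^sub>o osuc \<beta> \<le> osuc (\<alpha> +\<^sub>o \<beta>)"
    unfolding oadd_le_iff
    by (metis less_osuc_iff le_oadd oadd_mono order.strict_implies_order less_osuc order.trans)
  show "osuc (\<alpha> +\<^sub>o \<beta>) \<le> \<alpha> +\<^sub>o osuc \<beta>"
    by (simp add: osuc_le_iff oadd_strict_mono less_osuc)
qed

lemma oadd_olimit: "olimit \<beta> \<Longrightarrow> \<alpha> +\<^sub>o \<beta> \<le> y \<longleftrightarrow> (\<forall>\<gamma><\<beta>. \<alpha> +\<^sub>o \<gamma> \<le> y)"
  unfolding oadd_le_iff[of \<alpha> \<beta>] olimit_def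
  by (metis oadd_ozero oadd_osuc osuc_le_iff ozero_le order.strict_implies_order order.not_eq_order_implies_strict)

lemma omul_ozero: "\<alpha> \<cdot>\<^sub>o \<zero>\<^sub>o = \<zero>\<^sub>o"
  by (rule antisym) (auto simp: omul_le_iff not_less_ozero ozero_le)

lemma oadd_mono_left: "\<alpha> \<le> \<alpha>' \<Longrightarrow> \<alpha> +\<^sub>o \<beta> \<le> \<alpha>' +\<^sub>o \<beta>"
proof (induction \<beta> rule: less_induct)
  case (less \<beta>)
  have "\<alpha> \<le> \<alpha>' +\<^sub>o \<beta>" using less.prems le_oadd by (rule order.trans)
  moreover have "\<alpha> +\<^sub>o \<gamma> < \<alpha>' +\<^sub>o \<beta>" if "\<gamma> < \<beta>" for \<gamma>
    using less.IH[OF that less.prems] oadd_strict_mono[OF that] by (rule order.strict_trans1)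
  ultimately show ?case by (simp add: oadd_le_iff[of \<alpha> \<beta>])
qed

lemma omul_osuc: "\<alpha> \<cdot>\<^sub>o osuc \<beta> = \<alpha> \<cdot>\<^sub>o \<beta> +\<^sub>o \<alpha>"
proof (rule antisym)
  show "\<alpha> \<cdot>\<^sub>o osuc \<beta> \<le> \<alpha> \<cdot>\<^sub>o \<beta> +\<^sub>o \<alpha>"
    unfolding omul_le_iff by (simp add: less_osuc_iff oadd_mono_left omul_mono)
  show "\<alpha> \<cdot>\<^sub>o \<beta> +\<^sub>o \<alpha> \<le> \<alpha> \<cdot>\<^sub>o osuc \<beta>"
    by (simp add: omul_step less_osuc)
qed

lemma omul_olimit: "olimit \<beta> \<Longrightarrow> \<alpha> \<cdot>\<^sub>o \<beta> \<le> y \<longleftrightarrow> (\<forall>\<gamma><\<beta>. \<alpha> \<cdot>\<^sub>o \<gamma> \<le> y)"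
  unfolding omul_le_iff[of \<alpha> \<beta>] olimit_def
  by (metis le_oadd omul_osuc order.trans)

definition odvd :: "'o::ordinal \<Rightarrow> 'o \<Rightarrow> bool"
  where "odvd \<alpha> \<beta> \<longleftrightarrow> (\<exists>\<delta>. \<beta> = \<alpha> \<cdot>\<^sub>o \<delta>)"

definition additively_indecomposable :: "'o::ordinal \<Rightarrow> bool"
  where "additively_indecomposable \<rho> \<longleftrightarrow> \<rho> \<noteq> \<zero>\<^sub>o \<and> (\<forall>x<\<rho>. \<forall>y<\<rho>. x +\<^sub>o y < \<rho>)"

definition oinfinite :: "'o::ordinal \<Rightarrow> bool"
  where "oinfinite \<alpha> \<longleftrightarrow> infinite {..<\<alpha>}"

definition rfun :: "'o::ordinal \<Rightarrow> 'o \<Rightarrow> 'o \<Rightarrow> 'o"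
  where "rfun \<rho> \<xi> \<alpha> =
    (if odvd \<rho> \<alpha> then \<alpha> +\<^sub>o \<xi>
     else THE \<sigma>. odvd \<rho> \<sigma> \<and> (\<exists>\<epsilon>. \<zero>\<^sub>o < \<epsilon> \<and> \<epsilon> < \<rho> \<and> \<alpha> = \<sigma> +\<^sub>o \<epsilon>))"

lemma rfun_mult: "rfun \<rho> \<xi> (\<rho> \<cdot>\<^sub>o \<zeta>) = \<rho> \<cdot>\<^sub>o \<zeta> +\<^sub>o \<xi>"
  by (auto simp: rfun_def odvd_def)

lemma oquot_le:
  assumes "\<rho> \<cdot>\<^sub>o \<zeta> +\<^sub>o \<epsilon> = \<rho> \<cdot>\<^sub>o \<zeta>' +\<^sub>o \<epsilon>'" "\<epsilon> < \<rho>"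
  shows "\<zeta>' \<le> \<zeta>"
proof (rule ccontr)
  assume "\<not> \<zeta>' \<le> \<zeta>"
  then have "\<rho> \<cdot>\<^sub>o \<zeta> +\<^sub>o \<rho> \<le> \<rho> \<cdot>\<^sub>o \<zeta>'" by (simp add: omul_step)
  then show False
    using assms oadd_strict_mono[of \<epsilon> \<rho> "\<rho> \<cdot>\<^sub>o \<zeta>"] le_oadd[of "\<rho> \<cdot>\<^sub>o \<zeta>'" \<epsilon>'] by auto
qed

lemma rfun_rest:
  assumes "\<zero>\<^sub>o < \<epsilon>" "\<epsilon> < \<rho>"
  shows "rfun \<rho> \<xi> (\<rho> \<cdot>\<^sub>o \<zeta> +\<^sub>o \<epsilon>) = \<rho> \<cdot>\<^sub>o \<zeta>"
proof -
  have uniq: "\<zeta>' = \<zeta>" if "\<rho> \<cdot>\<^sub>o \<zeta> +\<^sub>o \<epsilon> = \<rho> \<cdot>\<^sub>o \<zeta>' +\<^sub>o \<epsilon>'" "\<epsilon>' < \<rho>" for \<zeta>' \<epsilon>'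
    using oquot_le[OF that(1) assms(2)] oquot_le[OF that(1)[symmetric] that(2)] by simp
  have "\<not> odvd \<rho> (\<rho> \<cdot>\<^sub>o \<zeta> +\<^sub>o \<epsilon>)"
  proof
    assume "odvd \<rho> (\<rho> \<cdot>\<^sub>o \<zeta> +\<^sub>o \<epsilon>)"
    then obtain \<delta> where \<delta>: "\<rho> \<cdot>\<^sub>o \<zeta> +\<^sub>o \<epsilon> = \<rho> \<cdot>\<^sub>o \<delta> +\<^sub>o \<zero>\<^sub>o" by (auto simp: odvd_def oadd_ozero)
    then have "\<delta> = \<zeta>" using assms by (intro uniq[of _ "\<zero>\<^sub>o"]) auto
    then show False using \<delta> oadd_strict_mono[OF assms(1), of "\<rho> \<cdot>\<^sub>o \<zeta>"] by simp
  qed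
  moreover have "(THE \<sigma>. odvd \<rho> \<sigma> \<and> (\<exists>\<epsilon>'. \<zero>\<^sub>o < \<epsilon>' \<and> \<epsilon>' < \<rho> \<and> \<rho> \<cdot>\<^sub>o \<zeta> +\<^sub>o \<epsilon> = \<sigma> +\<^sub>o \<epsilon>')) = \<rho> \<cdot>\<^sub>o \<zeta>"
    using assms uniq by (intro the_equality) (auto simp: odvd_def)
  ultimately show ?thesis by (simp add: rfun_def)
qed

definition rclosed :: "'o::ordinal \<Rightarrow> 'o set \<Rightarrow> bool"
  where "rclosed \<rho> X \<longleftrightarrow> (\<forall>\<sigma> \<xi>. odvd \<rho> \<sigma> \<and> \<xi> < \<rho> \<and> \<sigma> +\<^sub>o \<xi> \<in> X \<longrightarrow> \<sigma> \<in> X)"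

definition set_less :: "'o::ordinal set \<Rightarrow> 'o set \<Rightarrow> bool"
  where "set_less X Y \<longleftrightarrow> (\<forall>x\<in>X. \<forall>y\<in>Y. x < y)"

text \<open>
  As \<open>\<le>\<^sub>1\<close> and \<open>\<le>\<^sub>2\<close> are defined by recursion through the notion of covering, the latter takes the
  two relations as parameters.
\<close>

definition covering_map ::
    "'o::ordinal \<Rightarrow> ('o \<Rightarrow> 'o \<Rightarrow> bool) \<Rightarrow> ('o \<Rightarrow> 'o \<Rightarrow> bool) \<Rightarrow> ('o \<Rightarrow> 'o) \<Rightarrow> 'o set \<Rightarrow> bool"
  where "covering_map \<rho> R1 R2 h X \<longleftrightarrow> strict_mono_on X h \<and>
    (\<forall>x\<in>X. \<forall>y\<in>X.
       (\<forall>\<xi><\<rho>. rfun \<rho> \<xi> x = y \<longleftrightarrow> rfun \<rho> \<xi> (h x) = h y) \<and>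
       (R1 x y \<longrightarrow> R1 (h x) (h y)) \<and> (R2 x y \<longrightarrow> R2 (h x) (h y)))"

definition covering_of ::
    "'o::ordinal \<Rightarrow> ('o \<Rightarrow> 'o \<Rightarrow> bool) \<Rightarrow> ('o \<Rightarrow> 'o \<Rightarrow> bool) \<Rightarrow> 'o set \<Rightarrow> 'o set \<Rightarrow> bool"
  where "covering_of \<rho> R1 R2 Z X \<longleftrightarrow> (\<exists>h. covering_map \<rho> R1 R2 h X \<and> h ` X = Z)"

definition cofinally_many :: "'o::ordinal \<Rightarrow> ('o set \<Rightarrow> bool) \<Rightarrow> bool"
  where "cofinally_many \<alpha> P \<longleftrightarrow> (\<forall>\<gamma><\<alpha>. \<exists>Y'. finite Y' \<and> Y' \<subseteq> {\<gamma><..<\<alpha>} \<and> P Y')"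

text \<open>
  The guards \<open>y < \<beta>\<close> make the recursion on the larger argument explicit; they are redundant, since
  all coverings involved live below \<open>\<beta>\<close>. The defining equivalences without them are
  \<open>le1_iff\<close> and \<open>le2_iff\<close> below.
\<close>

context notes conj_cong [fundef_cong] begin

function le1 :: "'o::ordinal \<Rightarrow> 'o \<Rightarrow> 'o \<Rightarrow> bool"
  and le2 :: "'o::ordinal \<Rightarrow> 'o \<Rightarrow> 'o \<Rightarrow> bool"
  where
  "le1 \<rho> \<alpha> \<beta> \<longleftrightarrow> \<alpha> \<le> \<beta> \<and>
     (\<forall>X Y. finite X \<and> X \<subseteq> {..<\<alpha>} \<and> finite Y \<and> Y \<subseteq> {\<alpha>..<\<beta>} \<and> rclosed \<rho> (X \<union> Y) \<longrightarrow>
       (\<exists>Y'. finite Y' \<and> Y' \<subseteq> {..<\<alpha>} \<and> set_less X Y' \<and>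
          covering_of \<rho> (\<lambda>x y. y < \<beta> \<and> le1 \<rho> x y) (\<lambda>x y. y < \<beta> \<and> le2 \<rho> x y) (X \<union> Y') (X \<union> Y)))"
| "le2 \<rho> \<alpha> \<beta> \<longleftrightarrow> \<alpha> \<le> \<beta> \<and>
     (\<forall>X Y. finite X \<and> X \<subseteq> {..<\<alpha>} \<and> finite Y \<and> Y \<subseteq> {..<\<alpha>} \<and> rclosed \<rho> (X \<union> Y) \<and> set_less X Y \<longrightarrow>
       cofinally_many \<alpha> (\<lambda>Y'.
          covering_of \<rho> (\<lambda>x y. y < \<beta> \<and> le1 \<rho> x y) (\<lambda>x y. y < \<beta> \<and> le2 \<rho> x y) (X \<union> Y') (X \<union> Y)) \<longrightarrow>
       cofinally_many \<beta> (\<lambda>Y'.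
          covering_of \<rho> (\<lambda>x y. y < \<beta> \<and> le1 \<rho> x y) (\<lambda>x y. y < \<beta> \<and> le2 \<rho> x y) (X \<union> Y') (X \<union> Y))) \<and>
     (\<forall>X Y. finite X \<and> X \<subseteq> {..<\<alpha>} \<and> finite Y \<and> Y \<subseteq> {\<alpha>..<\<beta>} \<and> rclosed \<rho> (X \<union> Y) \<longrightarrow>
       (\<exists>Y'. finite Y' \<and> Y' \<subseteq> {..<\<alpha>} \<and> set_less X Y' \<and>
          covering_of \<rho> (\<lambda>x y. y < \<beta> \<and> le1 \<rho> x y) (\<lambda>x y. y < \<beta> \<and> le2 \<rho> x y) (X \<union> Y') (X \<union> Y) \<and>
          (\<forall>i<card Y. le1 \<rho> (sorted_list_of_set Y ! i) \<beta> \<longrightarrow> le1 \<rho> (sorted_list_of_set Y' ! i) \<alpha>)))"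
  by pat_completeness auto

end

termination
proof (relation "inv_image ({(x, y). x < y} <*lex*> less_than)
    (\<lambda>p. case p of Inl (\<rho>, \<alpha>, \<beta>) \<Rightarrow> (\<beta>, 0) | Inr (\<rho>, \<alpha>, \<beta>) \<Rightarrow> (\<beta>, 1))")
  show "wf (inv_image ({(x::'a, y). x < y} <*lex*> less_than)
    (\<lambda>p::'a \<times> 'a \<times> 'a + 'a \<times> 'a \<times> 'a.
       case p of Inl (\<rho>, \<alpha>, \<beta>) \<Rightarrow> (\<beta>, 0) | Inr (\<rho>, \<alpha>, \<beta>) \<Rightarrow> (\<beta>, 1)))"
    by (intro wf_inv_image wf_lex_prod wf_less_than wf)
qed auto

declare le1.simps [simp del] le2.simps [simp del]

abbreviation is_covering :: "'o::ordinal \<Rightarrow> 'o set \<Rightarrow> 'o set \<Rightarrow> bool"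
  where "is_covering \<rho> Z X \<equiv> covering_of \<rho> (le1 \<rho>) (le2 \<rho>) Z X"

lemma covering_of_guard:
  assumes "X \<subseteq> {..<\<beta>}" "Z \<subseteq> {..<\<beta>}"
  shows "covering_of \<rho> (\<lambda>x y. y < \<beta> \<and> le1 \<rho> x y) (\<lambda>x y. y < \<beta> \<and> le2 \<rho> x y) Z X
    \<longleftrightarrow> is_covering \<rho> Z X"
proof -
  have "covering_map \<rho> (\<lambda>x y. y < \<beta> \<and> le1 \<rho> x y) (\<lambda>x y. y < \<beta> \<and> le2 \<rho> x y) h X
      \<longleftrightarrow> covering_map \<rho> (le1 \<rho>) (le2 \<rho>) h X" if "h ` X = Z" for h
  proof -
    have "\<And>x. x \<in> X \<Longrightarrow> x < \<beta> \<and> h x < \<beta>" using assms that by auto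
    then show ?thesis unfolding covering_map_def by auto
  qed
  then show ?thesis unfolding covering_of_def by blast
qed

theorem le1_iff:
  "le1 \<rho> \<alpha> \<beta> \<longleftrightarrow> \<alpha> \<le> \<beta> \<and>
     (\<forall>X Y. finite X \<and> X \<subseteq> {..<\<alpha>} \<and> finite Y \<and> Y \<subseteq> {\<alpha>..<\<beta>} \<and> rclosed \<rho> (X \<union> Y) \<longrightarrow>
       (\<exists>Y'. finite Y' \<and> Y' \<subseteq> {..<\<alpha>} \<and> set_less X Y' \<and> is_covering \<rho> (X \<union> Y') (X \<union> Y)))"
proof (cases "\<alpha> \<le> \<beta>")
  case True
  have "covering_of \<rho> (\<lambda>x y. y < \<beta> \<and> le1 \<rho> x y) (\<lambda>x y. y < \<beta> \<and> le2 \<rho> x y) (X \<union> Y') (X \<union> Y)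
      \<longleftrightarrow> is_covering \<rho> (X \<union> Y') (X \<union> Y)"
    if "X \<subseteq> {..<\<alpha>}" "Y \<subseteq> {\<alpha>..<\<beta>}" "Y' \<subseteq> {..<\<alpha>}" for X Y Y'
    using that True by (intro covering_of_guard) force+
  then show ?thesis unfolding le1.simps[of \<rho> \<alpha> \<beta>] by (simp cong: conj_cong)
next
  case False
  then show ?thesis unfolding le1.simps[of \<rho> \<alpha> \<beta>] by simp
qed

definition le2_up :: "'o::ordinal \<Rightarrow> 'o \<Rightarrow> 'o \<Rightarrow> bool"
  where "le2_up \<rho> \<alpha> \<beta> \<longleftrightarrow>
     (\<forall>X Y. finite X \<and> X \<subseteq> {..<\<alpha>} \<and> finite Y \<and> Y \<subseteq> {..<\<alpha>} \<and> rclosed \<rho> (X \<union> Y) \<and> set_less X Y \<longrightarrow>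
       cofinally_many \<alpha> (\<lambda>Y'. is_covering \<rho> (X \<union> Y') (X \<union> Y)) \<longrightarrow>
       cofinally_many \<beta> (\<lambda>Y'. is_covering \<rho> (X \<union> Y') (X \<union> Y)))"

definition le2_down :: "'o::ordinal \<Rightarrow> 'o \<Rightarrow> 'o \<Rightarrow> bool"
  where "le2_down \<rho> \<alpha> \<beta> \<longleftrightarrow>
     (\<forall>X Y. finite X \<and> X \<subseteq> {..<\<alpha>} \<and> finite Y \<and> Y \<subseteq> {\<alpha>..<\<beta>} \<and> rclosed \<rho> (X \<union> Y) \<longrightarrow>
       (\<exists>Y'. finite Y' \<and> Y' \<subseteq> {..<\<alpha>} \<and> set_less X Y' \<and> is_covering \<rho> (X \<union> Y') (X \<union> Y) \<and>
          (\<forall>i<card Y. le1 \<rho> (sorted_list_of_set Y ! i) \<beta> \<longrightarrow> le1 \<rho> (sorted_list_of_set Y' ! i) \<alpha>)))"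

theorem le2_iff: "le2 \<rho> \<alpha> \<beta> \<longleftrightarrow> \<alpha> \<le> \<beta> \<and> le2_up \<rho> \<alpha> \<beta> \<and> le2_down \<rho> \<alpha> \<beta>"
proof (cases "\<alpha> \<le> \<beta>")
  case True
  have *: "covering_of \<rho> (\<lambda>x y. y < \<beta> \<and> le1 \<rho> x y) (\<lambda>x y. y < \<beta> \<and> le2 \<rho> x y) (X \<union> Y') (X \<union> Y)
      \<longleftrightarrow> is_covering \<rho> (X \<union> Y') (X \<union> Y)"
    if "X \<subseteq> {..<\<alpha>}" "Y \<subseteq> {..<\<beta>}" "Y' \<subseteq> {..<\<beta>}" for X Y Y'
    using that True by (intro covering_of_guard) force+
  have down: "covering_of \<rho> (\<lambda>x y. y < \<beta> \<and> le1 \<rho> x y) (\<lambda>x y. y < \<beta> \<and> le2 \<rho> x y) (X \<union> Y') (X \<union> Y)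
      \<longleftrightarrow> is_covering \<rho> (X \<union> Y') (X \<union> Y)"
    if "X \<subseteq> {..<\<alpha>}" "Y \<subseteq> {\<alpha>..<\<beta>}" "Y' \<subseteq> {..<\<alpha>}" for X Y Y'
    using that True by (intro *) force+
  have up: "cofinally_many \<eta> (\<lambda>Y'.
          covering_of \<rho> (\<lambda>x y. y < \<beta> \<and> le1 \<rho> x y) (\<lambda>x y. y < \<beta> \<and> le2 \<rho> x y) (X \<union> Y') (X \<union> Y))
      \<longleftrightarrow> cofinally_many \<eta> (\<lambda>Y'. is_covering \<rho> (X \<union> Y') (X \<union> Y))"
    if "X \<subseteq> {..<\<alpha>}" "Y \<subseteq> {..<\<alpha>}" "\<eta> \<le> \<beta>" for X Y \<eta>
  proof -
    have "covering_of \<rho> (\<lambda>x y. y < \<beta> \<and> le1 \<rho> x y) (\<lambda>x y. y < \<beta> \<and> le2 \<rho> x y) (X \<union> Y') (X \<union> Y)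
      \<longleftrightarrow> is_covering \<rho> (X \<union> Y') (X \<union> Y)" if "Y' \<subseteq> {\<gamma><..<\<eta>}" for Y' \<gamma>
      using \<open>X \<subseteq> {..<\<alpha>}\<close> \<open>Y \<subseteq> {..<\<alpha>}\<close> \<open>\<eta> \<le> \<beta>\<close> that True by (intro *) force+
    then show ?thesis unfolding cofinally_many_def by (simp cong: conj_cong)
  qed
  show ?thesis
    unfolding le2.simps[of \<rho> \<alpha> \<beta>] le2_up_def le2_down_def
    using True by (simp add: up down cong: conj_cong)
next
  case False
  then show ?thesis unfolding le2.simps[of \<rho> \<alpha> \<beta>] by simp
qed

definition less1 :: "'o::ordinal \<Rightarrow> 'o \<Rightarrow> 'o \<Rightarrow> bool"
  where "less1 \<rho> \<alpha> \<beta> \<longleftrightarrow> le1 \<rho> \<alpha> \<beta> \<and> \<alpha> \<noteq> \<beta>"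

definition not_le2 :: "'o::ordinal \<Rightarrow> 'o set \<Rightarrow> 'o set \<Rightarrow> bool"
  where "not_le2 \<rho> A B \<longleftrightarrow> (\<forall>a\<in>A. \<forall>b\<in>B. \<not> le2 \<rho> a b)"

definition resemblance_iso :: "'o::ordinal \<Rightarrow> 'o set \<Rightarrow> 'o set \<Rightarrow> bool"
  where "resemblance_iso \<rho> A B \<longleftrightarrow>
    (\<exists>h. bij_betw h A B \<and> strict_mono_on A h \<and>
      (\<forall>x\<in>A. \<forall>y\<in>A.
         (\<forall>\<xi><\<rho>. rfun \<rho> \<xi> x = y \<longleftrightarrow> rfun \<rho> \<xi> (h x) = h y) \<and>
         (le1 \<rho> x y \<longleftrightarrow> le1 \<rho> (h x) (h y)) \<and> (le2 \<rho> x y \<longleftrightarrow> le2 \<rho> (h x) (h y))))"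

definition minimal1 :: "'o::ordinal \<Rightarrow> 'o \<Rightarrow> bool"
  where "minimal1 \<rho> \<kappa> \<longleftrightarrow> (\<nexists>\<xi>. less1 \<rho> \<xi> \<kappa>)"

function kappa :: "'o::ordinal \<Rightarrow> 'o \<Rightarrow> 'o"
  where "kappa \<rho> \<alpha> = (LEAST \<kappa>. minimal1 \<rho> \<kappa> \<and> (\<forall>\<gamma>. \<gamma> < \<alpha> \<longrightarrow> kappa \<rho> \<gamma> < \<kappa>))"
  by auto
termination
proof (relation "inv_image {(x, y). x < y} snd", goal_cases)
  case 1
  show ?case by (intro wf_inv_image wf)
qed simp

declare kappa.simps [simp del]

text \<open>
  \<open>\<alpha> < \<theta>\<^sub>1\<close>: the enumeration has not run out at \<open>\<alpha>\<close>. Formulating this without naming \<open>\<theta>\<^sub>1\<close>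
  covers the case \<open>\<theta>\<^sub>1 = \<infinity>\<close>; see \<open>less_theta1_downward\<close>, \<open>strict_mono_kappa\<close> and
  \<open>kappa_image\<close>.
\<close>

definition less_theta1 :: "'o::ordinal \<Rightarrow> 'o \<Rightarrow> bool"
  where "less_theta1 \<rho> \<alpha> \<longleftrightarrow> (\<exists>\<kappa>. minimal1 \<rho> \<kappa> \<and> (\<forall>\<gamma><\<alpha>. kappa \<rho> \<gamma> < \<kappa>))"

lemma less_theta1_downward: "less_theta1 \<rho> \<alpha> \<Longrightarrow> \<beta> \<le> \<alpha> \<Longrightarrow> less_theta1 \<rho> \<beta>"
  unfolding less_theta1_def by (meson order.strict_trans2)

lemma kappa_props:
  assumes "less_theta1 \<rho> \<alpha>"
  shows "minimal1 \<rho> (kappa \<rho> \<alpha>) \<and> (\<forall>\<gamma>. \<gamma> < \<alpha> \<longrightarrow> kappa \<rho> \<gamma> < kappa \<rho> \<alpha>)"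
  using assms unfolding less_theta1_def kappa.simps[of \<rho> \<alpha>] by (rule LeastI_ex)

lemma strict_mono_kappa: "strict_mono_on {\<alpha>. less_theta1 \<rho> \<alpha>} (kappa \<rho>)"
  using kappa_props by (auto intro: strict_mono_onI)

lemma kappa_image: "kappa \<rho> ` {\<alpha>. less_theta1 \<rho> \<alpha>} = {\<kappa>. minimal1 \<rho> \<kappa>}"
proof (intro equalityI subsetI)
  fix \<kappa> assume "\<kappa> \<in> kappa \<rho> ` {\<alpha>. less_theta1 \<rho> \<alpha>}"
  then show "\<kappa> \<in> {\<kappa>. minimal1 \<rho> \<kappa>}" using kappa_props by auto
next
  fix \<kappa> assume \<kappa>: "\<kappa> \<in> {\<kappa>. minimal1 \<rho> \<kappa>}"
  have ex: "\<exists>\<alpha>. \<not> kappa \<rho> \<alpha> < \<kappa>"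
  proof (rule ccontr)
    assume "\<nexists>\<alpha>. \<not> kappa \<rho> \<alpha> < \<kappa>"
    then have b: "\<And>\<alpha>. kappa \<rho> \<alpha> < \<kappa>" by blast
    then have "less_theta1 \<rho> \<alpha>" for \<alpha> using \<kappa> unfolding less_theta1_def by auto
    then have sm: "kappa \<rho> \<beta> < kappa \<rho> \<alpha>" if "\<beta> < \<alpha>" for \<alpha> \<beta> using kappa_props that by blast
    have "\<alpha> \<le> kappa \<rho> \<alpha>" for \<alpha>
    proof (induction \<alpha> rule: less_induct)
      case (less \<alpha>)
      show ?case
      proof (rule ccontr)
        assume "\<not> \<alpha> \<le> kappa \<rho> \<alpha>"
        then have "kappa \<rho> \<alpha> < \<alpha>" by simp
        then show False using less[of "kappa \<rho> \<alpha>"] sm[of "kappa \<rho> \<alpha>" \<alpha>] by simp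
      qed
    qed
    then show False using b[of \<kappa>] by (metis not_less)
  qed
  define \<alpha> where "\<alpha> = (LEAST \<alpha>. \<not> kappa \<rho> \<alpha> < \<kappa>)"
  have 1: "\<not> kappa \<rho> \<alpha> < \<kappa>" unfolding \<alpha>_def using ex by (rule LeastI_ex)
  have 2: "kappa \<rho> \<gamma> < \<kappa>" if "\<gamma> < \<alpha>" for \<gamma>
    using not_less_Least[of \<gamma> "\<lambda>\<alpha>. \<not> kappa \<rho> \<alpha> < \<kappa>"] that unfolding \<alpha>_def by auto
  have "less_theta1 \<rho> \<alpha>" using \<kappa> 2 unfolding less_theta1_def by auto
  moreover have "kappa \<rho> \<alpha> \<le> \<kappa>" unfolding kappa.simps[of \<rho> \<alpha>] using \<kappa> 2 by (intro Least_le) auto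
  ultimately show "\<kappa> \<in> kappa \<rho> ` {\<alpha>. less_theta1 \<rho> \<alpha>}" using 1 by force
qed

context includes cardinal_syntax begin

abbreviation long_rel :: "('a + nat) set rel"
  where "long_rel \<equiv> cardSuc |UNIV :: ('a + nat) set|"

end

lemma long_rel_Card_order: "Card_order (long_rel :: ('a + nat) set rel)"
  by (simp add: cardSuc_Card_order card_of_Card_order)

lemma long_rel_infinite: "infinite (Field (long_rel :: ('a + nat) set rel))"
  unfolding cardSuc_finite[OF card_of_Card_order] Field_card_of by simp

lemma long_rel_regular: "regularCard (long_rel :: ('a + nat) set rel)"
  by (rule infinite_cardSuc_regularCard) (simp add: Field_card_of, rule card_of_Card_order)

lemma long_rel_order:
  fixes r :: "('a + nat) set rel"
  defines "r \<equiv> long_rel"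
  shows "\<And>x. x \<in> Field r \<Longrightarrow> (x, x) \<in> r"
    and "\<And>x y z. (x, y) \<in> r \<Longrightarrow> (y, z) \<in> r \<Longrightarrow> (x, z) \<in> r"
    and "\<And>x y. (x, y) \<in> r \<Longrightarrow> (y, x) \<in> r \<Longrightarrow> x = y"
    and "\<And>x y. x \<in> Field r \<Longrightarrow> y \<in> Field r \<Longrightarrow> (x, y) \<in> r \<or> (y, x) \<in> r"
    and "wf (r - Id)"
proof -
  have *: "Well_order r"
    using long_rel_Card_order unfolding r_def card_order_on_def by blast
  then show "wf (r - Id)" by (simp add: well_order_on_def)
  have "Refl r" "trans r" "antisym r" and "Total r"
    using * unfolding well_order_on_def linear_order_on_def partial_order_on_def preorder_on_def
    by blast+
  then show refl: "(x, x) \<in> r" if "x \<in> Field r" for x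
    using that by (blast dest: refl_onD)
  show "(x, z) \<in> r" if "(x, y) \<in> r" "(y, z) \<in> r" for x y z
    using \<open>trans r\<close> that by (blast dest: transD)
  show "x = y" if "(x, y) \<in> r" "(y, x) \<in> r" for x y
    using \<open>antisym r\<close> that by (blast dest: antisymD)
  show "(x, y) \<in> r \<or> (y, x) \<in> r" if "x \<in> Field r" "y \<in> Field r" for x y
  proof (cases "x = y")
    case True
    then show ?thesis using refl[OF that(1)] by simp
  next
    case False
    then show ?thesis using \<open>Total r\<close> that unfolding total_on_def by blast
  qed
qed

text \<open>The initial segment of the ordinals of length \<open>|'a + nat|\<^sup>+\<close>.\<close>

typedef 'a long_ord = "Field (long_rel :: ('a + nat) set rel)"
  using long_rel_infinite by (metis ex_in_conv finite.emptyI)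

instantiation long_ord :: (type) linorder
begin

definition less_eq_long_ord :: "'a long_ord \<Rightarrow> 'a long_ord \<Rightarrow> bool"
  where "x \<le> y \<longleftrightarrow> (Rep_long_ord x, Rep_long_ord y) \<in> long_rel" for x y :: "'a long_ord"

definition less_long_ord :: "'a long_ord \<Rightarrow> 'a long_ord \<Rightarrow> bool"
  where "x < y \<longleftrightarrow> x \<le> y \<and> x \<noteq> y" for x y :: "'a long_ord"

instance
proof
  fix x y z :: "'a long_ord"
  show anti: "x = y" if "x \<le> y" "y \<le> x"
    using that long_rel_order(3) unfolding less_eq_long_ord_def by (metis Rep_long_ord_inject)
  show "x < y \<longleftrightarrow> x \<le> y \<and> \<not> y \<le> x"
    using long_rel_order(3) long_rel_order(1)[OF Rep_long_ord]
    unfolding less_long_ord_def less_eq_long_ord_def by (metis Rep_long_ord_inject)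
  show "x \<le> x"
    unfolding less_eq_long_ord_def by (rule long_rel_order(1)[OF Rep_long_ord])
  show "x \<le> z" if "x \<le> y" "y \<le> z"
    using that unfolding less_eq_long_ord_def by (rule long_rel_order(2))
  show "x \<le> y \<or> y \<le> x"
    unfolding less_eq_long_ord_def by (rule long_rel_order(4)[OF Rep_long_ord Rep_long_ord])
qed

end

lemma less_long_ord_iff: "x < y \<longleftrightarrow> (Rep_long_ord x, Rep_long_ord y) \<in> long_rel - Id"
  by (auto simp: less_long_ord_def less_eq_long_ord_def Rep_long_ord_inject)

instance long_ord :: (type) wellorder
proof (rule wf_wellorderI)
  have "{(x, y :: 'a long_ord). x < y} = inv_image (long_rel - Id) Rep_long_ord"
    by (auto simp: less_long_ord_iff inv_image_def)
  then show "wf {(x, y :: 'a long_ord). x < y}"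
    using long_rel_order(5) by (metis wf_inv_image)
qed intro_classes

instance long_ord :: (type) ordinal
proof
  fix x :: "'a long_ord" and f :: "'a long_ord \<Rightarrow> 'a long_ord"
  let ?r = "long_rel :: ('a + nat) set rel"
  include cardinal_syntax
  obtain b where b: "b \<in> Field ?r" "Rep_long_ord x \<noteq> b" "(Rep_long_ord x, b) \<in> ?r"
    using infinite_Card_order_limit[OF long_rel_Card_order long_rel_infinite Rep_long_ord] by blast
  then have "x < Abs_long_ord b"
    by (simp add: less_long_ord_iff Abs_long_ord_inverse)
  then show "\<exists>y. x < y" ..
  define K where "K = Rep_long_ord ` f ` {..<x}"
  have "K = (\<lambda>u. Rep_long_ord (f (Abs_long_ord u))) ` Rep_long_ord ` {..<x}"
    by (simp add: K_def image_image Rep_long_ord_inverse)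
  then have "|K| \<le>o |Rep_long_ord ` {..<x}|" by (metis card_of_image)
  also have "|Rep_long_ord ` {..<x}| \<le>o |underS ?r (Rep_long_ord x)|"
    by (rule card_of_mono1) (auto simp: underS_def less_long_ord_iff)
  also have "|underS ?r (Rep_long_ord x)| <o ?r"
    by (rule card_of_underS[OF long_rel_Card_order Rep_long_ord])
  finally have "\<not> |K| =o ?r" by (rule not_ordLess_ordIso)
  moreover have "K \<subseteq> Field ?r" unfolding K_def using Rep_long_ord by blast
  ultimately have "\<not> cofinal K ?r"
    using long_rel_regular unfolding regularCard_def by blast
  then obtain a where a: "a \<in> Field ?r" "\<And>b. b \<in> K \<Longrightarrow> a = b \<or> (a, b) \<notin> ?r"
    unfolding cofinal_def by blast
  have "f z \<le> Abs_long_ord a" if "z < x" for z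
  proof -
    have "a = Rep_long_ord (f z) \<or> (a, Rep_long_ord (f z)) \<notin> ?r"
      using that by (intro a(2)) (auto simp: K_def)
    then have "(Rep_long_ord (f z), a) \<in> ?r"
      using long_rel_order(1)[OF a(1)] long_rel_order(4)[OF a(1) Rep_long_ord[of "f z"]] by metis
    then show ?thesis
      by (simp only: less_eq_long_ord_def Abs_long_ord_inverse[OF a(1)])
  qed
  then show "bdd_above (f ` {..<x})"
    unfolding bdd_above_def by blast
qed

end

theory Submission
  imports Defs
begin

text \<open>
  Part 1 at \<open>\<delta> + b\<close> for all \<open>b\<close> below \<open>x\<close> makes the translation \<open>y \<mapsto> \<delta> + y\<close> preserve and reflect
  both relations on \<open>(0, x]\<close>: coverings can be moved between the two intervals, and an ordinal
  \<open>a \<le> \<delta>\<close> can only be related to elements above \<open>\<delta>\<close> by \<open>\<le>\<^sub>1\<close>, a relation which is preserved when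
  those elements decrease. So part 2 follows from part 1.

  The hypothesis on \<open>\<alpha>\<close> provides cofinally many \<open>s < \<kappa>\<^sub>\<alpha>\<close> such that no \<open>a \<le> s\<close> is related to an
  ordinal above \<open>s\<close>. For these \<open>s\<close> the translation by \<open>s\<close> is an isomorphism without any restriction
  and \<open>s + \<kappa>\<^sub>\<alpha> = \<kappa>\<^sub>\<alpha>\<close>. Hence copies of every finite closed subset of \<open>(0, \<kappa>\<^sub>\<alpha>)\<close> occur cofinally below
  each nonzero multiple of \<open>\<kappa>\<^sub>\<alpha>\<close>. If \<open>a \<le>\<^sub>2 \<delta> + x\<close> with \<open>a \<le> \<delta>\<close> and \<open>0 < x < \<kappa>\<^sub>\<alpha>\<close>, then \<open>a\<close> is such a
  multiple, and \<open>\<le>\<^sub>2\<up>\<close> yields coverings of all these sets inside \<open>(0, x)\<close>. The least \<open>x\<close> admitting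
  them would satisfy \<open>x \<le>\<^sub>1 \<kappa>\<^sub>\<alpha>\<close>, contradicting the minimality of \<open>\<kappa>\<^sub>\<alpha>\<close>.
\<close>

section \<open>Ordinal arithmetic\<close>

text \<open>The translation breaks at its lower end: 0 is \<open>\<le>\<^sub>1\<close>-related to
  nothing else, whereas \<delta> may be related to ordinals above it. For the clauses that move sets
  down it is enough to adjoin 0 or \<delta> to the fixed part. The upward clause of
  \<open>\<le>\<^sub>2\<close> moves sets up, so relations from some a \<le> \<delta> do not survive
  by decrease. There a is related to cofinally many ordinals below \<delta> + x, hence to \<delta> +
  x, hence by transitivity to \<delta> + y and to everything between; points less than \<rho> above
  0 or \<delta> are left out and glued back afterwards. The ordinals s arise at successor indices.
  If \<open>kappa \<rho> (osuc \<gamma>)\<close> were a limit, \<open>kappa \<rho> \<gamma>\<close>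
  would be related to it. So it is \<theta> + 1 for some \<theta>, and s is \<theta> or the next
  multiple of \<rho>. As s \<le> \<theta> + \<rho>, staying below
  \<open>kappa \<rho> \<alpha>\<close> uses \<gamma> + \<rho> < \<alpha>, and the absorption of s by
  \<open>kappa \<rho> \<alpha>\<close> comes from comparing indices of minimal ordinals. Both rest
  on \<alpha> being closed under addition.\<close>

lemma oadd_less_cancel [simp]: "\<alpha> +\<^sub>o \<beta> < \<alpha> +\<^sub>o \<gamma> \<longleftrightarrow> \<beta> < (\<gamma>::'o::ordinal)"
  by (meson oadd_mono oadd_strict_mono leD leI)

lemma oadd_le_cancel [simp]: "\<alpha> +\<^sub>o \<beta> \<le> \<alpha> +\<^sub>o \<gamma> \<longleftrightarrow> \<beta> \<le> (\<gamma>::'o::ordinal)"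
  by (meson oadd_less_cancel leD leI)

lemma oadd_eq_cancel [simp]: "\<alpha> +\<^sub>o \<beta> = \<alpha> +\<^sub>o \<gamma> \<longleftrightarrow> \<beta> = (\<gamma>::'o::ordinal)"
  by (simp add: order_eq_iff)

lemma less_oadd_iff [simp]: "\<alpha> < \<alpha> +\<^sub>o \<beta> \<longleftrightarrow> \<zero>\<^sub>o < (\<beta>::'o::ordinal)"
  using oadd_less_cancel[of \<alpha> "\<zero>\<^sub>o" \<beta>] by (simp add: oadd_ozero)

lemma ozero_less_iff: "\<zero>\<^sub>o < (x::'o::ordinal) \<longleftrightarrow> x \<noteq> \<zero>\<^sub>o"
  using ozero_le[of x] by auto

lemma ozero_oadd [simp]: "\<zero>\<^sub>o +\<^sub>o x = (x::'o::ordinal)"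
proof (induction x rule: less_induct)
  case (less x)
  show ?case
  proof (rule antisym)
    show "\<zero>\<^sub>o +\<^sub>o x \<le> x" by (simp add: oadd_le_iff ozero_le less)
    show "x \<le> \<zero>\<^sub>o +\<^sub>o x"
      using less oadd_strict_mono[of _ x "\<zero>\<^sub>o"] by (metis leI order.irrefl)
  qed
qed

lemma le_oadd_right: "x \<le> \<alpha> +\<^sub>o (x::'o::ordinal)"
  using oadd_mono_left[OF ozero_le, of x \<alpha>] by simp

lemma ex_oadd:
  assumes "\<alpha> \<le> (\<beta>::'o::ordinal)"
  shows "\<exists>\<gamma>. \<beta> = \<alpha> +\<^sub>o \<gamma>"
proof -
  define \<gamma> where "\<gamma> = (LEAST \<gamma>. \<beta> \<le> \<alpha> +\<^sub>o \<gamma>)"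
  have "\<beta> \<le> \<alpha> +\<^sub>o \<gamma>" unfolding \<gamma>_def by (rule LeastI) (rule le_oadd_right)
  moreover have "\<alpha> +\<^sub>o \<gamma> \<le> \<beta>"
    unfolding oadd_le_iff using assms not_less_Least[of _ "\<lambda>\<gamma>. \<beta> \<le> \<alpha> +\<^sub>o \<gamma>"]
    by (auto simp: \<gamma>_def not_le)
  ultimately show ?thesis by (metis antisym)
qed

lemma oadd_assoc: "\<alpha> +\<^sub>o \<beta> +\<^sub>o \<gamma> = \<alpha> +\<^sub>o (\<beta> +\<^sub>o (\<gamma>::'o::ordinal))"
proof (induction \<gamma> rule: less_induct)
  case (less \<gamma>)
  show ?case
  proof (rule antisym)
    show "\<alpha> +\<^sub>o \<beta> +\<^sub>o \<gamma> \<le> \<alpha> +\<^sub>o (\<beta> +\<^sub>o \<gamma>)"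
      unfolding oadd_le_iff[of "\<alpha> +\<^sub>o \<beta>"] by (simp add: less le_oadd)
    have "\<alpha> +\<^sub>o \<epsilon> < \<alpha> +\<^sub>o \<beta> +\<^sub>o \<gamma>" if "\<epsilon> < \<beta> +\<^sub>o \<gamma>" for \<epsilon>
    proof (cases "\<epsilon> < \<beta>")
      case True
      then show ?thesis using le_oadd[of "\<alpha> +\<^sub>o \<beta>" \<gamma>] by (metis oadd_less_cancel order.strict_trans2)
    next
      case False
      then obtain \<zeta> where "\<epsilon> = \<beta> +\<^sub>o \<zeta>" using ex_oadd by (metis not_less)
      then show ?thesis using that less[of \<zeta>] by (metis oadd_less_cancel)
    qed
    then show "\<alpha> +\<^sub>o (\<beta> +\<^sub>o \<gamma>) \<le> \<alpha> +\<^sub>o \<beta> +\<^sub>o \<gamma>"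
      unfolding oadd_le_iff[of \<alpha> "\<beta> +\<^sub>o \<gamma>"] using le_oadd by (metis order.trans)
  qed
qed

lemma omul_oadd: "\<alpha> \<cdot>\<^sub>o (\<beta> +\<^sub>o \<gamma>) = \<alpha> \<cdot>\<^sub>o \<beta> +\<^sub>o \<alpha> \<cdot>\<^sub>o (\<gamma>::'o::ordinal)"
proof (induction \<gamma> rule: less_induct)
  case (less \<gamma>)
  show ?case
  proof (rule antisym)
    have "\<alpha> \<cdot>\<^sub>o \<epsilon> +\<^sub>o \<alpha> \<le> \<alpha> \<cdot>\<^sub>o \<beta> +\<^sub>o \<alpha> \<cdot>\<^sub>o \<gamma>" if "\<epsilon> < \<beta> +\<^sub>o \<gamma>" for \<epsilon>
    proof (cases "\<epsilon> < \<beta>")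
      case True
      then show ?thesis using omul_step le_oadd by (metis order.trans)
    next
      case False
      then obtain \<zeta> where "\<epsilon> = \<beta> +\<^sub>o \<zeta>" using ex_oadd by (metis not_less)
      then show ?thesis using that less[of \<zeta>] by (simp add: oadd_assoc omul_step)
    qed
    then show "\<alpha> \<cdot>\<^sub>o (\<beta> +\<^sub>o \<gamma>) \<le> \<alpha> \<cdot>\<^sub>o \<beta> +\<^sub>o \<alpha> \<cdot>\<^sub>o \<gamma>" unfolding omul_le_iff[of \<alpha> "\<beta> +\<^sub>o \<gamma>"] by blast
    have "\<alpha> \<cdot>\<^sub>o \<beta> +\<^sub>o \<epsilon> < \<alpha> \<cdot>\<^sub>o (\<beta> +\<^sub>o \<gamma>)" if \<epsilon>: "\<epsilon> < \<alpha> \<cdot>\<^sub>o \<gamma>" for \<epsilon>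
    proof -
      obtain \<zeta> where \<zeta>: "\<zeta> < \<gamma>" "\<epsilon> < \<alpha> \<cdot>\<^sub>o \<zeta> +\<^sub>o \<alpha>"
        using \<epsilon> omul_le_iff[of \<alpha> \<gamma> \<epsilon>] not_less by blast
      have "\<alpha> \<cdot>\<^sub>o \<beta> +\<^sub>o \<epsilon> < \<alpha> \<cdot>\<^sub>o (\<beta> +\<^sub>o \<zeta>) +\<^sub>o \<alpha>" using \<zeta> by (simp add: less oadd_assoc)
      also have "\<dots> \<le> \<alpha> \<cdot>\<^sub>o (\<beta> +\<^sub>o \<gamma>)" using \<zeta> by (intro omul_step) simp
      finally show ?thesis .
    qed
    then show "\<alpha> \<cdot>\<^sub>o \<beta> +\<^sub>o \<alpha> \<cdot>\<^sub>o \<gamma> \<le> \<alpha> \<cdot>\<^sub>o (\<beta> +\<^sub>o \<gamma>)"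
      unfolding oadd_le_iff[of "\<alpha> \<cdot>\<^sub>o \<beta>"] by (simp add: omul_mono le_oadd)
  qed
qed

lemma omul_strict_mono: "\<zero>\<^sub>o < \<alpha> \<Longrightarrow> \<beta> < \<gamma> \<Longrightarrow> \<alpha> \<cdot>\<^sub>o \<beta> < \<alpha> \<cdot>\<^sub>o (\<gamma>::'o::ordinal)"
  by (metis less_oadd_iff omul_step order.strict_trans2)

lemma omul_oone [simp]: "\<alpha> \<cdot>\<^sub>o \<one>\<^sub>o = (\<alpha>::'o::ordinal)"
  by (simp add: omul_osuc omul_ozero)

lemma ex_omul_oadd:
  assumes "\<zero>\<^sub>o < (\<alpha>::'o::ordinal)"
  shows "\<exists>\<zeta> \<epsilon>. x = \<alpha> \<cdot>\<^sub>o \<zeta> +\<^sub>o \<epsilon> \<and> \<epsilon> < \<alpha>"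
proof -
  have le: "y \<le> \<alpha> \<cdot>\<^sub>o y" for y
  proof (induction y rule: less_induct)
    case (less y)
    then show ?case using omul_strict_mono[OF assms] by (metis leI order.strict_iff_not)
  qed
  define \<zeta> where "\<zeta> = (LEAST \<zeta>. x < \<alpha> \<cdot>\<^sub>o \<zeta> +\<^sub>o \<alpha>)"
  have 1: "x < \<alpha> \<cdot>\<^sub>o \<zeta> +\<^sub>o \<alpha>"
    unfolding \<zeta>_def by (rule LeastI[of _ x]) (metis assms le le_less_trans less_oadd_iff)
  have "\<alpha> \<cdot>\<^sub>o \<zeta> \<le> x"
    unfolding omul_le_iff using not_less_Least[of _ "\<lambda>\<zeta>. x < \<alpha> \<cdot>\<^sub>o \<zeta> +\<^sub>o \<alpha>"]
    by (auto simp: \<zeta>_def not_less)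
  then obtain \<epsilon> where "x = \<alpha> \<cdot>\<^sub>o \<zeta> +\<^sub>o \<epsilon>" using ex_oadd by blast
  then show ?thesis using 1 by auto
qed

text \<open>Left subtraction. Its value is meaningful only for \<open>\<delta> \<le> y\<close>,
  which is tested or proved wherever the value matters.\<close>

definition osub :: "'o::ordinal \<Rightarrow> 'o \<Rightarrow> 'o"
  where "osub \<delta> y = (THE x. y = \<delta> +\<^sub>o x)"

lemma osub_oadd [simp]: "osub \<delta> (\<delta> +\<^sub>o x) = (x::'o::ordinal)"
  unfolding osub_def by (rule the_equality) auto

lemma oadd_osub: "\<delta> \<le> (y::'o::ordinal) \<Longrightarrow> \<delta> +\<^sub>o osub \<delta> y = y"
  using ex_oadd[of \<delta> y] by auto

section \<open>Floors with respect to \<open>\<rho>\<close>\<close>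

locale resemblance =
  fixes \<rho> :: "'o::ordinal"
  assumes indecomposable: "additively_indecomposable \<rho>"
begin

abbreviation mult :: "'o \<Rightarrow> bool" where "mult \<equiv> odvd \<rho>"

text \<open>At \<xi> = 0 a multiple of \<rho> is sent to itself and any other ordinal to the
  multiple below it, so this member of the family is the floor function.\<close>

abbreviation fl :: "'o \<Rightarrow> 'o" where "fl \<equiv> rfun \<rho> \<zero>\<^sub>o"

lemma \<rho>_pos: "\<zero>\<^sub>o < \<rho>"
  using indecomposable by (simp add: additively_indecomposable_def ozero_less_iff)

lemma mult_0 [simp]: "mult \<zero>\<^sub>o"
  unfolding odvd_def using omul_ozero by metis

lemma mult_\<rho> [simp]: "mult \<rho>"
  unfolding odvd_def by (metis omul_oone)

lemma mult_oadd: "mult \<sigma> \<Longrightarrow> mult \<tau> \<Longrightarrow> mult (\<sigma> +\<^sub>o \<tau>)"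
  unfolding odvd_def by (metis omul_oadd)

lemma fl_oadd [simp]: "mult \<sigma> \<Longrightarrow> \<epsilon> < \<rho> \<Longrightarrow> fl (\<sigma> +\<^sub>o \<epsilon>) = \<sigma>"
  using rfun_rest[of \<epsilon> \<rho> "\<zero>\<^sub>o"] rfun_mult[of \<rho> "\<zero>\<^sub>o"]
  by (cases "\<epsilon> = \<zero>\<^sub>o") (auto simp: odvd_def oadd_ozero ozero_less_iff)

lemma fl_cases:
  obtains \<sigma> \<epsilon> where "mult \<sigma>" "\<epsilon> < \<rho>" "x = \<sigma> +\<^sub>o \<epsilon>" "fl x = \<sigma>"
  using ex_omul_oadd[OF \<rho>_pos, of x] fl_oadd by (metis odvd_def)

lemma mult_fl [simp]: "mult (fl x)"
  by (rule fl_cases[of x]) simp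

lemma fl_le: "fl x \<le> x"
  by (rule fl_cases[of x]) (simp add: le_oadd)

lemma mult_iff_fl: "mult x \<longleftrightarrow> fl x = x"
  using fl_oadd[of x "\<zero>\<^sub>o"] \<rho>_pos mult_fl[of x] by (metis oadd_ozero)

lemma fl_mult: "mult x \<Longrightarrow> fl x = x"
  by (rule iffD1[OF mult_iff_fl])

lemma less_fl_oadd: "x < fl x +\<^sub>o \<rho>"
  by (rule fl_cases[of x]) simp

lemma rfun_eq: "rfun \<rho> \<xi> x = (if mult x then x +\<^sub>o \<xi> else fl x)"
  by (simp add: rfun_def)

lemma mult_less:
  assumes "mult \<sigma>" "mult \<tau>" "\<sigma> < \<tau>"
  shows "\<sigma> +\<^sub>o \<rho> \<le> \<tau>"
proof -
  obtain a b where ab: "\<sigma> = \<rho> \<cdot>\<^sub>o a" "\<tau> = \<rho> \<cdot>\<^sub>o b" using assms by (auto simp: odvd_def)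
  then have "a < b" using assms omul_mono[of b a \<rho>] by (meson leD leI)
  then show ?thesis using ab omul_step by simp
qed

lemma le_fl:
  assumes "mult \<sigma>" "\<sigma> \<le> x"
  shows "\<sigma> \<le> fl x"
proof (rule ccontr)
  assume "\<not> ?thesis"
  then have "fl x +\<^sub>o \<rho> \<le> \<sigma>" using assms by (intro mult_less) auto
  then show False using less_fl_oadd[of x] assms by simp
qed

lemma fl_translate: "mult \<delta> \<Longrightarrow> fl (\<delta> +\<^sub>o x) = \<delta> +\<^sub>o fl x"
  by (rule fl_cases[of x]) (simp add: mult_oadd flip: oadd_assoc)

lemma mult_translate: "mult \<delta> \<Longrightarrow> mult (\<delta> +\<^sub>o x) \<longleftrightarrow> mult x"
  by (simp add: mult_iff_fl[of x] mult_iff_fl[of "\<delta> +\<^sub>o x"] fl_translate)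

lemma rfun_translate: "mult \<delta> \<Longrightarrow> rfun \<rho> \<xi> (\<delta> +\<^sub>o x) = \<delta> +\<^sub>o rfun \<rho> \<xi> x"
  by (simp add: rfun_eq[of \<xi>] mult_translate fl_translate oadd_assoc)

lemma not_mult_less: "\<zero>\<^sub>o < x \<Longrightarrow> x < \<rho> \<Longrightarrow> \<not> mult x"
  using mult_less[of "\<zero>\<^sub>o" x] by auto

lemma rclosed_iff: "rclosed \<rho> X \<longleftrightarrow> (\<forall>x\<in>X. fl x \<in> X)"
proof
  assume *: "rclosed \<rho> X"
  show "\<forall>x\<in>X. fl x \<in> X"
  proof
    fix x assume "x \<in> X"
    then show "fl x \<in> X" using * by (rule_tac fl_cases[of x]) (auto simp: rclosed_def)
  qed
qed (auto simp: rclosed_def)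

section \<open>Coverings\<close>

abbreviation R1 :: "'o \<Rightarrow> 'o \<Rightarrow> bool" where "R1 \<equiv> le1 \<rho>"

abbreviation R2 :: "'o \<Rightarrow> 'o \<Rightarrow> bool" where "R2 \<equiv> le2 \<rho>"

abbreviation cov :: "('o \<Rightarrow> 'o) \<Rightarrow> 'o set \<Rightarrow> bool" where "cov \<equiv> covering_map \<rho> R1 R2"

lemma covI:
  assumes "\<And>x y. x \<in> X \<Longrightarrow> y \<in> X \<Longrightarrow> x < y \<Longrightarrow> h x < h y"
    and "\<And>x y \<xi>. x \<in> X \<Longrightarrow> y \<in> X \<Longrightarrow> \<xi> < \<rho> \<Longrightarrow> rfun \<rho> \<xi> x = y \<longleftrightarrow> rfun \<rho> \<xi> (h x) = h y"
    and "\<And>x y. x \<in> X \<Longrightarrow> y \<in> X \<Longrightarrow> R1 x y \<Longrightarrow> R1 (h x) (h y)"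
    and "\<And>x y. x \<in> X \<Longrightarrow> y \<in> X \<Longrightarrow> R2 x y \<Longrightarrow> R2 (h x) (h y)"
  shows "cov h X"
  using assms unfolding covering_map_def by (auto intro!: strict_mono_onI)

lemma
  assumes "cov h X" "x \<in> X" "y \<in> X"
  shows cov_mono: "x < y \<Longrightarrow> h x < h y"
    and cov_rfun: "\<xi> < \<rho> \<Longrightarrow> rfun \<rho> \<xi> x = y \<longleftrightarrow> rfun \<rho> \<xi> (h x) = h y"
    and cov_R1: "R1 x y \<Longrightarrow> R1 (h x) (h y)"
    and cov_R2: "R2 x y \<Longrightarrow> R2 (h x) (h y)"
  using assms unfolding covering_map_def strict_mono_on_def by auto

lemma cov_less_iff: "cov h X \<Longrightarrow> x \<in> X \<Longrightarrow> y \<in> X \<Longrightarrow> h x < h y \<longleftrightarrow> x < y"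
  by (metis cov_mono less_asym' linorder_neqE)

lemma cov_inj: "cov h X \<Longrightarrow> inj_on h X"
  by (metis cov_mono inj_onI less_irrefl linorder_neqE)

lemma cov_id: "cov (\<lambda>x. x) X"
  by (rule covI) auto

lemma cov_subset: "cov h X \<Longrightarrow> Y \<subseteq> X \<Longrightarrow> cov h Y"
  by (rule covI) (auto dest: cov_mono cov_R1 cov_R2 simp: cov_rfun subset_iff)

lemma cov_comp: "cov h X \<Longrightarrow> cov g (h ` X) \<Longrightarrow> cov (\<lambda>x. g (h x)) X"
  by (rule covI) (auto dest: cov_mono cov_R1 cov_R2 simp: cov_rfun)

lemma cov_cong: "(\<And>x. x \<in> X \<Longrightarrow> h x = g x) \<Longrightarrow> cov h X \<longleftrightarrow> cov g X"
  unfolding covering_map_def strict_mono_on_def by (auto; metis)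

lemma cov_fl: "cov h X \<Longrightarrow> rclosed \<rho> X \<Longrightarrow> x \<in> X \<Longrightarrow> fl (h x) = h (fl x)"
  using cov_rfun[of h X x "fl x" "\<zero>\<^sub>o"] \<rho>_pos by (auto simp: rclosed_iff)

lemma cov_mult: "cov h X \<Longrightarrow> x \<in> X \<Longrightarrow> mult (h x) \<longleftrightarrow> mult x"
  using cov_rfun[of h X x x "\<zero>\<^sub>o"] \<rho>_pos by (auto simp: mult_iff_fl)

lemma cov_closed: "cov h X \<Longrightarrow> rclosed \<rho> X \<Longrightarrow> rclosed \<rho> (h ` X)"
  using cov_fl unfolding rclosed_iff by auto

text \<open>X is an initial segment of both sides, so the increasing bijection matches it with
  itself, and on a well-ordered set only the identity does that. This lets the ranges in the
  definitions be replaced by maps that fix X.\<close>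

lemma cov_fixed:
  assumes h: "cov h (X \<union> Y)" "h ` (X \<union> Y) = X \<union> Y'" and less: "set_less X Y" "set_less X Y'"
  shows "x \<in> X \<Longrightarrow> h x = x" and "h ` Y = Y'"
proof -
  have fixed: "h x = x" if "x \<in> X" for x
    using that
  proof (induction x rule: less_induct)
    case (less x)
    have IH: "h z = z" if "z < x" "z \<in> X \<union> Y" for z
    proof -
      have "z \<in> X" using that less.prems assms(3) by (meson UnE less_asym' set_less_def)
      then show ?thesis using less.IH that by blast
    qed
    have "x \<in> h ` (X \<union> Y)" unfolding h(2) using less.prems by simp
    then obtain z where z: "z \<in> X \<union> Y" "h z = x" by blast
    have "\<not> z < x" using IH z by (metis less_irrefl)
    moreover have "\<not> x < z"
    proof
      assume "x < z"
      \<comment> \<open>Then \<open>h x\<close> is a smaller element of X, hence already known to be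
        fixed, although monotonicity moves it strictly down.\<close>
      then have *: "h x < x" using cov_mono[OF h(1), of x z] z less.prems by auto
      moreover have "h x \<in> X \<union> Y'" using less.prems by (simp flip: h(2))
      ultimately have "h x \<in> X" using less.prems assms(4) by (meson UnE less_asym' set_less_def)
      then have "h (h x) = h x" "h (h x) < h x" using * IH cov_mono[OF h(1), of "h x" x] less.prems by auto
      then show False by simp
    qed
    ultimately show ?case using z by (metis linorder_neqE)
  qed
  then show "x \<in> X \<Longrightarrow> h x = x" .
  have "X \<inter> h ` Y = {}"
    using fixed cov_mono[OF h(1)] assms(3) unfolding set_less_def by fastforce
  moreover have "X \<inter> Y' = {}" using assms(4) by (auto simp: set_less_def)
  moreover have "X \<union> h ` Y = X \<union> Y'" using h(2) fixed by (simp add: image_Un)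
  ultimately show "h ` Y = Y'" by blast
qed

lemma is_covering_iff:
  assumes "set_less X Y" "set_less X Y'"
  shows "is_covering \<rho> (X \<union> Y') (X \<union> Y) \<longleftrightarrow> (\<exists>h. cov h (X \<union> Y) \<and> (\<forall>x\<in>X. h x = x) \<and> h ` Y = Y')"
proof
  assume "is_covering \<rho> (X \<union> Y') (X \<union> Y)"
  then obtain h where "cov h (X \<union> Y)" "h ` (X \<union> Y) = X \<union> Y'" by (auto simp: covering_of_def)
  then show "\<exists>h. cov h (X \<union> Y) \<and> (\<forall>x\<in>X. h x = x) \<and> h ` Y = Y'" using cov_fixed[of h X Y Y'] assms by blast
qed (force simp: covering_of_def image_Un)

lemma cov_set_less:
  assumes "cov h (X \<union> Y)" "\<forall>x\<in>X. h x = x" "set_less X Y"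
  shows "set_less X (h ` Y)"
  using assms cov_mono[OF assms(1)] unfolding set_less_def by fastforce

text \<open>Maps compose and restrict, ranges do not. The condition \<open>set_less X Y'\<close>
  drops out because a covering that fixes X sends Y, which lies above X, to a set above X.\<close>

lemma le1_map_iff:
  "R1 \<alpha> \<beta> \<longleftrightarrow> \<alpha> \<le> \<beta> \<and>
     (\<forall>X Y. finite X \<and> X \<subseteq> {..<\<alpha>} \<and> finite Y \<and> Y \<subseteq> {\<alpha>..<\<beta>} \<and> rclosed \<rho> (X \<union> Y) \<longrightarrow>
       (\<exists>h. cov h (X \<union> Y) \<and> (\<forall>x\<in>X. h x = x) \<and> (\<forall>y\<in>Y. h y < \<alpha>)))"
proof -
  have "(\<exists>Y'. finite Y' \<and> Y' \<subseteq> {..<\<alpha>} \<and> set_less X Y' \<and> is_covering \<rho> (X \<union> Y') (X \<union> Y)) \<longleftrightarrow>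
      (\<exists>h. cov h (X \<union> Y) \<and> (\<forall>x\<in>X. h x = x) \<and> (\<forall>y\<in>Y. h y < \<alpha>))" (is "?L \<longleftrightarrow> ?R")
    if *: "finite X \<and> X \<subseteq> {..<\<alpha>} \<and> finite Y \<and> Y \<subseteq> {\<alpha>..<\<beta>} \<and> rclosed \<rho> (X \<union> Y)" for X Y
  proof -
    have less: "set_less X Y" and fin: "finite Y" using * by (force simp: set_less_def)+
    show ?thesis
    proof
      assume ?L
      then obtain Y' where Y': "Y' \<subseteq> {..<\<alpha>}" "set_less X Y'" "is_covering \<rho> (X \<union> Y') (X \<union> Y)"
        by blast
      then obtain h where "cov h (X \<union> Y)" "\<forall>x\<in>X. h x = x" "h ` Y = Y'"
        unfolding is_covering_iff[OF less Y'(2)] by blast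
      then show ?R using Y' by (intro exI[of _ h]) auto
    next
      assume ?R
      then obtain h where h: "cov h (X \<union> Y)" "\<forall>x\<in>X. h x = x" "\<forall>y\<in>Y. h y < \<alpha>" by blast
      then show ?L using fin cov_set_less[OF h(1,2) less]
          is_covering_iff[OF less cov_set_less[OF h(1,2) less]]
        by (intro exI[of _ "h ` Y"]) auto
    qed
  qed
  note * = this
  show ?thesis
    by (subst le1_iff, rule conj_cong[OF refl], rule all_cong1, rule all_cong1, rule imp_cong[OF refl], rule *)
qed

text \<open>Coverings are increasing, so they commute with taking the i-th element; this removes the
  indices from the last clause of \<open>le2_down\<close>.\<close>

lemma sorted_list_of_set_image:
  assumes "cov h (X \<union> Y)" "finite Y"
  shows "sorted_list_of_set (h ` Y) = map h (sorted_list_of_set Y)"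
proof -
  have inj: "inj_on h Y" using cov_inj[OF assms(1)] by (rule inj_on_subset) auto
  have "sorted_wrt (<) (map h (sorted_list_of_set Y))"
    unfolding sorted_wrt_map
    by (rule sorted_wrt_mono_rel[OF _ strict_sorted_list_of_set])
      (use assms in \<open>auto dest: cov_mono\<close>)
  then show ?thesis
    using assms(2) by (intro strict_sorted_equal) auto
qed

lemma le2_down_map_iff:
  assumes "\<alpha> \<le> \<beta>"
  shows "le2_down \<rho> \<alpha> \<beta> \<longleftrightarrow>
     (\<forall>X Y. finite X \<and> X \<subseteq> {..<\<alpha>} \<and> finite Y \<and> Y \<subseteq> {\<alpha>..<\<beta>} \<and> rclosed \<rho> (X \<union> Y) \<longrightarrow>
       (\<exists>h. cov h (X \<union> Y) \<and> (\<forall>x\<in>X. h x = x) \<and> (\<forall>y\<in>Y. h y < \<alpha>) \<and> (\<forall>y\<in>Y. R1 y \<beta> \<longrightarrow> R1 (h y) \<alpha>)))"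
proof -
  have nth: "(\<forall>i<card Y. R1 (sorted_list_of_set Y ! i) \<beta> \<longrightarrow> R1 (sorted_list_of_set (h ` Y) ! i) \<alpha>) \<longleftrightarrow>
      (\<forall>y\<in>Y. R1 y \<beta> \<longrightarrow> R1 (h y) \<alpha>)" if "cov h (X \<union> Y)" "finite Y" for h X Y
  proof -
    have "(\<forall>y\<in>set (sorted_list_of_set Y). R1 y \<beta> \<longrightarrow> R1 (h y) \<alpha>) \<longleftrightarrow>
      (\<forall>i<card Y. R1 (sorted_list_of_set Y ! i) \<beta> \<longrightarrow> R1 (h (sorted_list_of_set Y ! i)) \<alpha>)"
      by (simp only: all_set_conv_all_nth sorted_list_of_set.length_sorted_key_list_of_set)
    then show ?thesis using that by (simp add: sorted_list_of_set_image[OF that])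
  qed
  have "(\<exists>Y'. finite Y' \<and> Y' \<subseteq> {..<\<alpha>} \<and> set_less X Y' \<and> is_covering \<rho> (X \<union> Y') (X \<union> Y) \<and>
        (\<forall>i<card Y. R1 (sorted_list_of_set Y ! i) \<beta> \<longrightarrow> R1 (sorted_list_of_set Y' ! i) \<alpha>)) \<longleftrightarrow>
      (\<exists>h. cov h (X \<union> Y) \<and> (\<forall>x\<in>X. h x = x) \<and> (\<forall>y\<in>Y. h y < \<alpha>) \<and> (\<forall>y\<in>Y. R1 y \<beta> \<longrightarrow> R1 (h y) \<alpha>))"
      (is "?L \<longleftrightarrow> ?R")
    if *: "finite X \<and> X \<subseteq> {..<\<alpha>} \<and> finite Y \<and> Y \<subseteq> {\<alpha>..<\<beta>} \<and> rclosed \<rho> (X \<union> Y)" for X Y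
  proof -
    have less: "set_less X Y" and fin: "finite Y" using * by (force simp: set_less_def)+
    show ?thesis
    proof
      assume ?L
      then obtain Y' where Y': "Y' \<subseteq> {..<\<alpha>}" "set_less X Y'" "is_covering \<rho> (X \<union> Y') (X \<union> Y)"
        "\<forall>i<card Y. R1 (sorted_list_of_set Y ! i) \<beta> \<longrightarrow> R1 (sorted_list_of_set Y' ! i) \<alpha>" by blast
      then obtain h where h: "cov h (X \<union> Y)" "\<forall>x\<in>X. h x = x" "h ` Y = Y'"
        unfolding is_covering_iff[OF less Y'(2)] by blast
      then show ?R using Y' nth[OF h(1) fin] by (intro exI[of _ h]) auto
    next
      assume ?R
      then obtain h where h: "cov h (X \<union> Y)" "\<forall>x\<in>X. h x = x" "\<forall>y\<in>Y. h y < \<alpha>"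
        "\<forall>y\<in>Y. R1 y \<beta> \<longrightarrow> R1 (h y) \<alpha>" by blast
      then show ?L using fin cov_set_less[OF h(1,2) less] nth[OF h(1) fin]
          is_covering_iff[OF less cov_set_less[OF h(1,2) less]]
        by (intro exI[of _ "h ` Y"]) auto
    qed
  qed
  note * = this
  show ?thesis
    unfolding le2_down_def by (rule all_cong1, rule all_cong1, rule imp_cong[OF refl], rule *)
qed

definition cofinal_covers :: "'o \<Rightarrow> 'o set \<Rightarrow> 'o set \<Rightarrow> bool"
  where "cofinal_covers \<eta> X Y \<longleftrightarrow>
    (\<forall>\<gamma><\<eta>. \<exists>h. cov h (X \<union> Y) \<and> (\<forall>x\<in>X. h x = x) \<and> (\<forall>y\<in>Y. \<gamma> < h y \<and> h y < \<eta>))"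

lemma cofinally_many_iff:
  assumes "finite X" "X \<subseteq> {..<\<eta>}" "finite Y" "set_less X Y"
  shows "cofinally_many \<eta> (\<lambda>Y'. is_covering \<rho> (X \<union> Y') (X \<union> Y)) \<longleftrightarrow> cofinal_covers \<eta> X Y"
proof
  assume L: "cofinally_many \<eta> (\<lambda>Y'. is_covering \<rho> (X \<union> Y') (X \<union> Y))"
  show "cofinal_covers \<eta> X Y"
    unfolding cofinal_covers_def
  proof (intro allI impI)
    fix \<gamma> assume "\<gamma> < \<eta>"
    \<comment> \<open>The sets provided by the hypothesis only lie above the given bound; raising
      the bound to the maximum of X puts them above X, so that the covering fixes X.\<close>
    define \<gamma>' where "\<gamma>' = Max (insert \<gamma> X)"
    have \<gamma>': "\<gamma>' < \<eta>" "\<gamma> \<le> \<gamma>'" "\<forall>x\<in>X. x \<le> \<gamma>'" using assms \<open>\<gamma> < \<eta>\<close> by (auto simp: \<gamma>'_def)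
    obtain Y' where Y': "Y' \<subseteq> {\<gamma>'<..<\<eta>}" "is_covering \<rho> (X \<union> Y') (X \<union> Y)"
      using L \<gamma>'(1) by (auto simp: cofinally_many_def)
    have less: "set_less X Y'" using Y' \<gamma>' by (fastforce simp: set_less_def)
    obtain h where "cov h (X \<union> Y)" "\<forall>x\<in>X. h x = x" "h ` Y = Y'"
      using Y'(2) unfolding is_covering_iff[OF assms(4) less] by blast
    then show "\<exists>h. cov h (X \<union> Y) \<and> (\<forall>x\<in>X. h x = x) \<and> (\<forall>y\<in>Y. \<gamma> < h y \<and> h y < \<eta>)"
      using Y' \<gamma>' by (intro exI[of _ h]) force
  qed
next
  assume R: "cofinal_covers \<eta> X Y"
  show "cofinally_many \<eta> (\<lambda>Y'. is_covering \<rho> (X \<union> Y') (X \<union> Y))"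
    unfolding cofinally_many_def
  proof (intro allI impI)
    fix \<gamma> assume "\<gamma> < \<eta>"
    then obtain h where h: "cov h (X \<union> Y)" "\<forall>x\<in>X. h x = x" "\<forall>y\<in>Y. \<gamma> < h y \<and> h y < \<eta>"
      using R by (auto simp: cofinal_covers_def)
    then show "\<exists>Y'. finite Y' \<and> Y' \<subseteq> {\<gamma><..<\<eta>} \<and> is_covering \<rho> (X \<union> Y') (X \<union> Y)"
      using is_covering_iff[OF assms(4) cov_set_less[OF h(1,2) assms(4)]] assms(3)
      by (intro exI[of _ "h ` Y"]) auto
  qed
qed

lemma le2_up_map_iff:
  assumes "\<alpha> \<le> \<beta>"
  shows "le2_up \<rho> \<alpha> \<beta> \<longleftrightarrow>
     (\<forall>X Y. finite X \<and> X \<subseteq> {..<\<alpha>} \<and> finite Y \<and> Y \<subseteq> {..<\<alpha>} \<and> rclosed \<rho> (X \<union> Y) \<and> set_less X Y \<longrightarrow>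
       cofinal_covers \<alpha> X Y \<longrightarrow> cofinal_covers \<beta> X Y)"
proof -
  have "(cofinally_many \<alpha> (\<lambda>Y'. is_covering \<rho> (X \<union> Y') (X \<union> Y)) \<longrightarrow>
        cofinally_many \<beta> (\<lambda>Y'. is_covering \<rho> (X \<union> Y') (X \<union> Y))) \<longleftrightarrow>
      (cofinal_covers \<alpha> X Y \<longrightarrow> cofinal_covers \<beta> X Y)"
    if "finite X \<and> X \<subseteq> {..<\<alpha>} \<and> finite Y \<and> Y \<subseteq> {..<\<alpha>} \<and> rclosed \<rho> (X \<union> Y) \<and> set_less X Y" for X Y
    using that assms
    by (subst (1 2) cofinally_many_iff) auto
  note * = this
  show ?thesis
    unfolding le2_up_def by (rule all_cong1, rule all_cong1, rule imp_cong[OF refl], rule *)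
qed

section \<open>Basic properties of the two relations\<close>

lemma le1_le: "R1 \<alpha> \<beta> \<Longrightarrow> \<alpha> \<le> \<beta>"
  by (subst (asm) le1_iff) blast

lemma le2_le: "R2 \<alpha> \<beta> \<Longrightarrow> \<alpha> \<le> \<beta>"
  by (subst (asm) le2_iff) blast

lemma le1I:
  assumes "\<alpha> \<le> \<beta>"
    and "\<And>X Y. finite X \<Longrightarrow> X \<subseteq> {..<\<alpha>} \<Longrightarrow> finite Y \<Longrightarrow> Y \<subseteq> {\<alpha>..<\<beta>} \<Longrightarrow> rclosed \<rho> (X \<union> Y) \<Longrightarrow>
      \<exists>h. cov h (X \<union> Y) \<and> (\<forall>x\<in>X. h x = x) \<and> (\<forall>y\<in>Y. h y < \<alpha>)"
  shows "R1 \<alpha> \<beta>"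
  by (subst le1_map_iff) (use assms in blast)

lemma le1_cover:
  assumes "R1 \<alpha> \<beta>" "finite X" "X \<subseteq> {..<\<alpha>}" "finite Y" "Y \<subseteq> {\<alpha>..<\<beta>}" "rclosed \<rho> (X \<union> Y)"
  obtains h where "cov h (X \<union> Y)" "\<And>x. x \<in> X \<Longrightarrow> h x = x" "\<And>y. y \<in> Y \<Longrightarrow> h y < \<alpha>"
proof -
  have "\<exists>h. cov h (X \<union> Y) \<and> (\<forall>x\<in>X. h x = x) \<and> (\<forall>y\<in>Y. h y < \<alpha>)"
    by (rule iffD1[OF le1_map_iff assms(1), THEN conjunct2, rule_format]) (intro conjI assms(2-))
  then show ?thesis using that by blast
qed

lemma le2I:
  assumes "\<alpha> \<le> \<beta>"
    and "\<And>X Y. finite X \<Longrightarrow> X \<subseteq> {..<\<alpha>} \<Longrightarrow> finite Y \<Longrightarrow> Y \<subseteq> {..<\<alpha>} \<Longrightarrow> rclosed \<rho> (X \<union> Y) \<Longrightarrow>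
      set_less X Y \<Longrightarrow> cofinal_covers \<alpha> X Y \<Longrightarrow> cofinal_covers \<beta> X Y"
    and "\<And>X Y. finite X \<Longrightarrow> X \<subseteq> {..<\<alpha>} \<Longrightarrow> finite Y \<Longrightarrow> Y \<subseteq> {\<alpha>..<\<beta>} \<Longrightarrow> rclosed \<rho> (X \<union> Y) \<Longrightarrow>
      \<exists>h. cov h (X \<union> Y) \<and> (\<forall>x\<in>X. h x = x) \<and> (\<forall>y\<in>Y. h y < \<alpha>) \<and> (\<forall>y\<in>Y. R1 y \<beta> \<longrightarrow> R1 (h y) \<alpha>)"
  shows "R2 \<alpha> \<beta>"
proof -
  have "le2_up \<rho> \<alpha> \<beta>" by (subst le2_up_map_iff[OF assms(1)]) (use assms(2) in blast)
  moreover have "le2_down \<rho> \<alpha> \<beta>" by (subst le2_down_map_iff[OF assms(1)]) (use assms(3) in blast)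
  ultimately show ?thesis using assms(1) by (subst le2_iff) blast
qed

lemma le2_cofinal_covers:
  assumes "R2 \<alpha> \<beta>" "finite X" "X \<subseteq> {..<\<alpha>}" "finite Y" "Y \<subseteq> {..<\<alpha>}" "rclosed \<rho> (X \<union> Y)"
    "set_less X Y" "cofinal_covers \<alpha> X Y"
  shows "cofinal_covers \<beta> X Y"
proof -
  have "le2_up \<rho> \<alpha> \<beta>" using assms(1) by (subst (asm) le2_iff) blast
  then show ?thesis
    by (rule iffD1[OF le2_up_map_iff[OF le2_le[OF assms(1)]], rule_format]) (intro conjI assms(2-))+
qed

lemma le2_cover:
  assumes "R2 \<alpha> \<beta>" "finite X" "X \<subseteq> {..<\<alpha>}" "finite Y" "Y \<subseteq> {\<alpha>..<\<beta>}" "rclosed \<rho> (X \<union> Y)"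
  obtains h where "cov h (X \<union> Y)" "\<And>x. x \<in> X \<Longrightarrow> h x = x" "\<And>y. y \<in> Y \<Longrightarrow> h y < \<alpha>"
    "\<And>y. y \<in> Y \<Longrightarrow> R1 y \<beta> \<Longrightarrow> R1 (h y) \<alpha>"
proof -
  have "le2_down \<rho> \<alpha> \<beta>" using assms(1) by (subst (asm) le2_iff) blast
  then have "\<exists>h. cov h (X \<union> Y) \<and> (\<forall>x\<in>X. h x = x) \<and> (\<forall>y\<in>Y. h y < \<alpha>) \<and>
      (\<forall>y\<in>Y. R1 y \<beta> \<longrightarrow> R1 (h y) \<alpha>)"
    by (rule iffD1[OF le2_down_map_iff[OF le2_le[OF assms(1)]], rule_format]) (intro conjI assms(2-))
  then show ?thesis using that by blast
qed

lemma le1_refl [simp]: "R1 \<alpha> \<alpha>"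
  by (rule le1I) (auto intro!: exI[of _ "\<lambda>x. x"] cov_id)

lemma le2_refl [simp]: "R2 \<alpha> \<alpha>"
  by (rule le2I) (auto intro!: exI[of _ "\<lambda>x. x"] cov_id)

lemma le2_imp_le1:
  assumes "R2 \<alpha> \<beta>"
  shows "R1 \<alpha> \<beta>"
proof (rule le1I)
  show "\<alpha> \<le> \<beta>" by (rule le2_le[OF assms])
  fix X Y assume "finite X" "X \<subseteq> {..<\<alpha>}" "finite Y" "Y \<subseteq> {\<alpha>..<\<beta>}" "rclosed \<rho> (X \<union> Y)"
  then show "\<exists>h. cov h (X \<union> Y) \<and> (\<forall>x\<in>X. h x = x) \<and> (\<forall>y\<in>Y. h y < \<alpha>)"
    by (rule le2_cover[OF assms]) metis
qed

lemma le1_between: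
  assumes "R1 \<alpha> \<beta>" "\<alpha> \<le> \<gamma>" "\<gamma> \<le> \<beta>"
  shows "R1 \<alpha> \<gamma>"
proof (rule le1I)
  fix X Y assume *: "finite X" "X \<subseteq> {..<\<alpha>}" "finite Y" "Y \<subseteq> {\<alpha>..<\<gamma>}" "rclosed \<rho> (X \<union> Y)"
  have "Y \<subseteq> {\<alpha>..<\<beta>}" by (rule order.trans[OF *(4)]) (use assms(3) in auto)
  then show "\<exists>h. cov h (X \<union> Y) \<and> (\<forall>x\<in>X. h x = x) \<and> (\<forall>y\<in>Y. h y < \<alpha>)"
    using le1_cover[OF assms(1) *(1-3) _ *(5)] by metis
qed (rule assms)

text \<open>A finite Y below \<beta> already lies below some \<gamma> < \<beta> to which \<alpha> is
  related. The hypothesis forces \<beta> to be a limit, which \<open>ex_sep\<close> exploits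
  contrapositively.\<close>

lemma le1_limit:
  assumes "\<alpha> < \<beta>" "\<And>\<gamma>. \<gamma> < \<beta> \<Longrightarrow> \<exists>\<gamma>'. \<gamma> < \<gamma>' \<and> \<gamma>' < \<beta> \<and> R1 \<alpha> \<gamma>'"
  shows "R1 \<alpha> \<beta>"
proof (rule le1I)
  fix X Y assume *: "finite X" "X \<subseteq> {..<\<alpha>}" "finite Y" "Y \<subseteq> {\<alpha>..<\<beta>}" "rclosed \<rho> (X \<union> Y)"
  have "Max (insert \<alpha> Y) < \<beta>" using * assms(1) by auto
  then obtain \<gamma> where \<gamma>: "Max (insert \<alpha> Y) < \<gamma>" "\<gamma> < \<beta>" "R1 \<alpha> \<gamma>" using assms(2) by blast
  have "Y \<subseteq> {\<alpha>..<\<gamma>}" using \<gamma>(1) * by auto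
  then show "\<exists>h. cov h (X \<union> Y) \<and> (\<forall>x\<in>X. h x = x) \<and> (\<forall>y\<in>Y. h y < \<alpha>)"
    using le1_cover[OF \<gamma>(3) *(1-3) _ *(5)] by metis
qed (use assms in simp)

text \<open>Two moves: the part of Y in [\<beta>, \<gamma>) goes below \<beta> with the rest fixed,
  then whatever now lies in [\<alpha>, \<beta>) goes below \<alpha>.\<close>

lemma le1_trans:
  assumes "R1 \<alpha> \<beta>" "R1 \<beta> \<gamma>"
  shows "R1 \<alpha> \<gamma>"
proof (rule le1I)
  show "\<alpha> \<le> \<gamma>" using assms le1_le by (meson order.trans)
  fix X Y assume *: "finite X" "X \<subseteq> {..<\<alpha>}" "finite Y" "Y \<subseteq> {\<alpha>..<\<gamma>}" "rclosed \<rho> (X \<union> Y)"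
  define U V where "U = X \<union> (Y \<inter> {..<\<beta>})" and "V = Y \<inter> {\<beta>..}"
  have UV: "U \<union> V = X \<union> Y" by (auto simp: U_def V_def)
  have "finite U" "U \<subseteq> {..<\<beta>}" "finite V" "V \<subseteq> {\<beta>..<\<gamma>}"
    using * le1_le[OF assms(1)] by (auto simp: U_def V_def)
  then obtain g where g: "cov g (U \<union> V)" "\<And>x. x \<in> U \<Longrightarrow> g x = x" "\<And>y. y \<in> V \<Longrightarrow> g y < \<beta>"
    using le1_cover[OF assms(2)] * UV by metis
  have lt: "g z < \<beta>" if "z \<in> X \<union> Y" for z
    using g that \<open>U \<subseteq> {..<\<beta>}\<close> unfolding UV[symmetric] by auto
  define Z where "Z = g ` (X \<union> Y)"
  have Z: "finite Z" "rclosed \<rho> Z" "Z \<subseteq> {..<\<beta>}"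
    using * g cov_closed[OF g(1)] lt UV by (auto simp: Z_def)
  have Zs: "Z = (Z \<inter> {..<\<alpha>}) \<union> (Z \<inter> {\<alpha>..})" by auto
  obtain h where h: "cov h (Z \<inter> {..<\<alpha>} \<union> Z \<inter> {\<alpha>..})" "\<And>x. x \<in> Z \<inter> {..<\<alpha>} \<Longrightarrow> h x = x"
    "\<And>y. y \<in> Z \<inter> {\<alpha>..} \<Longrightarrow> h y < \<alpha>"
    by (rule le1_cover[OF assms(1), of "Z \<inter> {..<\<alpha>}" "Z \<inter> {\<alpha>..}"]) (use Z Zs in \<open>auto\<close>)
  have hg: "cov (\<lambda>x. h (g x)) (X \<union> Y)"
    by (rule cov_comp[OF g(1)[unfolded UV]]) (use h(1) in \<open>simp only: Zs[symmetric] Z_def[symmetric]\<close>)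
  have X: "h (g x) = x" if "x \<in> X" for x
  proof -
    have "g x = x" using that g(2) by (auto simp: U_def)
    moreover have "g x \<in> Z" using that by (auto simp: Z_def)
    ultimately show ?thesis using h(2) that *(2) by auto
  qed
  have Y: "h (g y) < \<alpha>" if "y \<in> Y" for y
  proof -
    have "g y \<in> Z" using that by (auto simp: Z_def)
    then show ?thesis using h(2,3)[of "g y"] by (cases "g y < \<alpha>") auto
  qed
  show "\<exists>h. cov h (X \<union> Y) \<and> (\<forall>x\<in>X. h x = x) \<and> (\<forall>y\<in>Y. h y < \<alpha>)"
    using hg X Y by blast
qed

text \<open>There is no room below 0 for the image of the closed set
  \<open>{\<zero>\<^sub>o}\<close>.\<close>

lemma le1_0 [simp]: "R1 \<zero>\<^sub>o \<beta> \<longleftrightarrow> \<beta> = \<zero>\<^sub>o"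
proof
  assume R: "R1 \<zero>\<^sub>o \<beta>"
  show "\<beta> = \<zero>\<^sub>o"
  proof (rule ccontr)
    assume "\<beta> \<noteq> \<zero>\<^sub>o"
    then have "{\<zero>\<^sub>o} \<subseteq> {\<zero>\<^sub>o..<\<beta>}" by (simp add: ozero_less_iff)
    moreover have "rclosed \<rho> ({} \<union> {\<zero>\<^sub>o})" using fl_mult[OF mult_0] by (simp add: rclosed_iff)
    ultimately obtain h where "cov h ({} \<union> {\<zero>\<^sub>o})" "\<And>y. y \<in> {\<zero>\<^sub>o} \<Longrightarrow> h y < \<zero>\<^sub>o"
      by (rule le1_cover[OF R, of "{}" "{\<zero>\<^sub>o}", rotated 3]) auto
    then show False by (simp add: not_less_ozero)
  qed
qed simp

text \<open>Otherwise the floor of \<alpha> can be put into X and stays fixed. As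
  \<open>\<alpha> = fl \<alpha> +\<^sub>o \<epsilon>\<close> is its value under a function of the
  family, \<alpha> stays fixed too and cannot move below itself.\<close>

lemma le1_mult:
  assumes "R1 \<alpha> \<beta>" "\<alpha> < \<beta>"
  shows "mult \<alpha>"
proof (rule ccontr)
  assume "\<not> mult \<alpha>"
  then have "fl \<alpha> < \<alpha>" using fl_le[of \<alpha>] by (auto simp: mult_iff_fl)
  have fl: "fl (fl \<alpha>) = fl \<alpha>" by (rule fl_mult) simp
  obtain h where h: "cov h ({fl \<alpha>} \<union> {\<alpha>})" "\<And>x. x \<in> {fl \<alpha>} \<Longrightarrow> h x = x" "\<And>y. y \<in> {\<alpha>} \<Longrightarrow> h y < \<alpha>"
    by (rule le1_cover[OF assms(1), of "{fl \<alpha>}" "{\<alpha>}"])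
      (use \<open>fl \<alpha> < \<alpha>\<close> fl assms(2) in \<open>auto simp: rclosed_iff\<close>)
  obtain \<epsilon> where \<epsilon>: "\<epsilon> < \<rho>" "\<alpha> = fl \<alpha> +\<^sub>o \<epsilon>" by (metis fl_cases)
  then have "rfun \<rho> \<epsilon> (fl \<alpha>) = \<alpha>" by (simp add: rfun_eq[of \<epsilon>])
  then have "rfun \<rho> \<epsilon> (fl \<alpha>) = h \<alpha>"
    using cov_rfun[OF h(1), of "fl \<alpha>" \<alpha> \<epsilon>] \<epsilon>(1) h(2) by simp
  then show False using \<open>rfun \<rho> \<epsilon> (fl \<alpha>) = \<alpha>\<close> h(3)[of \<alpha>] by simp
qed

text \<open>Fixing \<sigma> and moving \<open>\<sigma> +\<^sub>o \<rho>\<close> below itself would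
  produce a multiple of \<rho> strictly between two consecutive ones.\<close>

lemma le1_not_successor_mult:
  assumes "mult \<sigma>" "R1 (\<sigma> +\<^sub>o \<rho>) \<beta>"
  shows "\<beta> = \<sigma> +\<^sub>o \<rho>"
proof (rule ccontr)
  let ?\<alpha> = "\<sigma> +\<^sub>o \<rho>"
  assume "\<beta> \<noteq> ?\<alpha>"
  then have less: "?\<alpha> < \<beta>" "\<sigma> < ?\<alpha>" using le1_le[OF assms(2)] \<rho>_pos by auto
  have m: "mult ?\<alpha>" using assms(1) by (simp add: mult_oadd)
  then have fl: "fl \<sigma> = \<sigma>" "fl ?\<alpha> = ?\<alpha>" using assms(1) fl_mult by blast+
  obtain h where h: "cov h ({\<sigma>} \<union> {?\<alpha>})" "\<And>x. x \<in> {\<sigma>} \<Longrightarrow> h x = x" "\<And>y. y \<in> {?\<alpha>} \<Longrightarrow> h y < ?\<alpha>"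
    by (rule le1_cover[OF assms(2), of "{\<sigma>}" "{?\<alpha>}"]) (use less fl in \<open>auto simp: rclosed_iff\<close>)
  have "mult (h ?\<alpha>)" using cov_mult[OF h(1), of ?\<alpha>] m by simp
  moreover have "\<sigma> < h ?\<alpha>" using cov_mono[OF h(1), of \<sigma> ?\<alpha>] h(2) less by simp
  ultimately have "?\<alpha> \<le> h ?\<alpha>" using mult_less[OF assms(1)] by blast
  then show False using h(3)[of ?\<alpha>] by simp
qed

text \<open>A proper relation starts at a multiple of \<rho>; the only one below \<rho> is 0, where
  none starts. So elements below \<rho> contribute no relations when they are glued to a covering of
  larger elements.\<close>

lemma le_small:
  assumes "x < \<rho>" "R1 x y"
  shows "x = y"
proof (rule ccontr)
  assume "x \<noteq> y"
  then have "x < y" using le1_le[OF assms(2)] by simp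
  then have "mult x" using le1_mult assms(2) by blast
  then have "x = \<zero>\<^sub>o" using not_mult_less[of x] assms(1) ozero_less_iff by blast
  then show False using assms(2) \<open>x \<noteq> y\<close> by simp
qed

lemma minimal1_iff: "minimal1 \<rho> \<kappa> \<longleftrightarrow> (\<forall>\<xi>. R1 \<xi> \<kappa> \<longrightarrow> \<xi> = \<kappa>)"
  by (auto simp: minimal1_def less1_def)

text \<open>By transitivity the least \<open>R1\<close>-predecessor of x has no predecessor of its
  own.\<close>

lemma ex_minimal1: "\<exists>\<kappa>. minimal1 \<rho> \<kappa> \<and> R1 \<kappa> x"
proof -
  define \<kappa> where "\<kappa> = (LEAST \<kappa>. R1 \<kappa> x)"
  have \<kappa>: "R1 \<kappa> x" unfolding \<kappa>_def by (rule LeastI[of _ x]) simp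
  have "\<xi> = \<kappa>" if "R1 \<xi> \<kappa>" for \<xi>
  proof -
    have "\<kappa> \<le> \<xi>" unfolding \<kappa>_def by (rule Least_le) (use that \<kappa> le1_trans in \<open>simp add: \<kappa>_def\<close>)
    then show ?thesis using le1_le[OF that] by simp
  qed
  then show ?thesis using \<kappa> minimal1_iff by blast
qed

text \<open>As V and its image are closed and lie above U, floors of their elements stay above U, so
  no function of the family links U with V before or after the move. Only the relations from U into
  V remain to be checked.\<close>

lemma glue:
  assumes h: "cov h V" and V: "rclosed \<rho> V"
    and less: "\<And>u v. u \<in> U \<Longrightarrow> v \<in> V \<Longrightarrow> u < v" "\<And>u v. u \<in> U \<Longrightarrow> v \<in> V \<Longrightarrow> u < h v"
    and rel: "\<And>u v. u \<in> U \<Longrightarrow> v \<in> V \<Longrightarrow> R1 u v \<Longrightarrow> R1 u (h v)" "\<And>u v. u \<in> U \<Longrightarrow> v \<in> V \<Longrightarrow> R2 u v \<Longrightarrow> R2 u (h v)"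
  shows "cov (\<lambda>x. if x \<in> V then h x else x) (U \<union> V)"
proof -
  have no_rfun: "rfun \<rho> \<xi> u \<noteq> v \<and> rfun \<rho> \<xi> v \<noteq> u"
    if W: "rclosed \<rho> W" "\<And>w. w \<in> W \<Longrightarrow> u < w" "v \<in> W" and \<xi>: "\<xi> < \<rho>" for W u v \<xi>
  proof -
    have "u < fl v" using W by (simp add: rclosed_iff)
    then have "rfun \<rho> \<xi> v \<noteq> u" using W(2)[OF W(3)] le_oadd[of v \<xi>] by (auto simp: rfun_eq[of \<xi>])
    moreover have "rfun \<rho> \<xi> u \<noteq> v"
    proof
      assume *: "rfun \<rho> \<xi> u = v"
      show False
      proof (cases "mult u")
        case True
        then have "fl v = u" using * \<xi> by (auto simp: rfun_eq[of \<xi>])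
        then show False using \<open>u < fl v\<close> by simp
      next
        case False
        then show False using * W(2)[OF W(3)] fl_le[of u] by (simp add: rfun_eq[of \<xi>])
      qed
    qed
    ultimately show ?thesis by blast
  qed
  have UV: "u \<notin> V" if "u \<in> U" for u using less(1)[OF that] by blast
  have hV: "rclosed \<rho> (h ` V)" using cov_closed[OF h V] .
  have 1: "rfun \<rho> \<xi> u \<noteq> v" "rfun \<rho> \<xi> v \<noteq> u" if "u \<in> U" "v \<in> V" "\<xi> < \<rho>" for u v \<xi>
    using no_rfun[OF V less(1)[OF that(1)] that(2,3)] by auto
  have 2: "rfun \<rho> \<xi> u \<noteq> h v" "rfun \<rho> \<xi> (h v) \<noteq> u" if "u \<in> U" "v \<in> V" "\<xi> < \<rho>" for u v \<xi>
    using no_rfun[OF hV, of u "h v" \<xi>] less(2)[OF that(1)] that by auto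
  have 3: "\<not> R1 v u" "\<not> R2 v u" "\<not> v < u" if "u \<in> U" "v \<in> V" for u v
    using less(1)[OF that] le1_le[of v u] le2_le[of v u] by auto
  show ?thesis
  proof (rule covI)
    fix x y assume "x \<in> U \<union> V" "y \<in> U \<union> V"
    then consider "x \<in> U" "y \<in> U" | "x \<in> U" "y \<in> V" | "x \<in> V" "y \<in> U" | "x \<in> V" "y \<in> V" by blast
    note cs = this
    show "x < y \<Longrightarrow> (if x \<in> V then h x else x) < (if y \<in> V then h y else y)"
      by (rule cs) (use UV less 3 cov_mono[OF h] in auto)
    show "rfun \<rho> \<xi> x = y \<longleftrightarrow>
        rfun \<rho> \<xi> (if x \<in> V then h x else x) = (if y \<in> V then h y else y)" if "\<xi> < \<rho>" for \<xi>
      by (rule cs) (use UV 1[OF _ _ that] 2[OF _ _ that] cov_rfun[OF h _ _ that] in simp_all)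
    show "R1 x y \<Longrightarrow> R1 (if x \<in> V then h x else x) (if y \<in> V then h y else y)"
      by (rule cs) (use UV 3 rel cov_R1[OF h] in auto)
    show "R2 x y \<Longrightarrow> R2 (if x \<in> V then h x else x) (if y \<in> V then h y else y)"
      by (rule cs) (use UV 3 rel cov_R2[OF h] in auto)
  qed
qed

section \<open>Cofinal coverings\<close>

text \<open>A covering reflects the order and the family of functions, but it only preserves
  \<open>R1\<close> and \<open>R2\<close>. Passing from one image to another therefore needs a
  comparison of the relations on the images themselves.\<close>

lemma cov_between_images:
  assumes h: "cov h Z" and g: "cov g Z"
    and R1: "\<And>x y. x \<in> Z \<Longrightarrow> y \<in> Z \<Longrightarrow> R1 (h x) (h y) \<Longrightarrow> R1 (g x) (g y)"
    and R2: "\<And>x y. x \<in> Z \<Longrightarrow> y \<in> Z \<Longrightarrow> R2 (h x) (h y) \<Longrightarrow> R2 (g x) (g y)"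
  shows "cov (\<lambda>z. g (inv_into Z h z)) (h ` Z)"
proof -
  have inv: "inv_into Z h (h z) = z" if "z \<in> Z" for z
    using cov_inj[OF h] that by (rule inv_into_f_f)
  show ?thesis
  proof (rule covI)
    fix x y assume "x \<in> h ` Z" "y \<in> h ` Z"
    then obtain u v where [simp]: "x = h u" "y = h v" and Z: "u \<in> Z" "v \<in> Z" by blast
    show "x < y \<Longrightarrow> g (inv_into Z h x) < g (inv_into Z h y)"
      using cov_less_iff[OF h Z] cov_less_iff[OF g Z] Z by (simp add: inv)
    show "rfun \<rho> \<xi> x = y \<longleftrightarrow> rfun \<rho> \<xi> (g (inv_into Z h x)) = g (inv_into Z h y)" if "\<xi> < \<rho>" for \<xi>
      using cov_rfun[OF h Z that] cov_rfun[OF g Z that] Z by (simp add: inv)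
    show "R1 x y \<Longrightarrow> R1 (g (inv_into Z h x)) (g (inv_into Z h y))"
      using R1[OF Z] Z by (simp add: inv)
    show "R2 x y \<Longrightarrow> R2 (g (inv_into Z h x)) (g (inv_into Z h y))"
      using R2[OF Z] Z by (simp add: inv)
  qed
qed

text \<open>
  There are only finitely many possibilities for the relations on the image of a covering, so one of
  them occurs cofinally often.
\<close>

lemma cofinal_covers_obtain:
  assumes fin: "finite X" "finite Y" and cof: "cofinal_covers \<alpha> X Y" and d: "d < \<alpha>"
  obtains h where "cov h (X \<union> Y)" "\<And>x. x \<in> X \<Longrightarrow> h x = x" "\<And>y. y \<in> Y \<Longrightarrow> d < h y \<and> h y < \<alpha>"
    "cofinal_covers \<alpha> X (h ` Y)"
proof -
  define Z where "Z = X \<union> Y"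
  define P where "P = (\<lambda>\<gamma> h. cov h Z \<and> (\<forall>x\<in>X. h x = x) \<and> (\<forall>y\<in>Y. \<gamma> < h y \<and> h y < \<alpha>))"
  \<comment> \<open>The pattern of a map: the pairs of Z whose images are related.\<close>
  define tp where "tp = (\<lambda>h. ({(x, y) \<in> Z \<times> Z. R1 (h x) (h y)}, {(x, y) \<in> Z \<times> Z. R2 (h x) (h y)}))"
  have ex: "\<exists>T. \<forall>\<gamma><\<alpha>. \<exists>h. P \<gamma> h \<and> tp h = T"
  proof (rule ccontr)
    assume "\<nexists>T. \<forall>\<gamma><\<alpha>. \<exists>h. P \<gamma> h \<and> tp h = T"
    \<comment> \<open>Every pattern T fails beyond some bound \<open>c T\<close>. A covering beyond
      the largest of these finitely many bounds has a pattern itself, a contradiction.\<close>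
    then obtain c where c: "\<And>T. c T < \<alpha>" "\<And>T h. P (c T) h \<Longrightarrow> tp h \<noteq> T" by metis
    define Ts where "Ts = Pow (Z \<times> Z) \<times> Pow (Z \<times> Z)"
    have Ts: "finite Ts" "Ts \<noteq> {}" using fin by (auto simp: Ts_def Z_def)
    then have "Max (c ` Ts) < \<alpha>" using c(1) by simp
    then obtain h where h: "P (Max (c ` Ts)) h" using cof unfolding cofinal_covers_def P_def Z_def by blast
    have "tp h \<in> Ts" by (auto simp: tp_def Ts_def)
    then have "c (tp h) \<le> Max (c ` Ts)" using Ts by simp
    then have "P (c (tp h)) h" using h by (auto simp: P_def)
    then show False using c(2) by blast
  qed
  then obtain T where T: "\<And>\<gamma>. \<gamma> < \<alpha> \<Longrightarrow> \<exists>h. P \<gamma> h \<and> tp h = T" by blast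
  obtain h where h: "P d h" "tp h = T" using T[OF d] by blast
  have hc: "cov h Z" "\<And>x. x \<in> X \<Longrightarrow> h x = x" using h by (auto simp: P_def)
  have hX: "h ` X = X" using hc(2) by simp
  have "cofinal_covers \<alpha> X (h ` Y)"
    unfolding cofinal_covers_def
  proof (intro allI impI)
    fix \<gamma> assume "\<gamma> < \<alpha>"
    then obtain g where g: "P \<gamma> g" "tp g = T" using T by blast
    then have gc: "cov g Z" by (simp add: P_def)
    have "tp h = tp g" using g h by simp
    then have "R1 (h x) (h y) \<longleftrightarrow> R1 (g x) (g y)" "R2 (h x) (h y) \<longleftrightarrow> R2 (g x) (g y)"
      if "x \<in> Z" "y \<in> Z" for x y
      using that unfolding tp_def by blast+
    then have c: "cov (\<lambda>z. g (inv_into Z h z)) (h ` Z)" by (intro cov_between_images[OF hc(1) gc]) auto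
    have inv: "inv_into Z h (h z) = z" if "z \<in> Z" for z
      using cov_inj[OF hc(1)] that by (rule inv_into_f_f)
    have "h ` Z = X \<union> h ` Y" using hX by (auto simp: Z_def)
    moreover have "g (inv_into Z h x) = x" if "x \<in> X" for x
      using inv[of x] hc(2)[OF that] g that by (auto simp: P_def Z_def)
    moreover have "\<gamma> < g (inv_into Z h y) \<and> g (inv_into Z h y) < \<alpha>" if "y \<in> h ` Y" for y
      using that inv g by (auto simp: P_def Z_def)
    ultimately show "\<exists>k. cov k (X \<union> h ` Y) \<and> (\<forall>x\<in>X. k x = x) \<and> (\<forall>y\<in>h ` Y. \<gamma> < k y \<and> k y < \<alpha>)"
      using c by metis
  qed
  then show ?thesis using that h by (auto simp: P_def Z_def)
qed

lemma cofinal_covers_comp: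
  assumes "cov h (X \<union> Y)" "\<And>x. x \<in> X \<Longrightarrow> h x = x" "cofinal_covers \<beta> X (h ` Y)"
  shows "cofinal_covers \<beta> X Y"
  unfolding cofinal_covers_def
proof (intro allI impI)
  fix \<gamma> assume "\<gamma> < \<beta>"
  then obtain g where g: "cov g (X \<union> h ` Y)" "\<forall>x\<in>X. g x = x" "\<forall>y\<in>h ` Y. \<gamma> < g y \<and> g y < \<beta>"
    using assms(3) unfolding cofinal_covers_def by blast
  have "h ` (X \<union> Y) = X \<union> h ` Y" using assms(2) by (simp add: image_Un)
  then have "cov (\<lambda>x. g (h x)) (X \<union> Y)" using cov_comp[OF assms(1)] g(1) by simp
  then show "\<exists>h. cov h (X \<union> Y) \<and> (\<forall>x\<in>X. h x = x) \<and> (\<forall>y\<in>Y. \<gamma> < h y \<and> h y < \<beta>)"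
    using g assms(2) by (intro exI[of _ "\<lambda>x. g (h x)"]) simp
qed

text \<open>With \<epsilon> < \<rho>, an element \<open>d +\<^sub>o \<epsilon>\<close> of Y has its
  floor d in X. The coverings fix d and hence this element, so it cannot be moved up
  cofinally.\<close>

lemma cofinal_covers_far:
  assumes "mult d" "rclosed \<rho> (X \<union> Y)" "\<And>y. y \<in> Y \<Longrightarrow> d < y" "Y \<subseteq> {..<\<eta>}" "cofinal_covers \<eta> X Y" "y \<in> Y"
  shows "d +\<^sub>o \<rho> \<le> y"
proof (rule ccontr)
  assume "\<not> d +\<^sub>o \<rho> \<le> y"
  moreover obtain \<epsilon> where y: "y = d +\<^sub>o \<epsilon>" using ex_oadd[of d y] assms(3,6) by force
  ultimately have \<epsilon>: "\<epsilon> < \<rho>" by simp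
  then have "fl y = d" using assms(1) y by simp
  then have "d \<in> X \<union> Y" using assms(2,6) unfolding rclosed_iff by fastforce
  then have "d \<in> X" using assms(3) by blast
  have "y < \<eta>" using assms(4,6) by blast
  then obtain h where h: "cov h (X \<union> Y)" "\<forall>x\<in>X. h x = x" "\<forall>v\<in>Y. y < h v \<and> h v < \<eta>"
    using assms(5) unfolding cofinal_covers_def by blast
  have "rfun \<rho> \<epsilon> d = y" using y assms(1) by (simp add: rfun_eq[of \<epsilon>])
  then have "y = h y" using cov_rfun[OF h(1), of d y \<epsilon>] \<epsilon> h(2) \<open>d \<in> X\<close> assms(6) by simp
  then show False using h(3) assms(6) by force
qed

section \<open>Translations\<close>

lemma rclosed_translate: "mult \<delta> \<Longrightarrow> rclosed \<rho> S \<Longrightarrow> rclosed \<rho> ((\<lambda>z. \<delta> +\<^sub>o z) ` S)"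
  by (auto simp: rclosed_iff fl_translate)

lemma inj_oadd: "inj (\<lambda>w. \<delta> +\<^sub>o w)"
  by (rule injI) simp

section \<open>Induction step for the translation by \<open>\<delta>\<close>, at larger argument
  \<open>y\<close>\<close>

context
  fixes \<delta> y :: 'o
  assumes \<delta>: "mult \<delta>"
    and IH1: "\<And>z w. \<zero>\<^sub>o < z \<Longrightarrow> w < y \<Longrightarrow> R1 z w \<longleftrightarrow> R1 (\<delta> +\<^sub>o z) (\<delta> +\<^sub>o w)"
    and IH2: "\<And>z w. \<zero>\<^sub>o < z \<Longrightarrow> w < y \<Longrightarrow> R2 z w \<longleftrightarrow> R2 (\<delta> +\<^sub>o z) (\<delta> +\<^sub>o w)"
    and no2: "\<And>a b. a \<le> \<delta> \<Longrightarrow> \<zero>\<^sub>o < b \<Longrightarrow> b < y \<Longrightarrow> \<not> R2 a (\<delta> +\<^sub>o b)"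
begin

text \<open>Conjugation by the translation. At 0, where the induction hypotheses say nothing, there
  is nothing to transfer: 0 is related only to itself.\<close>

lemma pull:
  assumes h: "cov h ((\<lambda>z. \<delta> +\<^sub>o z) ` Z)" and Z: "Z \<subseteq> {..<y}"
    and pos: "\<And>z. z \<in> Z \<Longrightarrow> \<zero>\<^sub>o < z \<Longrightarrow> \<delta> < h (\<delta> +\<^sub>o z) \<and> h (\<delta> +\<^sub>o z) < \<delta> +\<^sub>o y"
    and zero: "\<zero>\<^sub>o \<in> Z \<Longrightarrow> h \<delta> = \<delta>"
  shows "cov (\<lambda>z. osub \<delta> (h (\<delta> +\<^sub>o z))) Z"
proof -
  define g where "g = (\<lambda>z. osub \<delta> (h (\<delta> +\<^sub>o z)))"
  have g: "\<delta> +\<^sub>o g z = h (\<delta> +\<^sub>o z)" if "z \<in> Z" for z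
    unfolding g_def using that pos[of z] zero by (intro oadd_osub) (cases "z = \<zero>\<^sub>o"; auto simp: oadd_ozero ozero_less_iff)
  have g0: "g \<zero>\<^sub>o = \<zero>\<^sub>o" if "\<zero>\<^sub>o \<in> Z"
    using g[OF that] zero[OF that] oadd_eq_cancel[of \<delta> "g \<zero>\<^sub>o" "\<zero>\<^sub>o"] by (simp add: oadd_ozero)
  have gpos: "\<zero>\<^sub>o < g z" "g z < y" if "z \<in> Z" "\<zero>\<^sub>o < z" for z
    using pos[OF that] unfolding g[OF that(1), symmetric] by auto
  show ?thesis
    unfolding g_def[symmetric]
  proof (rule covI)
    fix z w assume zw: "z \<in> Z" "w \<in> Z"
    then have t: "\<delta> +\<^sub>o z \<in> (\<lambda>z. \<delta> +\<^sub>o z) ` Z" "\<delta> +\<^sub>o w \<in> (\<lambda>z. \<delta> +\<^sub>o z) ` Z" by auto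
    have w: "w < y" using zw Z by auto
    show "z < w \<Longrightarrow> g z < g w"
      using cov_mono[OF h t] zw by (simp flip: g)
    show "rfun \<rho> \<xi> z = w \<longleftrightarrow> rfun \<rho> \<xi> (g z) = g w" if "\<xi> < \<rho>" for \<xi>
      using cov_rfun[OF h t that] zw by (simp add: rfun_translate[OF \<delta>] flip: g)
    have *: "w = \<zero>\<^sub>o" if "R1 z w" "z = \<zero>\<^sub>o" using that by simp
    have **: "w \<noteq> \<zero>\<^sub>o" if "R1 z w" "z \<noteq> \<zero>\<^sub>o" using le1_le[OF that(1)] that(2) ozero_le[of z] by auto
    show "R1 (g z) (g w)" if "R1 z w"
    proof (cases "z = \<zero>\<^sub>o")
      case False
      then have "R1 (\<delta> +\<^sub>o g z) (\<delta> +\<^sub>o g w)"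
        using that IH1[of z w] w cov_R1[OF h t] zw by (simp add: ozero_less_iff g)
      then show ?thesis using IH1[of "g z" "g w"] gpos zw False **[OF that] by (simp add: ozero_less_iff)
    qed (use that * in simp)
    show "R2 (g z) (g w)" if "R2 z w"
    proof (cases "z = \<zero>\<^sub>o")
      case False
      then have "R2 (\<delta> +\<^sub>o g z) (\<delta> +\<^sub>o g w)"
        using that IH2[of z w] w cov_R2[OF h t] zw by (simp add: ozero_less_iff g)
      then show ?thesis using IH2[of "g z" "g w"] gpos zw False **[OF le2_imp_le1[OF that]] by (simp add: ozero_less_iff)
    qed (use that *[OF le2_imp_le1[OF that]] in simp)
  qed
qed

text \<open>Unlike in \<open>pull\<close>, elements up to \<delta>, and \<delta> itself, may be
  related to elements above \<delta> although 0 is not. For \<open>R2\<close> this is excluded by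
  \<open>no2\<close>; for \<open>R1\<close> it has to be supplied as \<open>rel\<close>. The part
  below \<delta> is glued on unchanged.\<close>

lemma push:
  assumes g: "cov g W" and W: "W = {w. \<delta> +\<^sub>o w \<in> Z}" and Z: "rclosed \<rho> Z" "Z \<subseteq> {..<\<delta> +\<^sub>o y}"
    and pos: "\<And>w. w \<in> W \<Longrightarrow> \<zero>\<^sub>o < w \<Longrightarrow> \<zero>\<^sub>o < g w \<and> g w < y"
    and zero: "\<zero>\<^sub>o \<in> W \<Longrightarrow> g \<zero>\<^sub>o = \<zero>\<^sub>o"
    and rel: "\<And>a w. a \<in> Z \<Longrightarrow> a \<le> \<delta> \<Longrightarrow> w \<in> W \<Longrightarrow> \<zero>\<^sub>o < w \<Longrightarrow> R1 a (\<delta> +\<^sub>o w) \<Longrightarrow> R1 a (\<delta> +\<^sub>o g w)"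
  shows "cov (\<lambda>z. if \<delta> \<le> z then \<delta> +\<^sub>o g (osub \<delta> z) else z) Z"
proof -
  define V where "V = Z \<inter> {\<delta>..}"
  define h where "h = (\<lambda>z. \<delta> +\<^sub>o g (osub \<delta> z))"
  have h: "h (\<delta> +\<^sub>o w) = \<delta> +\<^sub>o g w" for w by (simp add: h_def)
  have V: "\<exists>w. v = \<delta> +\<^sub>o w \<and> w \<in> W" if "v \<in> V" for v
    using that ex_oadd[of \<delta> v] by (auto simp: V_def W)
  have wy: "w < y" if "w \<in> W" for w using that Z(2) by (auto simp: W)
  have \<delta>Z: "\<delta> \<in> Z" if "\<zero>\<^sub>o \<in> W" using that by (simp add: W oadd_ozero)
  have covV: "cov h V"
  proof (rule covI)
    fix a b assume "a \<in> V" "b \<in> V"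
    then obtain z w where [simp]: "a = \<delta> +\<^sub>o z" "b = \<delta> +\<^sub>o w" and zw: "z \<in> W" "w \<in> W" using V by meson
    show "a < b \<Longrightarrow> h a < h b" using cov_mono[OF g zw] by (simp add: h)
    show "rfun \<rho> \<xi> a = b \<longleftrightarrow> rfun \<rho> \<xi> (h a) = h b" if "\<xi> < \<rho>" for \<xi>
      using cov_rfun[OF g zw that] by (simp add: h rfun_translate[OF \<delta>])
    show "R1 (h a) (h b)" if R: "R1 a b"
    proof (cases "z = \<zero>\<^sub>o")
      case True
      then have *: "a = \<delta>" "h a = \<delta>" "\<zero>\<^sub>o \<in> W"
        using zero zw h[of "\<zero>\<^sub>o"] by (auto simp: oadd_ozero)
      show ?thesis
      proof (cases "w = \<zero>\<^sub>o")
        case False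
        then show ?thesis using rel[of \<delta> w] R * \<delta>Z zw by (simp add: ozero_less_iff h oadd_ozero)
      qed (use True in simp)
    next
      case False
      then have "R1 z w" using R IH1[of z w] wy zw by (simp add: ozero_less_iff)
      moreover have "w \<noteq> \<zero>\<^sub>o" using le1_le[OF \<open>R1 z w\<close>] False ozero_le[of z] by auto
      ultimately show ?thesis
        using cov_R1[OF g zw] IH1[of "g z" "g w"] pos zw False by (simp add: ozero_less_iff h)
    qed
    show "R2 (h a) (h b)" if R: "R2 a b"
    proof (cases "z = \<zero>\<^sub>o")
      case True
      then show ?thesis
        using no2[of \<delta> w] R wy zw by (cases "w = \<zero>\<^sub>o") (auto simp: ozero_less_iff oadd_ozero)
    next
      case False
      then have "R2 z w" using R IH2[of z w] wy zw by (simp add: ozero_less_iff)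
      moreover have "w \<noteq> \<zero>\<^sub>o" using le2_le[OF \<open>R2 z w\<close>] False ozero_le[of z] by auto
      ultimately show ?thesis
        using cov_R2[OF g zw] IH2[of "g z" "g w"] pos zw False by (simp add: ozero_less_iff h)
    qed
  qed
  have clV: "rclosed \<rho> V" using Z(1) le_fl[OF \<delta>] by (auto simp: rclosed_iff V_def)
  have h\<delta>: "\<delta> \<le> h v" for v by (simp add: h_def le_oadd)
  have "cov (\<lambda>x. if x \<in> V then h x else x) (Z \<inter> {..<\<delta>} \<union> V)"
  proof (rule glue[OF covV clV])
    fix u v assume u: "u \<in> Z \<inter> {..<\<delta>}" and "v \<in> V"
    then obtain w where v[simp]: "v = \<delta> +\<^sub>o w" and w: "w \<in> W" using V by meson
    show "u < v" using u \<open>v \<in> V\<close> by (auto simp: V_def)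
    show "u < h v" using u h\<delta>[of v] by auto
    show "R1 u (h v)" if "R1 u v"
    proof (cases "w = \<zero>\<^sub>o")
      case False
      then show ?thesis using rel[of u w] u w that by (auto simp: h ozero_less_iff)
    qed (use that w zero in \<open>simp add: h\<close>)
    show "R2 u (h v)" if "R2 u v"
    proof (cases "w = \<zero>\<^sub>o")
      case False
      then have "\<not> R2 u v" using no2[of u w] wy[OF w] u order.strict_implies_order[of u \<delta>] by (simp add: ozero_less_iff)
      then show ?thesis using that by blast
    qed (use that w zero in \<open>simp add: h\<close>)
  qed
  moreover have "Z \<inter> {..<\<delta>} \<union> V = Z" by (auto simp: V_def)
  ultimately show ?thesis
    by (subst cov_cong[of Z _ "\<lambda>x. if x \<in> V then h x else x"]) (auto simp: V_def h_def)
qed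

text \<open>Shared by the downward clauses of both relations; Q stands for the extra condition in
  \<open>le2_down\<close>. The moved elements only decrease, so relations from ordinals up to
  \<delta> survive by \<open>le1_between\<close>.\<close>

lemma push_cover:
  assumes "\<zero>\<^sub>o < x" "x < y"
    and "finite X" "X \<subseteq> {..<\<delta> +\<^sub>o x}" "finite Y" "Y \<subseteq> {\<delta> +\<^sub>o x..<\<delta> +\<^sub>o y}" "rclosed \<rho> (X \<union> Y)"
    and low: "\<And>U V. finite U \<Longrightarrow> U \<subseteq> {..<x} \<Longrightarrow> finite V \<Longrightarrow> V \<subseteq> {x..<y} \<Longrightarrow> rclosed \<rho> (U \<union> V) \<Longrightarrow>
      \<exists>g. cov g (U \<union> V) \<and> (\<forall>u\<in>U. g u = u) \<and> (\<forall>v\<in>V. g v < x \<and> Q v (g v))"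
  shows "\<exists>h. cov h (X \<union> Y) \<and> (\<forall>x\<in>X. h x = x) \<and>
    (\<forall>v\<in>Y. \<exists>w w'. v = \<delta> +\<^sub>o w \<and> h v = \<delta> +\<^sub>o w' \<and> \<zero>\<^sub>o < w' \<and> x \<le> w \<and> w < y \<and> w' < x \<and> Q w w')"
proof -
  \<comment> \<open>Since 0 joins the fixed part, positive elements have positive images, whose
    translates stay above \<delta>.\<close>
  define U V where "U = insert \<zero>\<^sub>o {w. \<delta> +\<^sub>o w \<in> X}" and "V = {w. \<delta> +\<^sub>o w \<in> Y}"
  have fin: "finite {w. \<delta> +\<^sub>o w \<in> S}" if "finite S" for S
    using finite_vimageI[OF that inj_oadd[of \<delta>]] by (simp add: vimage_def)
  have U: "finite U" "U \<subseteq> {..<x}" using assms(1,3,4) fin by (auto simp: U_def)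
  have V: "finite V" "V \<subseteq> {x..<y}" using assms(5,6) fin by (auto simp: V_def)
  have cl: "rclosed \<rho> (U \<union> V)"
    using assms(7) fl_mult[OF mult_0] by (auto simp: rclosed_iff U_def V_def simp flip: fl_translate[OF \<delta>])
  obtain g where g: "cov g (U \<union> V)" "\<And>u. u \<in> U \<Longrightarrow> g u = u" "\<And>v. v \<in> V \<Longrightarrow> g v < x \<and> Q v (g v)"
    using low[OF U V cl] by blast
  define W where "W = {w. \<delta> +\<^sub>o w \<in> X \<union> Y}"
  have WUV: "W \<subseteq> U \<union> V" by (auto simp: W_def U_def V_def)
  have 0: "\<zero>\<^sub>o \<in> U" by (simp add: U_def)
  have gpos: "\<zero>\<^sub>o < g w" if "w \<in> U \<union> V" "\<zero>\<^sub>o < w" for w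
    using cov_mono[OF g(1) _ that(1), of "\<zero>\<^sub>o"] that 0 g(2)[OF 0] by simp
  \<comment> \<open>Elements of V drop from [x, y) to below x; all others stay.\<close>
  have glex: "g w \<le> w" if "w \<in> U \<union> V" for w using that g V by force
  have glt: "g w < y" if "w \<in> U \<union> V" for w using that glex[OF that] U V assms(2) by force
  define h where "h = (\<lambda>z. if \<delta> \<le> z then \<delta> +\<^sub>o g (osub \<delta> z) else z)"
  have ht: "h (\<delta> +\<^sub>o w) = \<delta> +\<^sub>o g w" for w by (simp add: h_def le_oadd)
  have "cov h (X \<union> Y)"
    unfolding h_def
  proof (rule push[OF cov_subset[OF g(1) WUV] W_def assms(7)])
    have "{..<\<delta> +\<^sub>o x} \<subseteq> {..<\<delta> +\<^sub>o y}" "{\<delta> +\<^sub>o x..<\<delta> +\<^sub>o y} \<subseteq> {..<\<delta> +\<^sub>o y}" using assms(2) by auto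
    then show "X \<union> Y \<subseteq> {..<\<delta> +\<^sub>o y}" by (intro Un_least order.trans[OF assms(4)] order.trans[OF assms(6)])
    show "\<zero>\<^sub>o < g w \<and> g w < y" if "w \<in> W" "\<zero>\<^sub>o < w" for w
      using that WUV gpos glt by blast
    show "g \<zero>\<^sub>o = \<zero>\<^sub>o" using g(2)[OF 0] .
    show "R1 a (\<delta> +\<^sub>o g w)" if "a \<le> \<delta>" "w \<in> W" "R1 a (\<delta> +\<^sub>o w)" for a w
    proof (rule le1_between[OF that(3)])
      show "a \<le> \<delta> +\<^sub>o g w" using that(1) le_oadd by (rule order.trans)
      show "\<delta> +\<^sub>o g w \<le> \<delta> +\<^sub>o w" using glex that WUV by auto
    qed
  qed
  moreover have "h z = z" if "z \<in> X" for z
  proof (cases "\<delta> \<le> z")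
    case True
    then obtain w where z: "z = \<delta> +\<^sub>o w" using ex_oadd by blast
    then show ?thesis using that g(2)[of w] by (simp add: ht U_def)
  qed (simp add: h_def)
  moreover have "\<exists>w w'. v = \<delta> +\<^sub>o w \<and> h v = \<delta> +\<^sub>o w' \<and> \<zero>\<^sub>o < w' \<and> x \<le> w \<and> w < y \<and> w' < x \<and> Q w w'"
    if "v \<in> Y" for v
  proof -
    have "\<delta> \<le> v" using that assms(6) le_oadd[of \<delta> x] by force
    then obtain w where w: "v = \<delta> +\<^sub>o w" using ex_oadd by blast
    then have "w \<in> V" using that by (simp add: V_def)
    then have "x \<le> w" "w < y" using V(2) by auto
    moreover from this have "\<zero>\<^sub>o < g w" using gpos[of w] assms(1) \<open>w \<in> V\<close> by simp
    moreover have "h v = \<delta> +\<^sub>o g w" unfolding w by (rule ht)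
    ultimately show ?thesis using w g(3)[OF \<open>w \<in> V\<close>] by blast
  qed
  ultimately show ?thesis by blast
qed

text \<open>Mirror image of \<open>push_cover\<close>: the adjoined 0 is translated to \<delta>, and
  fixing \<delta> keeps the images above it, so that they can be pulled back.\<close>

lemma pull_cover:
  assumes "\<zero>\<^sub>o < x" "x < y"
    and "finite X" "X \<subseteq> {..<x}" "finite Y" "Y \<subseteq> {x..<y}" "rclosed \<rho> (X \<union> Y)"
    and low: "\<And>U V. finite U \<Longrightarrow> U \<subseteq> {..<\<delta> +\<^sub>o x} \<Longrightarrow> finite V \<Longrightarrow> V \<subseteq> {\<delta> +\<^sub>o x..<\<delta> +\<^sub>o y} \<Longrightarrow>
      rclosed \<rho> (U \<union> V) \<Longrightarrow>
      \<exists>g. cov g (U \<union> V) \<and> (\<forall>u\<in>U. g u = u) \<and> (\<forall>v\<in>V. g v < \<delta> +\<^sub>o x \<and> Q v (g v))"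
  shows "\<exists>h. cov h (X \<union> Y) \<and> (\<forall>x\<in>X. h x = x) \<and>
    (\<forall>v\<in>Y. \<zero>\<^sub>o < h v \<and> h v < x \<and> Q (\<delta> +\<^sub>o v) (\<delta> +\<^sub>o h v))"
proof -
  let ?t = "\<lambda>z. \<delta> +\<^sub>o z"
  define U V where "U = insert \<zero>\<^sub>o X" and "V = Y"
  have "rclosed \<rho> (U \<union> V)"
    using assms(7) fl_mult[OF mult_0] by (auto simp: rclosed_iff U_def V_def)
  then have cl: "rclosed \<rho> (?t ` U \<union> ?t ` V)"
    unfolding image_Un[symmetric] by (rule rclosed_translate[OF \<delta>])
  have U: "finite (?t ` U)" "?t ` U \<subseteq> {..<\<delta> +\<^sub>o x}" using assms(1,3,4) by (auto simp: U_def)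
  have V: "finite (?t ` V)" "?t ` V \<subseteq> {\<delta> +\<^sub>o x..<\<delta> +\<^sub>o y}" using assms(5,6) by (auto simp: V_def)
  obtain h where low: "cov h (?t ` U \<union> ?t ` V) \<and> (\<forall>u\<in>?t ` U. h u = u) \<and>
      (\<forall>v\<in>?t ` V. h v < \<delta> +\<^sub>o x \<and> Q v (h v))"
    using low[OF U V cl] by (elim exE)
  note h = low[THEN conjunct1] low[THEN conjunct2, THEN conjunct1, rule_format]
    low[THEN conjunct2, THEN conjunct2, rule_format]
  have h': "cov h (?t ` (U \<union> V))" using h(1) by (simp only: image_Un)
  have \<delta>U: "\<delta> \<in> ?t ` U" by (rule image_eqI[of _ _ "\<zero>\<^sub>o"]) (simp_all add: oadd_ozero U_def)
  have pos: "\<delta> < h (?t z)" if "z \<in> U \<union> V" "\<zero>\<^sub>o < z" for z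
    using cov_mono[OF h(1), of \<delta> "?t z"] that \<delta>U h(2)[OF \<delta>U] by auto
  have lt: "h (?t z) < \<delta> +\<^sub>o y" if "z \<in> U \<union> V" for z
  proof (cases "z \<in> U")
    case True
    then have "h (?t z) = ?t z" using h(2) by blast
    moreover have "z < x" using U(2) True by auto
    ultimately show ?thesis using assms(2) by simp
  next
    case False
    then have "h (?t z) < \<delta> +\<^sub>o x" using h(3) that by blast
    also have "\<dots> < \<delta> +\<^sub>o y" using assms(2) by simp
    finally show ?thesis .
  qed
  have c: "cov (\<lambda>z. osub \<delta> (h (?t z))) (U \<union> V)"
  proof (rule pull[OF h'])
    show "U \<union> V \<subseteq> {..<y}" using assms(1,2,4,6) by (auto simp: U_def V_def)
  qed (use pos lt h(2)[OF \<delta>U] in blast)+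
  have eq: "\<delta> +\<^sub>o osub \<delta> (h (?t v)) = h (?t v)" if "v \<in> V" for v
    using pos[of v] that assms(1,6) by (intro oadd_osub) (force simp: V_def)
  show ?thesis
  proof (intro exI conjI ballI)
    show "cov (\<lambda>z. osub \<delta> (h (?t z))) (X \<union> Y)" by (rule cov_subset[OF c]) (auto simp: U_def V_def)
    show "osub \<delta> (h (?t z)) = z" if "z \<in> X" for z using that h(2)[of "?t z"] by (simp add: U_def)
    fix v assume v: "v \<in> Y"
    then have "x \<le> v" "v \<in> V" using assms(6) by (auto simp: V_def)
    then have "\<zero>\<^sub>o < v" using assms(1) by simp
    then have *: "\<delta> < h (?t v)" "h (?t v) < \<delta> +\<^sub>o x" "Q (?t v) (h (?t v))"
      using pos h(3) \<open>v \<in> V\<close> by auto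
    show "\<zero>\<^sub>o < osub \<delta> (h (?t v))" "osub \<delta> (h (?t v)) < x"
      using *(1,2) eq[OF \<open>v \<in> V\<close>] by (metis less_oadd_iff, metis oadd_less_cancel)
    show "Q (?t v) (?t (osub \<delta> (h (?t v))))" using * by (simp add: eq[OF \<open>v \<in> V\<close>])
  qed
qed

lemma translate_le1:
  assumes "\<zero>\<^sub>o < x" "x < y"
  shows "R1 x y \<longleftrightarrow> R1 (\<delta> +\<^sub>o x) (\<delta> +\<^sub>o y)"
proof
  assume R: "R1 x y"
  show "R1 (\<delta> +\<^sub>o x) (\<delta> +\<^sub>o y)"
  proof (rule le1I)
    fix X Y assume *: "finite X" "X \<subseteq> {..<\<delta> +\<^sub>o x}" "finite Y" "Y \<subseteq> {\<delta> +\<^sub>o x..<\<delta> +\<^sub>o y}" "rclosed \<rho> (X \<union> Y)"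
    have low: "\<exists>g. cov g (U \<union> V) \<and> (\<forall>u\<in>U. g u = u) \<and> (\<forall>v\<in>V. g v < x \<and> True)"
      if "finite U" "U \<subseteq> {..<x}" "finite V" "V \<subseteq> {x..<y}" "rclosed \<rho> (U \<union> V)" for U V
      using le1_cover[OF R that] by metis
    obtain h where h: "cov h (X \<union> Y)" "\<forall>x\<in>X. h x = x"
      "\<forall>v\<in>Y. \<exists>w w'. v = \<delta> +\<^sub>o w \<and> h v = \<delta> +\<^sub>o w' \<and> \<zero>\<^sub>o < w' \<and> x \<le> w \<and> w < y \<and> w' < x \<and> True"
      using push_cover[where Q = "\<lambda>_ _. True", OF assms * low] by blast
    then have "\<forall>v\<in>Y. h v < \<delta> +\<^sub>o x" by fastforce
    then show "\<exists>h. cov h (X \<union> Y) \<and> (\<forall>x\<in>X. h x = x) \<and> (\<forall>v\<in>Y. h v < \<delta> +\<^sub>o x)"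
      using h by blast
  qed (use assms in simp)
next
  assume R: "R1 (\<delta> +\<^sub>o x) (\<delta> +\<^sub>o y)"
  show "R1 x y"
  proof (rule le1I)
    fix X Y assume *: "finite X" "X \<subseteq> {..<x}" "finite Y" "Y \<subseteq> {x..<y}" "rclosed \<rho> (X \<union> Y)"
    have low: "\<exists>g. cov g (U \<union> V) \<and> (\<forall>u\<in>U. g u = u) \<and> (\<forall>v\<in>V. g v < \<delta> +\<^sub>o x \<and> True)"
      if "finite U" "U \<subseteq> {..<\<delta> +\<^sub>o x}" "finite V" "V \<subseteq> {\<delta> +\<^sub>o x..<\<delta> +\<^sub>o y}" "rclosed \<rho> (U \<union> V)" for U V
      using le1_cover[OF R that] by metis
    show "\<exists>h. cov h (X \<union> Y) \<and> (\<forall>x\<in>X. h x = x) \<and> (\<forall>v\<in>Y. h v < x)"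
      using pull_cover[where Q = "\<lambda>_ _. True", OF assms * low] by blast
  qed (use assms in simp)
qed

text \<open>The coverings are pulled down to x, moved up to y by \<open>R2 x y\<close>, and pushed
  back. Since images may now increase, the relations from ordinals up to \<delta> need the separate
  argument \<open>relY\<close>.\<close>

lemma cofinal_push:
  assumes "\<zero>\<^sub>o < x" "x < y" and R: "R2 x y"
    and *: "finite X" "X \<subseteq> {..<\<delta> +\<^sub>o x}" "finite Y" "Y \<subseteq> {\<delta><..<\<delta> +\<^sub>o x}" "rclosed \<rho> (X \<union> Y)"
      "set_less X Y" "cofinal_covers (\<delta> +\<^sub>o x) X Y" "Y \<noteq> {}"
  shows "cofinal_covers (\<delta> +\<^sub>o y) X Y"
proof -
  let ?t = "\<lambda>z. \<delta> +\<^sub>o z"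
  have fin: "finite {w. \<rho> \<le> w \<and> \<delta> +\<^sub>o w \<in> S}" if "finite S" for S
    using finite_vimageI[OF that inj_oadd[of \<delta>]] by (rule rev_finite_subset) auto
  \<comment> \<open>Only the part at distance at least \<rho> from \<delta> takes part in the move;
    by \<open>cofinal_covers_far\<close> this includes all of Y.\<close>
  define U V W where "U = {w. \<rho> \<le> w \<and> ?t w \<in> X}" and "V = {w. ?t w \<in> Y}" and "W = {w. ?t w \<in> X \<union> Y}"
  have far: "\<delta> +\<^sub>o \<rho> \<le> v" if "v \<in> Y" for v
    using cofinal_covers_far[OF \<delta> *(5) _ _ *(7) that] *(4) by force
  have V\<rho>: "\<rho> \<le> v" if "v \<in> V" for v using far[of "?t v"] that by (simp add: V_def)
  then have V_eq: "V = {w. \<rho> \<le> w \<and> ?t w \<in> Y}" by (auto simp: V_def)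
  have finUV: "finite U" "finite V" unfolding U_def V_eq using fin * by auto
  have UVx: "U \<subseteq> {..<x}" "V \<subseteq> {..<x}" using * by (auto simp: U_def V_def)
  have clUV: "rclosed \<rho> (U \<union> V)"
    unfolding rclosed_iff
  proof
    fix w assume "w \<in> U \<union> V"
    then have "\<rho> \<le> w" "?t w \<in> X \<union> Y" by (auto simp: U_def V_eq)
    then have "\<rho> \<le> fl w" "?t (fl w) \<in> X \<union> Y"
      using le_fl[OF mult_\<rho>] *(5) by (auto simp: rclosed_iff simp flip: fl_translate[OF \<delta>])
    then show "fl w \<in> U \<union> V" by (auto simp: U_def V_eq)
  qed
  have lessUV: "set_less U V" using *(6) by (force simp: set_less_def U_def V_def)
  have tUV: "?t ` (U \<union> V) \<subseteq> X \<union> Y" by (auto simp: U_def V_def)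
  have pos: "\<zero>\<^sub>o < w" if "w \<in> U \<union> V" for w
    using that \<rho>_pos by (auto simp: U_def V_eq intro: order.strict_trans2)
  have cof: "cofinal_covers x U V"
    unfolding cofinal_covers_def
  proof (intro allI impI)
    fix \<gamma> assume "\<gamma> < x"
    then obtain h where h: "cov h (X \<union> Y)" "\<forall>x\<in>X. h x = x" "\<forall>v\<in>Y. ?t \<gamma> < h v \<and> h v < ?t x"
      using *(7) unfolding cofinal_covers_def by (meson oadd_strict_mono)
    have hY: "?t \<gamma> < h (?t v)" "h (?t v) < ?t x" if "v \<in> V" for v using h(3) that by (auto simp: V_def)
    have hX: "h (?t v) = ?t v" if "v \<in> U" for v using h(2) that by (auto simp: U_def)
    have bd: "\<delta> < h (?t z) \<and> h (?t z) < \<delta> +\<^sub>o y" if "z \<in> U \<union> V" for z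
    proof (cases "z \<in> U")
      case True
      then show ?thesis using hX[OF True] pos[of z] UVx assms(2) by auto
    next
      case False
      then have "z \<in> V" using that by blast
      then show ?thesis
        using hY[of z] le_oadd[of \<delta> \<gamma>] oadd_strict_mono[OF assms(2), of \<delta>]
        by (meson order.strict_trans order.strict_trans1)
    qed
    have c: "cov (\<lambda>z. osub \<delta> (h (?t z))) (U \<union> V)"
    proof (rule pull[OF cov_subset[OF h(1) tUV]])
      show "U \<union> V \<subseteq> {..<y}" using UVx assms(2) by auto
    qed (use bd pos in blast)+
    have "\<gamma> < osub \<delta> (h (?t v)) \<and> osub \<delta> (h (?t v)) < x" if "v \<in> V" for v
    proof -
      have "?t (osub \<delta> (h (?t v))) = h (?t v)" using bd[of v] that by (intro oadd_osub) auto
      then show ?thesis using hY[OF that] by (metis oadd_less_cancel)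
    qed
    moreover have "osub \<delta> (h (?t u)) = u" if "u \<in> U" for u using hX[OF that] by simp
    ultimately show "\<exists>h. cov h (U \<union> V) \<and> (\<forall>x\<in>U. h x = x) \<and> (\<forall>y\<in>V. \<gamma> < h y \<and> h y < x)"
      using c by (intro exI[of _ "\<lambda>z. osub \<delta> (h (?t z))"]) blast
  qed
  have cofy: "cofinal_covers y U V"
    by (rule le2_cofinal_covers[OF R finUV(1) UVx(1) finUV(2) UVx(2) clUV lessUV cof])
  obtain v0 where v0: "v0 \<in> Y" using *(8) by blast
  have R1xy: "R1 (?t x) (?t y)" using translate_le1[OF assms(1,2)] le2_imp_le1[OF R] by blast
  \<comment> \<open>Coverings carry the relation from a to cofinally many ordinals below
    \<open>?t x\<close>. Hence a is related to \<open>?t x\<close>, by transitivity to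
    \<open>?t y\<close>, and so to everything in between, wherever the image of v lands.\<close>
  have relY: "R1 a (?t c)" if a: "a \<in> X" "a \<le> \<delta>" and w: "v \<in> Y" "R1 a v" and c: "c < y" for a v c
  proof -
    have lim: "\<exists>\<gamma>'. \<gamma> < \<gamma>' \<and> \<gamma>' < ?t x \<and> R1 a \<gamma>'" if "\<gamma> < ?t x" for \<gamma>
    proof -
      obtain h where h: "cov h (X \<union> Y)" "\<forall>x\<in>X. h x = x" "\<forall>v\<in>Y. \<gamma> < h v \<and> h v < ?t x"
        using *(7) \<open>\<gamma> < ?t x\<close> unfolding cofinal_covers_def by blast
      then show ?thesis using cov_R1[OF h(1), of a v] a w by (intro exI[of _ "h v"]) auto
    qed
    have "R1 a (?t x)"
      by (rule le1_limit[OF _ lim]) (use a *(2) in auto)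
    then have "R1 a (?t y)" using R1xy le1_trans by blast
    then show ?thesis
      by (rule le1_between) (use c a(2) le_oadd[of \<delta> c] in \<open>auto intro: order.trans\<close>)
  qed
  show ?thesis
    unfolding cofinal_covers_def
  proof (intro allI impI)
    fix \<gamma> assume \<gamma>: "\<gamma> < ?t y"
    \<comment> \<open>The second component is the bound \<gamma> seen from \<delta>; the first keeps
      the images above the omitted part, so that it can be glued back.\<close>
    define \<gamma>' where "\<gamma>' = max \<rho> (if \<delta> \<le> \<gamma> then osub \<delta> \<gamma> else \<zero>\<^sub>o)"
    have "\<rho> < y"
    proof -
      have "?t \<rho> \<le> v0" using far v0 by blast
      also have "v0 < ?t x" using *(4) v0 by auto
      finally show ?thesis using assms(2) by simp
    qed
    moreover have "osub \<delta> \<gamma> < y" if "\<delta> \<le> \<gamma>" using \<gamma> oadd_osub[OF that] by (metis oadd_less_cancel)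
    ultimately have "\<gamma>' < y" using assms(1,2) by (auto simp: \<gamma>'_def)
    then obtain g where g: "cov g (U \<union> V)" "\<forall>x\<in>U. g x = x" "\<forall>v\<in>V. \<gamma>' < g v \<and> g v < y"
      using cofy unfolding cofinal_covers_def by blast
    have \<gamma>t: "\<gamma> < ?t c" if "\<gamma>' < c" for c
    proof (cases "\<delta> \<le> \<gamma>")
      case True
      then show ?thesis using that oadd_strict_mono[of "osub \<delta> \<gamma>" c \<delta>] by (simp add: \<gamma>'_def oadd_osub)
    next
      case False
      then show ?thesis using le_oadd[of \<delta> c] by simp
    qed
    define g' where "g' = (\<lambda>x. if x \<in> U \<union> V then g x else x)"
    have g\<rho>: "\<rho> \<le> g w" if "w \<in> U \<union> V" for w using that g by (auto simp: U_def \<gamma>'_def)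
    have covg': "cov g' ({..<\<rho>} \<union> (U \<union> V))"
      unfolding g'_def
    proof (rule glue[OF g(1) clUV])
      fix u v assume u: "u \<in> {..<\<rho>}" and v: "v \<in> U \<union> V"
      then show "u < v" by (auto simp: U_def V_eq)
      show "u < g v" using u g\<rho>[OF v] by auto
      have "\<not> R1 u v" using le_small[of u v] u \<open>u < v\<close> by auto
      then show "R1 u v \<Longrightarrow> R1 u (g v)" "R2 u v \<Longrightarrow> R2 u (g v)" using le2_imp_le1 by blast+
    qed
    have W: "W \<subseteq> {..<\<rho>} \<union> (U \<union> V)" by (auto simp: W_def U_def V_def)
    have g'U: "g' w = w" if "w \<in> W" "w \<notin> V" for w
      using that g(2) by (auto simp: g'_def)
    have g'V: "g' w = g w" if "w \<in> V" for w using that by (simp add: g'_def)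
    define h where "h = (\<lambda>z. if \<delta> \<le> z then ?t (g' (osub \<delta> z)) else z)"
    have ht: "h (?t w) = ?t (g' w)" for w by (simp add: h_def le_oadd)
    have Wy: "w < y" if "w \<in> W" for w
    proof -
      have "?t w < ?t x" using that *(2,4) by (auto simp: W_def)
      then show ?thesis using assms(2) by simp
    qed
    have "cov h (X \<union> Y)"
      unfolding h_def
    proof (rule push[OF cov_subset[OF covg' W] W_def *(5)])
      have "{..<?t x} \<subseteq> {..<?t y}" using assms(2) by auto
      moreover have "X \<union> Y \<subseteq> {..<?t x}" using *(2,4) by auto
      ultimately show "X \<union> Y \<subseteq> {..<?t y}" by (meson order.trans)
      show "\<zero>\<^sub>o < g' w \<and> g' w < y" if "w \<in> W" "\<zero>\<^sub>o < w" for w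
      proof (cases "w \<in> V")
        case True
        then show ?thesis using g(3) by (auto simp: g'V \<gamma>'_def intro: order.strict_trans1 ozero_le)
      next
        case False
        then show ?thesis using g'U[OF that(1)] that Wy by simp
      qed
      have "\<zero>\<^sub>o \<notin> U \<union> V" using pos by blast
      then show "g' \<zero>\<^sub>o = \<zero>\<^sub>o" by (simp add: g'_def)
      show "R1 a (?t (g' w))" if "a \<in> X \<union> Y" "a \<le> \<delta>" "w \<in> W" "R1 a (?t w)" for a w
      proof (cases "w \<in> V")
        case True
        have "a \<in> X" using that(1,2) *(4) by force
        then show ?thesis using relY[of a "?t w" "g w"] that True g(3) by (simp add: g'V V_def)
      next
        case False
        then show ?thesis using g'U that by simp
      qed
    qed
    moreover have "h z = z" if "z \<in> X" for z
    proof (cases "\<delta> \<le> z")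
      case True
      then obtain w where z: "z = ?t w" using ex_oadd by blast
      then have "w \<in> W" using that by (simp add: W_def)
      moreover have "w \<notin> V" using *(6) that z by (force simp: V_def set_less_def)
      ultimately show ?thesis using g'U z by (simp add: ht)
    qed (simp add: h_def)
    moreover have "\<gamma> < h v \<and> h v < ?t y" if "v \<in> Y" for v
    proof -
      have "\<delta> \<le> v" using that *(4) by force
      then obtain w where w: "v = \<delta> +\<^sub>o w" using ex_oadd by blast
      then have "w \<in> V" using that by (simp add: V_def)
      then show ?thesis using w g(3) \<gamma>t by (simp add: ht g'V)
    qed
    ultimately show "\<exists>h. cov h (X \<union> Y) \<and> (\<forall>x\<in>X. h x = x) \<and> (\<forall>v\<in>Y. \<gamma> < h v \<and> h v < ?t y)"
      by blast
  qed
qed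

text \<open>The coverings are pushed to the upper interval, moved up by \<open>R2\<close>, and
  pulled back; the elements below \<rho> do not travel and are glued on at the end.\<close>

lemma cofinal_pull:
  assumes "x < y" and R: "R2 (\<delta> +\<^sub>o x) (\<delta> +\<^sub>o y)"
    and *: "finite X" "X \<subseteq> {..<x}" "finite Y" "Y \<subseteq> {\<zero>\<^sub>o<..<x}" "rclosed \<rho> (X \<union> Y)"
      "set_less X Y" "cofinal_covers x X Y" "Y \<noteq> {}"
  shows "cofinal_covers y X Y"
proof -
  let ?t = "\<lambda>z. \<delta> +\<^sub>o z"
  \<comment> \<open>The translate \<delta> of 0 may be related to translates of Y, while 0 is
    related to none of Y, so the coverings give no control there. Dropping 0 forces dropping
    everything with floor 0 to keep the set closed.\<close>
  define U where "U = X \<inter> {\<rho>..}"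
  have far: "\<rho> \<le> v" if "v \<in> Y" for v
    using cofinal_covers_far[OF mult_0 *(5) _ _ *(7) that] *(4) by force
  have \<rho>: "\<rho> < y"
  proof -
    obtain v where "v \<in> Y" using *(8) by blast
    then have "\<rho> \<le> v" "v < x" using far *(4) by auto
    then show ?thesis using assms(1) by simp
  qed
  have UY\<rho>: "\<rho> \<le> w" if "w \<in> U \<union> Y" for w using that far by (auto simp: U_def)
  have UYx: "w < x" if "w \<in> U \<union> Y" for w using that *(2,4) by (auto simp: U_def)
  have pos: "\<zero>\<^sub>o < w" if "w \<in> U \<union> Y" for w using UY\<rho>[OF that] \<rho>_pos by simp
  have cl: "rclosed \<rho> (U \<union> Y)"
    unfolding rclosed_iff
  proof
    fix w assume w: "w \<in> U \<union> Y"
    then have "fl w \<in> X \<union> Y" using *(5) by (auto simp: rclosed_iff U_def)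
    moreover have "\<rho> \<le> fl w" using le_fl[OF mult_\<rho>] UY\<rho>[OF w] .
    ultimately show "fl w \<in> U \<union> Y" by (auto simp: U_def)
  qed
  have tU: "finite (?t ` U)" "?t ` U \<subseteq> {..<?t x}" "finite (?t ` Y)" "?t ` Y \<subseteq> {..<?t x}"
    "set_less (?t ` U) (?t ` Y)"
    using *(1,3,6) UYx by (auto simp: U_def set_less_def)
  have tcl: "rclosed \<rho> (?t ` U \<union> ?t ` Y)"
    unfolding image_Un[symmetric] by (rule rclosed_translate[OF \<delta> cl])
  have cof: "cofinal_covers (?t x) (?t ` U) (?t ` Y)"
    unfolding cofinal_covers_def
  proof (intro allI impI)
    fix \<gamma> assume \<gamma>: "\<gamma> < ?t x"
    define \<gamma>' where "\<gamma>' = (if \<delta> \<le> \<gamma> then osub \<delta> \<gamma> else \<zero>\<^sub>o)"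
    have "\<zero>\<^sub>o < x" using *(4,8) by auto
    moreover have "osub \<delta> \<gamma> < x" if "\<delta> \<le> \<gamma>" using \<gamma> oadd_osub[OF that] by (metis oadd_less_cancel)
    ultimately have "\<gamma>' < x" by (auto simp: \<gamma>'_def)
    then obtain g where g: "cov g (X \<union> Y)" "\<forall>x\<in>X. g x = x" "\<forall>v\<in>Y. \<gamma>' < g v \<and> g v < x"
      using *(7) unfolding cofinal_covers_def by blast
    have \<gamma>t: "\<gamma> < ?t c" if "\<gamma>' < c" for c
    proof (cases "\<delta> \<le> \<gamma>")
      case True
      then show ?thesis using that oadd_strict_mono[of "osub \<delta> \<gamma>" c \<delta>] by (simp add: \<gamma>'_def oadd_osub)
    next
      case False
      then show ?thesis using le_oadd[of \<delta> c] by simp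
    qed
    have gx: "\<zero>\<^sub>o < g w \<and> g w < x" if "w \<in> U \<union> Y" for w
    proof (cases "w \<in> Y")
      case True
      then have "\<gamma>' < g w" "g w < x" using g(3) by auto
      then show ?thesis using ozero_le[of \<gamma>'] by simp
    next
      case False
      then have "g w = w" using that g(2) by (auto simp: U_def)
      then show ?thesis using pos UYx that by simp
    qed
    define h where "h = (\<lambda>z. if \<delta> \<le> z then ?t (g (osub \<delta> z)) else z)"
    have ht: "h (?t w) = ?t (g w)" for w by (simp add: h_def le_oadd)
    have Zeq: "U \<union> Y = {w. ?t w \<in> ?t ` U \<union> ?t ` Y}" by auto
    have "cov h (?t ` U \<union> ?t ` Y)"
      unfolding h_def
    proof (rule push[OF _ Zeq tcl])
      show "cov g (U \<union> Y)" by (rule cov_subset[OF g(1)]) (auto simp: U_def)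
      have "{..<?t x} \<subseteq> {..<?t y}" using assms(1) by auto
      then show "?t ` U \<union> ?t ` Y \<subseteq> {..<?t y}"
        by (intro Un_least order.trans[OF tU(2)] order.trans[OF tU(4)])
      show "\<zero>\<^sub>o < g w \<and> g w < y" if "w \<in> U \<union> Y" for w
        using gx[OF that] assms(1) order.strict_trans by blast
      show "g \<zero>\<^sub>o = \<zero>\<^sub>o" if "\<zero>\<^sub>o \<in> U \<union> Y" using pos[OF that] by simp
      \<comment> \<open>Vacuous: without 0, the translated set lies strictly above \<delta>.\<close>
      show "R1 a (?t (g w))" if a: "a \<in> ?t ` U \<union> ?t ` Y" "a \<le> \<delta>" for a w
      proof -
        obtain z where "z \<in> U \<union> Y" "a = ?t z" using a(1) by blast
        then have False using a(2) pos[of z] less_oadd_iff[of \<delta> z] by (meson leD)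
        then show ?thesis ..
      qed
    qed
    moreover have "h z = z" if "z \<in> ?t ` U" for z
      using that g(2) by (auto simp: U_def ht)
    moreover have "\<gamma> < h v \<and> h v < ?t x" if v: "v \<in> ?t ` Y" for v
    proof -
      obtain w where w: "v = ?t w" "w \<in> Y" using v by blast
      then show ?thesis using g(3) \<gamma>t by (simp add: ht)
    qed
    ultimately show "\<exists>h. cov h (?t ` U \<union> ?t ` Y) \<and> (\<forall>x\<in>?t ` U. h x = x) \<and>
        (\<forall>v\<in>?t ` Y. \<gamma> < h v \<and> h v < ?t x)"
      by (intro exI[of _ h]) blast
  qed
  have cofy: "cofinal_covers (?t y) (?t ` U) (?t ` Y)"
    by (rule le2_cofinal_covers[OF R tU(1-4) tcl tU(5) cof])
  show ?thesis
    unfolding cofinal_covers_def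
  proof (intro allI impI)
    fix \<gamma> assume \<gamma>: "\<gamma> < y"
    \<comment> \<open>Images above \<open>?t \<rho>\<close> are pulled back to ordinals above
      \<rho>, as needed for gluing.\<close>
    define \<gamma>' where "\<gamma>' = max \<rho> \<gamma>"
    have "?t \<gamma>' < ?t y" using \<gamma> \<rho> by (simp add: \<gamma>'_def)
    then obtain h where low: "cov h (?t ` U \<union> ?t ` Y) \<and> (\<forall>x\<in>?t ` U. h x = x) \<and>
        (\<forall>v\<in>?t ` Y. ?t \<gamma>' < h v \<and> h v < ?t y)"
      by (rule cofy[unfolded cofinal_covers_def, rule_format, elim_format]) (elim exE)
    have h: "cov h (?t ` (U \<union> Y))" using low by (simp only: image_Un)
    have hU: "h (?t u) = ?t u" if "u \<in> U" for u using low that by simp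
    have hY: "?t \<gamma>' < h (?t v)" "h (?t v) < ?t y" if "v \<in> Y" for v using low that by simp_all
    have bd: "?t \<rho> \<le> h (?t z) \<and> h (?t z) < ?t y" if "z \<in> U \<union> Y" for z
    proof (cases "z \<in> U")
      case True
      then show ?thesis using hU[OF True] UY\<rho>[OF that] UYx[OF that] assms(1) by simp
    next
      case False
      then have "z \<in> Y" using that by blast
      moreover have "?t \<rho> \<le> ?t \<gamma>'" by (simp add: \<gamma>'_def)
      ultimately show ?thesis using hY[of z] by (meson order.strict_implies_order order.trans)
    qed
    have "\<delta> < ?t \<rho>" using \<rho>_pos by simp
    then have bd': "\<delta> < h (?t z)" if "z \<in> U \<union> Y" for z using bd[OF that] by (blast intro: order.strict_trans2)
    define g where "g = (\<lambda>z. osub \<delta> (h (?t z)))"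
    have c: "cov g (U \<union> Y)"
      unfolding g_def
    proof (rule pull[OF h])
      show "U \<union> Y \<subseteq> {..<y}" using UYx assms(1) by force
      show "h \<delta> = \<delta>" if "\<zero>\<^sub>o \<in> U \<union> Y" using pos[OF that] by simp
    qed (use bd bd' in blast)+
    have eq: "?t (g v) = h (?t v)" if "v \<in> U \<union> Y" for v
      using bd'[OF that] unfolding g_def by (intro oadd_osub) simp
    have g\<rho>: "\<rho> \<le> g v" if "v \<in> U \<union> Y" for v using bd[OF that] by (simp flip: eq[OF that])
    have gY: "\<gamma> < g v \<and> g v < y" if "v \<in> Y" for v
    proof -
      have "\<gamma>' < g v \<and> g v < y" using hY[OF that] eq[of v] that by (metis UnI2 oadd_less_cancel)
      then show ?thesis by (simp add: \<gamma>'_def)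
    qed
    define k where "k = (\<lambda>x. if x \<in> U \<union> Y then g x else x)"
    have "cov k ({..<\<rho>} \<union> (U \<union> Y))"
      unfolding k_def
    proof (rule glue[OF c cl])
      fix u v assume u: "u \<in> {..<\<rho>}" and v: "v \<in> U \<union> Y"
      then show "u < v" using UY\<rho>[OF v] by simp
      show "u < g v" using u g\<rho>[OF v] by simp
      have "\<not> R1 u v" using le_small[of u v] u \<open>u < v\<close> by auto
      then show "R1 u v \<Longrightarrow> R1 u (g v)" "R2 u v \<Longrightarrow> R2 u (g v)" using le2_imp_le1 by blast+
    qed
    then have "cov k (X \<union> Y)" by (rule cov_subset) (auto simp: U_def)
    moreover have "k x = x" if "x \<in> X" for x
    proof -
      have "x \<notin> Y" using that *(6) by (force simp: set_less_def)
      then show ?thesis using hU[of x] by (auto simp: k_def g_def)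
    qed
    moreover have "\<gamma> < k v \<and> k v < y" if "v \<in> Y" for v using gY[OF that] that by (simp add: k_def)
    ultimately show "\<exists>h. cov h (X \<union> Y) \<and> (\<forall>x\<in>X. h x = x) \<and> (\<forall>v\<in>Y. \<gamma> < h v \<and> h v < y)"
      by blast
  qed
qed

lemma translate_le2:
  assumes "\<zero>\<^sub>o < x" "x < y"
  shows "R2 x y \<longleftrightarrow> R2 (\<delta> +\<^sub>o x) (\<delta> +\<^sub>o y)"
proof
  \<comment> \<open>Y may meet the part of \<alpha> up to d. A recurring image of Y beyond d,
    obtained from \<open>cofinal_covers_obtain\<close>, can replace it. Below, d is \<delta> when
    pushing and 0 when pulling.\<close>
  have restrict: "cofinal_covers \<beta> X Y"
    if "finite X" "X \<subseteq> {..<\<alpha>}" "finite Y" "Y \<subseteq> {..<\<alpha>}" "rclosed \<rho> (X \<union> Y)" "set_less X Y" "cofinal_covers \<alpha> X Y"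
      "d < \<alpha>" and step: "\<And>Y. finite Y \<Longrightarrow> Y \<subseteq> {d<..<\<alpha>} \<Longrightarrow> rclosed \<rho> (X \<union> Y) \<Longrightarrow> set_less X Y \<Longrightarrow>
        cofinal_covers \<alpha> X Y \<Longrightarrow> Y \<noteq> {} \<Longrightarrow> cofinal_covers \<beta> X Y"
    for \<alpha> \<beta> d X Y
  proof (cases "Y = {}")
    case True
    then show ?thesis using cov_id by (auto simp: cofinal_covers_def intro!: exI[of _ "\<lambda>x. x"])
  next
    case False
    note prems = that
    obtain h where h: "cov h (X \<union> Y)" "\<And>x. x \<in> X \<Longrightarrow> h x = x" "\<And>y. y \<in> Y \<Longrightarrow> d < h y \<and> h y < \<alpha>"
      "cofinal_covers \<alpha> X (h ` Y)"
      using cofinal_covers_obtain[OF prems(1,3,7,8)] by blast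
    have "X \<union> h ` Y = h ` (X \<union> Y)" using h(2) by (simp add: image_Un)
    then have "rclosed \<rho> (X \<union> h ` Y)" using cov_closed[OF h(1) that(5)] by simp
    moreover have "set_less X (h ` Y)" by (rule cov_set_less[OF h(1) _ that(6)]) (use h(2) in blast)
    moreover have "h ` Y \<subseteq> {d<..<\<alpha>}" using h(3) by auto
    ultimately have "cofinal_covers \<beta> X (h ` Y)" using that(3) False h(4) by (intro step) auto
    then show ?thesis using cofinal_covers_comp[OF h(1,2)] by blast
  qed
  {
    assume R: "R2 x y"
    show "R2 (\<delta> +\<^sub>o x) (\<delta> +\<^sub>o y)"
    proof (rule le2I)
      fix X Y assume *: "finite X" "X \<subseteq> {..<\<delta> +\<^sub>o x}" "finite Y" "Y \<subseteq> {..<\<delta> +\<^sub>o x}"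
        "rclosed \<rho> (X \<union> Y)" "set_less X Y" "cofinal_covers (\<delta> +\<^sub>o x) X Y"
      show "cofinal_covers (\<delta> +\<^sub>o y) X Y"
        by (rule restrict[OF *, of \<delta>]) (use assms in simp, rule cofinal_push[OF assms R *(1,2)])
    next
      fix X Y assume *: "finite X" "X \<subseteq> {..<\<delta> +\<^sub>o x}" "finite Y" "Y \<subseteq> {\<delta> +\<^sub>o x..<\<delta> +\<^sub>o y}" "rclosed \<rho> (X \<union> Y)"
      let ?Q = "\<lambda>v w. R1 v y \<longrightarrow> R1 w x"
      have low: "\<exists>g. cov g (U \<union> V) \<and> (\<forall>u\<in>U. g u = u) \<and> (\<forall>v\<in>V. g v < x \<and> ?Q v (g v))"
        if "finite U" "U \<subseteq> {..<x}" "finite V" "V \<subseteq> {x..<y}" "rclosed \<rho> (U \<union> V)" for U V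
        using le2_cover[OF R that] by metis
      obtain h where h: "cov h (X \<union> Y)" "\<forall>x\<in>X. h x = x"
        "\<forall>v\<in>Y. \<exists>w w'. v = \<delta> +\<^sub>o w \<and> h v = \<delta> +\<^sub>o w' \<and> \<zero>\<^sub>o < w' \<and> x \<le> w \<and> w < y \<and> w' < x \<and> ?Q w w'"
        using push_cover[where Q = ?Q, OF assms * low] by blast
      have "h v < \<delta> +\<^sub>o x \<and> (R1 v (\<delta> +\<^sub>o y) \<longrightarrow> R1 (h v) (\<delta> +\<^sub>o x))" if v: "v \<in> Y" for v
      proof -
        obtain w w' where w: "v = \<delta> +\<^sub>o w" "h v = \<delta> +\<^sub>o w'" "\<zero>\<^sub>o < w'" "x \<le> w" "w < y" "w' < x" "?Q w w'"
          using h(3) v by blast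
        have "\<zero>\<^sub>o < w" using assms(1) w(4) by simp
        \<comment> \<open>The comparison at y itself is beyond the induction hypothesis and comes
          from \<open>translate_le1\<close>; the one at x < y is \<open>IH1\<close>.\<close>
        then have "R1 w y \<longleftrightarrow> R1 v (\<delta> +\<^sub>o y)"
          using translate_le1[OF _ w(5)] w(1) by simp
        moreover have "R1 w' x \<longleftrightarrow> R1 (h v) (\<delta> +\<^sub>o x)" unfolding w(2) by (rule IH1[OF w(3) assms(2)])
        ultimately show ?thesis using w by simp
      qed
      then show "\<exists>h. cov h (X \<union> Y) \<and> (\<forall>x\<in>X. h x = x) \<and> (\<forall>v\<in>Y. h v < \<delta> +\<^sub>o x) \<and>
          (\<forall>v\<in>Y. R1 v (\<delta> +\<^sub>o y) \<longrightarrow> R1 (h v) (\<delta> +\<^sub>o x))"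
        using h(1,2) by blast
    qed (use assms in simp)
  next
    assume R: "R2 (\<delta> +\<^sub>o x) (\<delta> +\<^sub>o y)"
    show "R2 x y"
    proof (rule le2I)
      fix X Y assume *: "finite X" "X \<subseteq> {..<x}" "finite Y" "Y \<subseteq> {..<x}"
        "rclosed \<rho> (X \<union> Y)" "set_less X Y" "cofinal_covers x X Y"
      show "cofinal_covers y X Y"
        by (rule restrict[OF * assms(1)]) (rule cofinal_pull[OF assms(2) R *(1,2)])
    next
      fix X Y assume *: "finite X" "X \<subseteq> {..<x}" "finite Y" "Y \<subseteq> {x..<y}" "rclosed \<rho> (X \<union> Y)"
      let ?Q = "\<lambda>v w. R1 v (\<delta> +\<^sub>o y) \<longrightarrow> R1 w (\<delta> +\<^sub>o x)"
      have low: "\<exists>g. cov g (U \<union> V) \<and> (\<forall>u\<in>U. g u = u) \<and> (\<forall>v\<in>V. g v < \<delta> +\<^sub>o x \<and> ?Q v (g v))"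
        if "finite U" "U \<subseteq> {..<\<delta> +\<^sub>o x}" "finite V" "V \<subseteq> {\<delta> +\<^sub>o x..<\<delta> +\<^sub>o y}" "rclosed \<rho> (U \<union> V)" for U V
        using le2_cover[OF R that] by metis
      obtain h where h: "cov h (X \<union> Y)" "\<forall>x\<in>X. h x = x"
        "\<forall>v\<in>Y. \<zero>\<^sub>o < h v \<and> h v < x \<and> ?Q (\<delta> +\<^sub>o v) (\<delta> +\<^sub>o h v)"
        using pull_cover[where Q = ?Q, OF assms * low] by blast
      have "R1 v y \<longrightarrow> R1 (h v) x" if "v \<in> Y" for v
      proof -
        have v: "x \<le> v" "v < y" using *(4) that by auto
        have "R1 v y \<longleftrightarrow> R1 (\<delta> +\<^sub>o v) (\<delta> +\<^sub>o y)"
          by (rule translate_le1[OF order.strict_trans2[OF assms(1) v(1)] v(2)])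
        moreover have "R1 (h v) x \<longleftrightarrow> R1 (\<delta> +\<^sub>o h v) (\<delta> +\<^sub>o x)"
          by (rule IH1[OF _ assms(2)]) (use h(3) that in blast)
        ultimately show ?thesis using h(3) that by blast
      qed
      then show "\<exists>h. cov h (X \<union> Y) \<and> (\<forall>x\<in>X. h x = x) \<and> (\<forall>v\<in>Y. h v < x) \<and> (\<forall>v\<in>Y. R1 v y \<longrightarrow> R1 (h v) x)"
        using h by blast
    qed (use assms in simp)
  }
qed

end

text \<open>The endpoint y = B is included although \<open>no2\<close> stops short of B, because the
  step at y uses \<open>no2\<close> only for b < y. This is how the isomorphism reaches the closed
  right end of the interval.\<close>

lemma translate:
  assumes \<delta>: "mult \<delta>" and no2: "\<And>a b. a \<le> \<delta> \<Longrightarrow> \<zero>\<^sub>o < b \<Longrightarrow> b < B \<Longrightarrow> \<not> R2 a (\<delta> +\<^sub>o b)"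
    and "\<zero>\<^sub>o < x" "y \<le> B"
  shows "(R1 x y \<longleftrightarrow> R1 (\<delta> +\<^sub>o x) (\<delta> +\<^sub>o y)) \<and> (R2 x y \<longleftrightarrow> R2 (\<delta> +\<^sub>o x) (\<delta> +\<^sub>o y))"
  using assms(3,4)
proof (induction y arbitrary: x rule: less_induct)
  case (less y)
  have IH: "(R1 z w \<longleftrightarrow> R1 (\<delta> +\<^sub>o z) (\<delta> +\<^sub>o w)) \<and> (R2 z w \<longleftrightarrow> R2 (\<delta> +\<^sub>o z) (\<delta> +\<^sub>o w))"
    if "\<zero>\<^sub>o < z" "w < y" for z w
    using less.IH[OF that(2,1)] that(2) less.prems(2) by simp
  have no2': "\<not> R2 a (\<delta> +\<^sub>o b)" if "a \<le> \<delta>" "\<zero>\<^sub>o < b" "b < y" for a b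
    using no2[OF that(1,2)] that(3) less.prems(2) by simp
  consider "x < y" | "x = y" | "y < x" by (rule linorder_cases)
  then show ?case
  proof cases
    case 1
    show ?thesis
      using translate_le1[OF \<delta> _ _ no2' less.prems(1) 1] translate_le2[OF \<delta> _ _ no2' less.prems(1) 1] IH
      by blast
  next
    case 3
    then have "\<not> x \<le> y" "\<not> \<delta> +\<^sub>o x \<le> \<delta> +\<^sub>o y" by simp_all
    then show ?thesis using le1_le le2_le by blast
  qed simp
qed

section \<open>Separating ordinals\<close>

definition sep :: "'o \<Rightarrow> bool"
  where "sep s \<longleftrightarrow> mult s \<and> (\<forall>a b. a \<le> s \<longrightarrow> s < b \<longrightarrow> \<not> R1 a b)"

lemma sep_translate:
  assumes "sep s" "\<zero>\<^sub>o < x"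
  shows "(R1 x y \<longleftrightarrow> R1 (s +\<^sub>o x) (s +\<^sub>o y)) \<and> (R2 x y \<longleftrightarrow> R2 (s +\<^sub>o x) (s +\<^sub>o y))"
proof (rule translate[where B = y])
  show "\<not> R2 a (s +\<^sub>o b)" if "a \<le> s" "\<zero>\<^sub>o < b" for a b
    using that assms(1) le2_imp_le1 unfolding sep_def by (metis less_oadd_iff)
qed (use assms in \<open>simp_all add: sep_def\<close>)

lemma cov_oadd:
  assumes \<delta>: "mult \<delta>"
    and rel: "\<And>z w. z \<in> Z \<Longrightarrow> w \<in> Z \<Longrightarrow>
      (R1 z w \<longleftrightarrow> R1 (\<delta> +\<^sub>o z) (\<delta> +\<^sub>o w)) \<and> (R2 z w \<longleftrightarrow> R2 (\<delta> +\<^sub>o z) (\<delta> +\<^sub>o w))"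
  shows "cov (\<lambda>z. \<delta> +\<^sub>o z) Z" and "cov (osub \<delta>) ((\<lambda>z. \<delta> +\<^sub>o z) ` Z)"
proof -
  show "cov (\<lambda>z. \<delta> +\<^sub>o z) Z"
    by (rule covI) (use rel in \<open>auto simp: rfun_translate[OF \<delta>]\<close>)
  show "cov (osub \<delta>) ((\<lambda>z. \<delta> +\<^sub>o z) ` Z)"
    by (rule covI) (use rel in \<open>auto simp: rfun_translate[OF \<delta>]\<close>)
qed

text \<open>Lowering the larger argument to \<kappa> would give \<kappa> a proper
  predecessor.\<close>

lemma minimal1_not_le1: "minimal1 \<rho> \<kappa> \<Longrightarrow> a < \<kappa> \<Longrightarrow> \<kappa> \<le> b \<Longrightarrow> \<not> R1 a b"
  using le1_between[of a b \<kappa>] by (metis minimal1_iff order.strict_iff_order)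

text \<open>Every z in [\<kappa>, N) has a minimal predecessor, which can only be \<kappa>. If N
  were a limit, \<kappa> would be related to N as well, so N is a successor \<theta> + 1. Since N is
  minimal, nothing up to \<theta> is related to anything beyond \<theta>.\<close>

lemma ex_sep:
  assumes N: "minimal1 \<rho> N" and x: "x < N" and \<kappa>: "minimal1 \<rho> \<kappa>" "\<kappa> \<le> x"
    and nxt: "\<And>z. minimal1 \<rho> z \<Longrightarrow> \<kappa> < z \<Longrightarrow> N \<le> z"
  obtains s \<theta> where "sep s" "x \<le> \<theta>" "N = osuc \<theta>" "\<theta> \<le> s" "s \<le> \<theta> +\<^sub>o \<rho>"
proof -
  have R: "R1 \<kappa> z" if "\<kappa> \<le> z" "z < N" for z
  proof -
    obtain z' where z': "minimal1 \<rho> z'" "R1 z' z" using ex_minimal1 by blast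
    then have "\<not> \<kappa> < z'" using nxt[OF z'(1)] le1_le[OF z'(2)] that(2) by auto
    moreover have "\<not> z' < \<kappa>" using minimal1_not_le1[OF \<kappa>(1) _ that(1)] z'(2) by blast
    ultimately show ?thesis using z'(2) by (metis linorder_neqE)
  qed
  have "\<kappa> < N" using x \<kappa>(2) by simp
  have "\<not> R1 \<kappa> N" using N \<open>\<kappa> < N\<close> by (auto simp: minimal1_iff)
  then obtain \<gamma> where \<gamma>: "\<gamma> < N" "\<And>\<gamma>'. \<gamma> < \<gamma>' \<Longrightarrow> \<gamma>' < N \<Longrightarrow> \<not> R1 \<kappa> \<gamma>'"
    using le1_limit[OF \<open>\<kappa> < N\<close>] by blast
  \<comment> \<open>No ordinal strictly between \<theta> and N is left: it would be related to
    \<kappa> by R, but not by the choice of \<gamma>.\<close>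
  define \<theta> where "\<theta> = max \<kappa> \<gamma>"
  have "\<theta> < N" using \<gamma>(1) \<open>\<kappa> < N\<close> by (simp add: \<theta>_def)
  have gap: "N \<le> z" if "\<theta> < z" for z
  proof (rule ccontr)
    assume "\<not> N \<le> z"
    moreover have "\<kappa> \<le> z" "\<gamma> < z" using that by (auto simp: \<theta>_def intro: order.strict_implies_order)
    ultimately show False using \<gamma>(2)[of z] R[of z] by (meson not_le)
  qed
  have N_eq: "N = osuc \<theta>"
    by (rule antisym) (simp_all add: osuc_le_iff \<open>\<theta> < N\<close> gap less_osuc)
  have "x \<le> \<theta>" using x by (simp add: N_eq less_osuc_iff)
  have no: "\<not> R1 a b" if "a \<le> \<theta>" "\<theta> < b" for a b
    using minimal1_not_le1[OF N _ gap[OF that(2)]] that(1) \<open>\<theta> < N\<close> by simp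
  show ?thesis
  proof (cases "mult \<theta>")
    case True
    then have "sep \<theta>" using no by (auto simp: sep_def)
    then show ?thesis using that[of \<theta> \<theta>] \<open>x \<le> \<theta>\<close> N_eq by (simp add: le_oadd)
  next
    case False
    \<comment> \<open>The next multiple of \<rho> after \<theta>. A relation starting in (\<theta>,
      s] starts at a multiple of \<rho>, hence at s, and \<open>le1_not_successor_mult\<close>
      excludes that.\<close>
    define s where "s = fl \<theta> +\<^sub>o \<rho>"
    have lt: "\<theta> < s" unfolding s_def by (rule less_fl_oadd)
    have m: "mult s" unfolding s_def by (simp add: mult_oadd)
    have "\<not> R1 a b" if ab: "a \<le> s" "s < b" for a b
    proof
      assume R: "R1 a b"
      then have "\<theta> < a" using no[of a b] ab lt by (meson leI order.strict_trans)
      have "mult a" using le1_mult[OF R] ab by simp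
      moreover have "fl \<theta> < a" using fl_le[of \<theta>] \<open>\<theta> < a\<close> by simp
      ultimately have "s \<le> a" unfolding s_def by (intro mult_less) auto
      then have "R1 (fl \<theta> +\<^sub>o \<rho>) b" using R ab(1) by (simp add: s_def)
      then show False using le1_not_successor_mult[of "fl \<theta>" b] ab(2) by (simp add: s_def)
    qed
    then have "sep s" using m by (simp add: sep_def)
    moreover have "s \<le> \<theta> +\<^sub>o \<rho>" unfolding s_def by (rule oadd_mono_left[OF fl_le])
    ultimately show ?thesis using that[of s \<theta>] \<open>x \<le> \<theta>\<close> N_eq lt False by auto
  qed
qed

section \<open>The enumeration of the minimal ordinals\<close>

end

locale recurrence = resemblance \<rho> for \<rho> :: "'o::ordinal" +
  fixes \<alpha> \<mu> :: 'o
  assumes \<alpha>: "less_theta1 \<rho> \<alpha>" and \<alpha>_eq: "\<alpha> = \<rho> \<cdot>\<^sub>o \<mu>"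
    and \<mu>: "oinfinite \<mu>" "additively_indecomposable \<mu>"
begin

abbreviation K :: 'o where "K \<equiv> kappa \<rho> \<alpha>"

lemma oone_less_\<mu>: "\<one>\<^sub>o < \<mu>"
proof (rule ccontr)
  assume "\<not> \<one>\<^sub>o < \<mu>"
  have "{..<\<mu>} \<subseteq> {\<zero>\<^sub>o}"
  proof
    fix z assume "z \<in> {..<\<mu>}"
    then have "z < \<one>\<^sub>o" using \<open>\<not> \<one>\<^sub>o < \<mu>\<close> by (simp add: order.strict_trans2)
    then have "z \<le> \<zero>\<^sub>o" by (simp only: less_osuc_iff)
    then show "z \<in> {\<zero>\<^sub>o}" using ozero_le[of z] by simp
  qed
  then have "finite {..<\<mu>}" by (rule finite_subset) simp
  then show False using \<mu>(1) by (simp add: oinfinite_def)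
qed

lemma \<rho>_less_\<alpha>: "\<rho> < \<alpha>"
  using omul_strict_mono[OF \<rho>_pos oone_less_\<mu>] by (simp add: \<alpha>_eq)

text \<open>Distributivity reduces sums below \<open>\<rho> \<cdot>\<^sub>o \<mu>\<close> to sums of
  the right factors below \<mu>.\<close>

lemma \<alpha>_oadd:
  assumes "x < \<alpha>" "y < \<alpha>"
  shows "x +\<^sub>o y < \<alpha>"
proof -
  \<comment> \<open>z lies below some \<open>\<rho> \<cdot>\<^sub>o a +\<^sub>o \<rho>\<close> with
    a < \<mu>, and a + 1 is still below \<mu> because 1 < \<mu>.\<close>
  have *: "\<exists>a<\<mu>. z < \<rho> \<cdot>\<^sub>o a" if z: "z < \<alpha>" for z
  proof -
    obtain a where a: "a < \<mu>" "z < \<rho> \<cdot>\<^sub>o a +\<^sub>o \<rho>"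
      using z omul_le_iff[of \<rho> \<mu> z] by (auto simp: \<alpha>_eq not_le[symmetric])
    have "osuc a = a +\<^sub>o \<one>\<^sub>o" by (simp add: oadd_osuc oadd_ozero)
    also have "\<dots> < \<mu>" using \<mu>(2) a(1) oone_less_\<mu> by (simp add: additively_indecomposable_def)
    finally show ?thesis using a(2) by (auto simp flip: omul_osuc)
  qed
  obtain a b where ab: "a < \<mu>" "x < \<rho> \<cdot>\<^sub>o a" "b < \<mu>" "y < \<rho> \<cdot>\<^sub>o b"
    using *[OF assms(1)] *[OF assms(2)] by blast
  have "x +\<^sub>o y < x +\<^sub>o \<rho> \<cdot>\<^sub>o b" using ab by simp
  also have "\<dots> \<le> \<rho> \<cdot>\<^sub>o a +\<^sub>o \<rho> \<cdot>\<^sub>o b" using ab by (intro oadd_mono_left) simp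
  also have "\<dots> = \<rho> \<cdot>\<^sub>o (a +\<^sub>o b)" by (simp add: omul_oadd)
  also have "\<dots> < \<alpha>"
    using \<mu>(2) ab unfolding \<alpha>_eq by (intro omul_strict_mono[OF \<rho>_pos]) (simp add: additively_indecomposable_def)
  finally show ?thesis .
qed

lemma oone_less_\<alpha>: "\<one>\<^sub>o < \<alpha>"
  using \<rho>_less_\<alpha> \<rho>_pos osuc_le_iff[of "\<zero>\<^sub>o" \<rho>] by simp

lemma kappa_minimal: "\<gamma> \<le> \<alpha> \<Longrightarrow> minimal1 \<rho> (kappa \<rho> \<gamma>)"
  using kappa_props[OF less_theta1_downward[OF \<alpha>]] by blast

lemma kappa_less: "\<gamma> < \<gamma>' \<Longrightarrow> \<gamma>' \<le> \<alpha> \<Longrightarrow> kappa \<rho> \<gamma> < kappa \<rho> \<gamma>'"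
  using kappa_props[OF less_theta1_downward[OF \<alpha>]] by blast

lemma ex_kappa:
  assumes "minimal1 \<rho> z" "z \<le> K"
  obtains \<gamma> where "\<gamma> \<le> \<alpha>" "z = kappa \<rho> \<gamma>"
proof -
  obtain \<gamma> where \<gamma>: "less_theta1 \<rho> \<gamma>" "z = kappa \<rho> \<gamma>"
    using assms(1) kappa_image[of \<rho>] by (metis imageE mem_Collect_eq)
  have "\<gamma> \<le> \<alpha>"
  proof (rule ccontr)
    assume "\<not> \<gamma> \<le> \<alpha>"
    then have "K < z" using kappa_props[OF \<gamma>(1)] \<gamma>(2) by simp
    then show False using assms(2) by simp
  qed
  then show ?thesis using that \<gamma> by blast
qed

lemma K_minimal: "minimal1 \<rho> K"
  by (rule kappa_minimal) simp

text \<open>The index \<gamma> belongs to a minimal predecessor of x. That predecessor cannot be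
  related to anything at or beyond the next minimal ordinal, so x lies before it.\<close>

lemma next_kappa:
  assumes "x < K"
  obtains \<gamma> where "\<gamma> < \<alpha>" "kappa \<rho> \<gamma> \<le> x" "x < kappa \<rho> (osuc \<gamma>)" "osuc \<gamma> < \<alpha>"
    "\<And>z. minimal1 \<rho> z \<Longrightarrow> kappa \<rho> \<gamma> < z \<Longrightarrow> kappa \<rho> (osuc \<gamma>) \<le> z"
proof -
  obtain z where z: "minimal1 \<rho> z" "R1 z x" using ex_minimal1 by blast
  then have "z \<le> x" using le1_le by blast
  then have "z \<le> K" using assms by simp
  then obtain \<gamma> where \<gamma>: "\<gamma> \<le> \<alpha>" "z = kappa \<rho> \<gamma>" by (rule ex_kappa[OF z(1)])
  have "\<gamma> < \<alpha>" using \<gamma> \<open>z \<le> x\<close> assms by (metis leD order.not_eq_order_implies_strict)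
  have "osuc \<gamma> = \<gamma> +\<^sub>o \<one>\<^sub>o" by (simp add: oadd_osuc oadd_ozero)
  then have suc: "osuc \<gamma> < \<alpha>" using \<alpha>_oadd[OF \<open>\<gamma> < \<alpha>\<close> oone_less_\<alpha>] by simp
  have least: "kappa \<rho> (osuc \<gamma>) \<le> w" if w: "minimal1 \<rho> w" "kappa \<rho> \<gamma> < w" for w
  proof (cases "w \<le> K")
    case True
    then obtain \<gamma>' where \<gamma>': "\<gamma>' \<le> \<alpha>" "w = kappa \<rho> \<gamma>'" by (rule ex_kappa[OF w(1)])
    then have "\<gamma> < \<gamma>'" using kappa_less[of \<gamma>' \<gamma>] w(2) \<gamma>(1) by (metis linorder_neqE order.asym)
    then have "osuc \<gamma> \<le> \<gamma>'" by (simp add: osuc_le_iff)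
    then show ?thesis using kappa_less[of "osuc \<gamma>" \<gamma>'] \<gamma>' by (metis le_less)
  next
    case False
    then show ?thesis using kappa_less[OF suc] by simp
  qed
  have "x < kappa \<rho> (osuc \<gamma>)"
  proof (rule ccontr)
    assume "\<not> ?thesis"
    moreover have "z < kappa \<rho> (osuc \<gamma>)" using kappa_less[OF less_osuc order.strict_implies_order[OF suc]] \<gamma>(2) by simp
    ultimately show False
      using minimal1_not_le1[OF kappa_minimal] suc z(2) by (meson not_less order.strict_implies_order)
  qed
  then show ?thesis using that \<open>\<gamma> < \<alpha>\<close> \<open>z \<le> x\<close> \<gamma> suc least by blast
qed

text \<open>The separating ordinal from \<open>ex_sep\<close> may exceed \<theta> by up to \<rho>.
  As the enumeration is strictly increasing, \<rho> further indices make up for that, and \<gamma> +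
  \<rho> is still below \<alpha>.\<close>

lemma ex_sep_below_K:
  assumes "x < K"
  obtains s where "sep s" "x \<le> s" "s < K"
proof -
  obtain \<gamma> where \<gamma>: "\<gamma> < \<alpha>" "kappa \<rho> \<gamma> \<le> x" "x < kappa \<rho> (osuc \<gamma>)" "osuc \<gamma> < \<alpha>"
    "\<And>z. minimal1 \<rho> z \<Longrightarrow> kappa \<rho> \<gamma> < z \<Longrightarrow> kappa \<rho> (osuc \<gamma>) \<le> z"
    by (rule next_kappa[OF assms]) blast
  obtain s \<theta> where s: "sep s" "x \<le> \<theta>" "kappa \<rho> (osuc \<gamma>) = osuc \<theta>" "\<theta> \<le> s" "s \<le> \<theta> +\<^sub>o \<rho>"
    by (rule ex_sep[OF kappa_minimal[OF order.strict_implies_order[OF \<gamma>(4)]] \<gamma>(3)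
          kappa_minimal[OF order.strict_implies_order[OF \<gamma>(1)]] \<gamma>(2,5)]) blast
  \<comment> \<open>The case \<eta> = 0 is left out since \<open>kappa \<rho> \<gamma>\<close> lies
    at or below \<theta>; the count starts from \<theta> + 1 at index \<gamma> + 1.\<close>
  have grow: "\<theta> +\<^sub>o \<eta> \<le> kappa \<rho> (\<gamma> +\<^sub>o \<eta>)" if "\<zero>\<^sub>o < \<eta>" "\<gamma> +\<^sub>o \<eta> \<le> \<alpha>" for \<eta>
    using that
  proof (induction \<eta> rule: less_induct)
    case (less \<eta>)
    have "osuc \<gamma> \<le> \<gamma> +\<^sub>o \<eta>" using less.prems(1) by (simp add: osuc_le_iff)
    then have "osuc \<theta> \<le> kappa \<rho> (\<gamma> +\<^sub>o \<eta>)"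
      using kappa_less[of "osuc \<gamma>" "\<gamma> +\<^sub>o \<eta>"] less.prems(2) s(3) by (metis le_less)
    then have \<theta>: "\<theta> < kappa \<rho> (\<gamma> +\<^sub>o \<eta>)" by (simp add: osuc_le_iff)
    have "\<theta> +\<^sub>o \<eta>' < kappa \<rho> (\<gamma> +\<^sub>o \<eta>)" if "\<eta>' < \<eta>" for \<eta>'
    proof (cases "\<eta>' = \<zero>\<^sub>o")
      case False
      have *: "\<gamma> +\<^sub>o \<eta>' < \<gamma> +\<^sub>o \<eta>" using that by simp
      then have "\<theta> +\<^sub>o \<eta>' \<le> kappa \<rho> (\<gamma> +\<^sub>o \<eta>')"
        using less.IH[OF that] False order.trans[OF order.strict_implies_order[OF *] less.prems(2)]
        by (simp add: ozero_less_iff)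
      also have "\<dots> < kappa \<rho> (\<gamma> +\<^sub>o \<eta>)" by (rule kappa_less[OF * less.prems(2)])
      finally show ?thesis .
    qed (simp add: oadd_ozero \<theta>)
    then show ?case using \<theta> by (simp add: oadd_le_iff[of \<theta>])
  qed
  have *: "\<gamma> +\<^sub>o \<rho> < \<alpha>" by (rule \<alpha>_oadd[OF \<gamma>(1) \<rho>_less_\<alpha>])
  have "s \<le> kappa \<rho> (\<gamma> +\<^sub>o \<rho>)" using s(5) grow[OF \<rho>_pos order.strict_implies_order[OF *]] by (rule order.trans)
  also have "\<dots> < K" by (rule kappa_less[OF *]) simp
  finally show ?thesis using that s by (meson order.trans)
qed

lemma minimal1_sep_translate:
  assumes "sep s" "\<zero>\<^sub>o < y" "minimal1 \<rho> (s +\<^sub>o y)"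
  shows "minimal1 \<rho> y"
  unfolding minimal1_iff
proof (intro allI impI)
  fix z assume R: "R1 z y"
  then have "z \<noteq> \<zero>\<^sub>o" using assms(2) by auto
  then have "R1 (s +\<^sub>o z) (s +\<^sub>o y)" using sep_translate[OF assms(1), of z y] R by (simp add: ozero_less_iff)
  then show "z = y" using assms(3) by (metis minimal1_iff oadd_eq_cancel)
qed

text \<open>Each minimal ordinal in (s, K] has the form s plus a minimal ordinal. Comparing indices
  bounds \<open>s +\<^sub>o kappa \<rho> \<eta>\<close> by the minimal ordinal with index \<gamma>'
  + \<eta>. If K were s plus a minimal ordinal of index \<xi> < \<alpha>, then K would be at most
  the one with index \<gamma>' + \<xi> < \<alpha>.\<close>

lemma sep_oadd_K:
  assumes s: "sep s" "s < K"
  shows "s +\<^sub>o K = K"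
proof -
  obtain \<gamma> where \<gamma>: "osuc \<gamma> < \<alpha>" "s < kappa \<rho> (osuc \<gamma>)" by (rule next_kappa[OF s(2)]) blast
  define \<gamma>' where "\<gamma>' = osuc \<gamma>"
  have sub: "\<exists>\<xi>\<le>\<alpha>. z = s +\<^sub>o kappa \<rho> \<xi>" if z: "minimal1 \<rho> z" "s < z" "z \<le> K" for z
  proof -
    obtain y where y: "z = s +\<^sub>o y" using ex_oadd[OF order.strict_implies_order[OF z(2)]] by blast
    have "\<zero>\<^sub>o < y" using z(2) y by simp
    then have m: "minimal1 \<rho> y" using minimal1_sep_translate[OF s(1)] z(1) y by simp
    moreover have "y \<le> K" using le_oadd_right[of y s] z(3) y by simp
    ultimately obtain \<xi> where "\<xi> \<le> \<alpha>" "y = kappa \<rho> \<xi>" by (rule ex_kappa)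
    then show ?thesis using y by blast
  qed
  have grow: "s +\<^sub>o kappa \<rho> \<eta> \<le> kappa \<rho> (\<gamma>' +\<^sub>o \<eta>)" if "\<gamma>' +\<^sub>o \<eta> \<le> \<alpha>" for \<eta>
    using that
  proof (induction \<eta> rule: less_induct)
    case (less \<eta>)
    have "kappa \<rho> \<gamma>' \<le> kappa \<rho> (\<gamma>' +\<^sub>o \<eta>)"
      using kappa_less[of \<gamma>' "\<gamma>' +\<^sub>o \<eta>"] less.prems le_oadd[of \<gamma>' \<eta>] by (metis le_less)
    then have "s < kappa \<rho> (\<gamma>' +\<^sub>o \<eta>)" using \<gamma>(2) by (simp add: \<gamma>'_def)
    moreover have "kappa \<rho> (\<gamma>' +\<^sub>o \<eta>) \<le> K" using kappa_less[of "\<gamma>' +\<^sub>o \<eta>" \<alpha>] less.prems by (metis le_less)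
    ultimately obtain \<xi> where \<xi>: "\<xi> \<le> \<alpha>" "kappa \<rho> (\<gamma>' +\<^sub>o \<eta>) = s +\<^sub>o kappa \<rho> \<xi>"
      using sub[OF kappa_minimal[OF less.prems]] by blast
    have "\<eta> \<le> \<xi>"
    proof (rule ccontr)
      assume "\<not> \<eta> \<le> \<xi>"
      then have *: "\<xi> < \<eta>" "\<gamma>' +\<^sub>o \<xi> < \<gamma>' +\<^sub>o \<eta>" by simp_all
      then have "s +\<^sub>o kappa \<rho> \<xi> \<le> kappa \<rho> (\<gamma>' +\<^sub>o \<xi>)" using less.IH[of \<xi>] order.trans[OF order.strict_implies_order less.prems] by blast
      also have "\<dots> < kappa \<rho> (\<gamma>' +\<^sub>o \<eta>)" by (rule kappa_less[OF *(2) less.prems])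
      finally show False using \<xi>(2) by simp
    qed
    then have "kappa \<rho> \<eta> \<le> kappa \<rho> \<xi>" using kappa_less[of \<eta> \<xi>] \<xi>(1) by (metis le_less)
    then show ?case using \<xi>(2) by simp
  qed
  obtain \<xi> where \<xi>: "\<xi> \<le> \<alpha>" "K = s +\<^sub>o kappa \<rho> \<xi>" using sub[OF K_minimal s(2)] by auto
  have "\<xi> = \<alpha>"
  proof (rule ccontr)
    assume "\<xi> \<noteq> \<alpha>"
    then have *: "\<gamma>' +\<^sub>o \<xi> < \<alpha>" using \<alpha>_oadd \<gamma>(1) \<xi>(1) by (simp add: \<gamma>'_def)
    then have "K \<le> kappa \<rho> (\<gamma>' +\<^sub>o \<xi>)" using grow[of \<xi>] \<xi>(2) by simp
    then show False using kappa_less[OF *] by simp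
  qed
  then show ?thesis using \<xi>(2) by simp
qed

section \<open>Closure properties of \<open>K\<close>\<close>

lemma oone_less_K: "\<one>\<^sub>o < K"
proof -
  have "\<zero>\<^sub>o < kappa \<rho> \<one>\<^sub>o"
    using kappa_less[OF less_osuc order.strict_implies_order[OF oone_less_\<alpha>]] ozero_le
    by (rule order.strict_trans1[rotated])
  moreover have "kappa \<rho> \<one>\<^sub>o < K" using kappa_less[OF oone_less_\<alpha>] by simp
  ultimately show ?thesis using osuc_le_iff[of "\<zero>\<^sub>o" "kappa \<rho> \<one>\<^sub>o"] by simp
qed

lemma K_pos: "\<zero>\<^sub>o < K"
  using oone_less_K less_osuc[of "\<zero>\<^sub>o"] by (rule order.strict_trans[rotated])

lemma \<rho>_less_K: "\<rho> < K"
proof -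
  obtain s where s: "sep s" "\<one>\<^sub>o \<le> s" "s < K" using ex_sep_below_K[OF oone_less_K] by blast
  have "\<zero>\<^sub>o < s" using s(2) by (simp add: osuc_le_iff)
  then have "\<rho> \<le> s" using mult_less[of "\<zero>\<^sub>o" s] s(1) by (simp add: sep_def)
  then show ?thesis using s(3) by simp
qed

text \<open>The left summand can be enlarged to a separating ordinal, which K absorbs.\<close>

lemma oadd_less_K:
  assumes "x < K" "y < K"
  shows "x +\<^sub>o y < K"
proof -
  obtain s where s: "sep s" "x \<le> s" "s < K" using ex_sep_below_K[OF assms(1)] by blast
  have "x +\<^sub>o y \<le> s +\<^sub>o y" by (rule oadd_mono_left[OF s(2)])
  also have "\<dots> < s +\<^sub>o K" using assms(2) by simp
  also have "\<dots> = K" by (rule sep_oadd_K[OF s(1,3)])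
  finally show ?thesis .
qed

lemma mult_K: "mult K"
proof (rule ccontr)
  assume "\<not> mult K"
  then have "fl K < K" using fl_le[of K] by (metis mult_iff_fl order.not_eq_order_implies_strict)
  then have "fl K +\<^sub>o \<rho> < K" by (rule oadd_less_K[OF _ \<rho>_less_K])
  then show False using less_fl_oadd[of K] by simp
qed

text \<open>Images avoid 0 because only the part above \<delta> resembles its translate.\<close>

definition coverable :: "'o \<Rightarrow> 'o set \<Rightarrow> bool"
  where "coverable x Y \<longleftrightarrow> (\<exists>h. cov h Y \<and> (\<forall>y\<in>Y. \<zero>\<^sub>o < h y \<and> h y < x))"

text \<open>
  The least \<open>x\<close> below which every finite closed subset of \<open>(0, \<kappa>\<^sub>\<alpha>)\<close> is coverable would be minimal,
  so that no smaller ordinal is related to anything above \<open>x\<close>; this would yield \<open>x \<le>\<^sub>1 \<kappa>\<^sub>\<alpha>\<close>.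
\<close>

lemma ex_not_coverable:
  assumes "x < K"
  shows "\<exists>Y. finite Y \<and> Y \<subseteq> {\<zero>\<^sub>o<..<K} \<and> rclosed \<rho> Y \<and> \<not> coverable x Y"
proof (rule ccontr)
  define Q where "Q = (\<lambda>x. \<forall>Y. finite Y \<longrightarrow> Y \<subseteq> {\<zero>\<^sub>o<..<K} \<longrightarrow> rclosed \<rho> Y \<longrightarrow> coverable x Y)"
  define m where "m = (LEAST x. Q x)"
  assume "\<not> ?thesis"
  then have "Q x" by (auto simp: Q_def)
  then have Qm: "Q m" and "m \<le> x" unfolding m_def by (auto intro: LeastI Least_le)
  then have "m < K" using assms by simp
  have not_Q: "\<not> Q z" if "z < m" for z using not_less_Least that unfolding m_def by blast
  \<comment> \<open>Leastness of m gives coverings beyond any \<gamma> < m. Take a set Y' not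
    coverable below \<gamma> and a copy of Y placed after it by a separating s. A covering of both
    below m sends some element of Y' to at least \<gamma>, and hence the whole copy beyond
    \<gamma>.\<close>
  have cof: "\<exists>h. cov h Y \<and> (\<forall>y\<in>Y. \<gamma> < h y \<and> h y < m)"
    if Y: "finite Y" "Y \<subseteq> {\<zero>\<^sub>o<..<K}" "rclosed \<rho> Y" and \<gamma>: "\<gamma> < m" for Y \<gamma>
  proof -
    obtain Y' where Y': "finite Y'" "Y' \<subseteq> {\<zero>\<^sub>o<..<K}" "rclosed \<rho> Y'" "\<not> coverable \<gamma> Y'"
      using not_Q[OF \<gamma>] by (auto simp: Q_def)
    have "Max (insert \<zero>\<^sub>o Y') < K" using Y' K_pos by auto
    then obtain s where s: "sep s" "Max (insert \<zero>\<^sub>o Y') \<le> s" "s < K" using ex_sep_below_K by blast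
    have Y's: "y' \<le> s" if "y' \<in> Y'" for y' using s(2) Y'(1) that by simp
    let ?Z = "Y' \<union> (\<lambda>z. s +\<^sub>o z) ` Y"
    have pos: "\<zero>\<^sub>o < y" if "y \<in> Y" for y using Y(2) that by auto
    have "s +\<^sub>o y < K" if "y \<in> Y" for y using oadd_less_K[OF s(3)] Y(2) that by auto
    moreover have "\<zero>\<^sub>o < s +\<^sub>o y" if "y \<in> Y" for y
      using pos[OF that] le_oadd_right[of y s] by (rule order.strict_trans2)
    ultimately have "(\<lambda>z. s +\<^sub>o z) ` Y \<subseteq> {\<zero>\<^sub>o<..<K}" by auto
    then have "?Z \<subseteq> {\<zero>\<^sub>o<..<K}" using Y'(2) by blast
    moreover have "rclosed \<rho> ?Z"
      using Y'(3) rclosed_translate[OF _ Y(3), of s] s(1) by (auto simp: rclosed_iff sep_def)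
    moreover have "finite ?Z" using Y(1) Y'(1) by simp
    ultimately obtain h where h: "cov h ?Z" "\<forall>z\<in>?Z. \<zero>\<^sub>o < h z \<and> h z < m"
      using Qm unfolding Q_def coverable_def by meson
    have "cov h Y'" by (rule cov_subset[OF h(1)]) auto
    then obtain y' where y': "y' \<in> Y'" "\<gamma> \<le> h y'" using Y'(4) h(2) by (meson UnI1 coverable_def not_le)
    have "\<gamma> < h (s +\<^sub>o y) \<and> h (s +\<^sub>o y) < m" if "y \<in> Y" for y
    proof -
      have "y' < s +\<^sub>o y" using Y's[OF y'(1)] pos[OF that] less_oadd_iff[of s y] by (meson order.strict_trans1)
      then have "h y' < h (s +\<^sub>o y)" using cov_mono[OF h(1), of y' "s +\<^sub>o y"] y'(1) that by simp
      moreover have "h (s +\<^sub>o y) < m" using h(2) that by simp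
      ultimately show ?thesis using y'(2) by simp
    qed
    moreover have "cov (\<lambda>z. h (s +\<^sub>o z)) Y"
    proof (rule cov_comp[of "\<lambda>z. s +\<^sub>o z"])
      show "cov (\<lambda>z. s +\<^sub>o z) Y"
        by (rule cov_oadd(1)[OF _ sep_translate[OF s(1) pos]]) (use s(1) in \<open>simp_all add: sep_def\<close>)
      show "cov h ((\<lambda>z. s +\<^sub>o z) ` Y)" by (rule cov_subset[OF h(1)]) auto
    qed
    ultimately show ?thesis by blast
  qed
  \<comment> \<open>A closed singleton whose coverings are single multiples of \<rho>: covering it
    shows that m is positive, and covering it cofinally that m is a multiple of \<rho>.\<close>
  have \<rho>Y: "finite {\<rho>}" "{\<rho>} \<subseteq> {\<zero>\<^sub>o<..<K}" "rclosed \<rho> {\<rho>}"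
    using \<rho>_pos \<rho>_less_K fl_mult[OF mult_\<rho>] by (auto simp: rclosed_iff)
  have "coverable m {\<rho>}" using Qm \<rho>Y unfolding Q_def by blast
  then have "\<zero>\<^sub>o < m" unfolding coverable_def by (meson insertI1 order.strict_trans)
  have mult_m: "mult m"
  proof (rule ccontr)
    assume "\<not> mult m"
    then have "fl m < m" using fl_le[of m] by (metis mult_iff_fl order.not_eq_order_implies_strict)
    then obtain h where h: "cov h {\<rho>}" "fl m < h \<rho>" "h \<rho> < m" using cof[OF \<rho>Y] by auto
    have "mult (h \<rho>)" using cov_mult[OF h(1), of \<rho>] by simp
    then have "h \<rho> \<le> fl m" using h(3) by (intro le_fl) auto
    then show False using h(2) by simp
  qed
  \<comment> \<open>If z < m were related to m, coverings lying between z and m could be moved below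
    z, so z would have property Q. Fixing 0 in this move keeps the images positive.\<close>
  have min_m: "\<not> R1 z m" if "z < m" for z
  proof
    assume R: "R1 z m"
    then have "\<zero>\<^sub>o < z" using \<open>\<zero>\<^sub>o < m\<close> by (auto simp: ozero_less_iff)
    have "coverable z Y" if Y: "finite Y" "Y \<subseteq> {\<zero>\<^sub>o<..<K}" "rclosed \<rho> Y" for Y
    proof -
      obtain g where g: "cov g Y" "\<forall>y\<in>Y. z < g y \<and> g y < m" using cof[OF Y \<open>z < m\<close>] by blast
      have "rclosed \<rho> ({\<zero>\<^sub>o} \<union> g ` Y)"
        using cov_closed[OF g(1) Y(3)] fl_mult[OF mult_0] by (auto simp: rclosed_iff)
      moreover have "g ` Y \<subseteq> {z..<m}" using g(2) by (auto intro: order.strict_implies_order)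
      ultimately obtain h where h: "cov h ({\<zero>\<^sub>o} \<union> g ` Y)" "\<And>x. x \<in> {\<zero>\<^sub>o} \<Longrightarrow> h x = x"
        "\<And>y. y \<in> g ` Y \<Longrightarrow> h y < z"
        using le1_cover[OF R, of "{\<zero>\<^sub>o}" "g ` Y"] Y(1) \<open>\<zero>\<^sub>o < z\<close>
        by (metis empty_subsetI finite.emptyI finite.insertI finite_imageI insert_subset lessThan_iff)
      have "cov h (g ` Y)" by (rule cov_subset[OF h(1)]) auto
      then have "cov (\<lambda>y. h (g y)) Y" by (rule cov_comp[OF g(1)])
      moreover have "\<zero>\<^sub>o < h (g y) \<and> h (g y) < z" if "y \<in> Y" for y
      proof -
        have "\<zero>\<^sub>o < g y" using g(2) that \<open>\<zero>\<^sub>o < z\<close> by (meson order.strict_trans)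
        then show ?thesis using cov_mono[OF h(1), of "\<zero>\<^sub>o" "g y"] h(2)[of "\<zero>\<^sub>o"] h(3)[of "g y"] that by simp
      qed
      ultimately show ?thesis by (auto simp: coverable_def)
    qed
    then have "Q z" by (simp add: Q_def)
    then show False using not_Q[OF \<open>z < m\<close>] by blast
  qed
  have "R1 m K"
  proof (rule le1I)
    show "m \<le> K" using \<open>m < K\<close> by simp
    fix X Y assume *: "finite X" "X \<subseteq> {..<m}" "finite Y" "Y \<subseteq> {m..<K}" "rclosed \<rho> (X \<union> Y)"
    have Ym: "m \<le> y" if "y \<in> Y" for y using *(4) that by auto
    \<comment> \<open>Since m is a multiple of \<rho>, floors of elements of Y stay at or above m;
      so Y can be covered separately from X.\<close>
    have clY: "rclosed \<rho> Y"
      unfolding rclosed_iff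
    proof
      fix y assume "y \<in> Y"
      then have "m \<le> fl y" "fl y \<in> X \<union> Y" using le_fl[OF mult_m Ym] *(5) by (auto simp: rclosed_iff)
      then show "fl y \<in> Y" using *(2) by auto
    qed
    have "Y \<subseteq> {\<zero>\<^sub>o<..<K}" using *(4) Ym \<open>\<zero>\<^sub>o < m\<close> by (force intro: order.strict_trans2)
    moreover have "Max (insert \<zero>\<^sub>o X) < m" using *(1,2) \<open>\<zero>\<^sub>o < m\<close> by auto
    ultimately obtain h where h: "cov h Y" "\<forall>y\<in>Y. Max (insert \<zero>\<^sub>o X) < h y \<and> h y < m"
      using cof[OF *(3) _ clY] by blast
    have XY: "u < v" if "u \<in> X" "v \<in> Y" for u v
      using *(2) Ym[OF that(2)] that(1) by auto
    \<comment> \<open>A relation from X into Y would pass down to m, against \<open>min_m\<close>.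
      So any covering of Y above the maximum of X can be glued to the identity on X.\<close>
    have no: "\<not> R1 u v" if "u \<in> X" "v \<in> Y" for u v
    proof
      assume "R1 u v"
      moreover have "u < m" using *(2) that(1) by auto
      ultimately have "R1 u m" using Ym[OF that(2)] by (intro le1_between[of u v m]) auto
      then show False using min_m \<open>u < m\<close> by blast
    qed
    let ?h = "\<lambda>x. if x \<in> Y then h x else x"
    have "cov ?h (X \<union> Y)"
    proof (rule glue[OF h(1) clY])
      show "u < h v" if "u \<in> X" "v \<in> Y" for u v
      proof -
        have "u \<le> Max (insert \<zero>\<^sub>o X)" using *(1) that(1) by simp
        then show ?thesis using h(2) that(2) by (meson order.strict_trans1)
      qed
      show "R1 u v \<Longrightarrow> R1 u (h v)" "R2 u v \<Longrightarrow> R2 u (h v)" if "u \<in> X" "v \<in> Y" for u v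
        using no[OF that] le2_imp_le1 by blast+
    qed (rule XY)
    moreover have "\<forall>x\<in>X. ?h x = x" using XY by auto
    moreover have "\<forall>y\<in>Y. ?h y < m" using h(2) by simp
    ultimately show "\<exists>h. cov h (X \<union> Y) \<and> (\<forall>x\<in>X. h x = x) \<and> (\<forall>y\<in>Y. h y < m)" by blast
  qed
  then have "m = K" using K_minimal unfolding minimal1_iff by blast
  then show False using \<open>m < K\<close> by simp
qed

text \<open>A floor strictly below the product would fall below
  \<open>K \<cdot>\<^sub>o \<zeta> +\<^sub>o K\<close> for some \<zeta> < \<eta>, which is by
  induction a multiple of \<rho> not exceeding the product.\<close>

lemma mult_K_omul: "mult (K \<cdot>\<^sub>o \<eta>)"
proof (induction \<eta> rule: less_induct)
  case (less \<eta>)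
  show ?case
  proof (rule ccontr)
    assume "\<not> ?thesis"
    then have "fl (K \<cdot>\<^sub>o \<eta>) < K \<cdot>\<^sub>o \<eta>"
      using fl_le[of "K \<cdot>\<^sub>o \<eta>"] by (metis mult_iff_fl order.not_eq_order_implies_strict)
    then obtain \<zeta> where \<zeta>: "\<zeta> < \<eta>" "fl (K \<cdot>\<^sub>o \<eta>) < K \<cdot>\<^sub>o \<zeta> +\<^sub>o K"
      using omul_le_iff[of K \<eta> "fl (K \<cdot>\<^sub>o \<eta>)"] by (auto simp: not_le[symmetric])
    have "mult (K \<cdot>\<^sub>o \<zeta> +\<^sub>o K)" using less[OF \<zeta>(1)] mult_K by (rule mult_oadd)
    then have "K \<cdot>\<^sub>o \<zeta> +\<^sub>o K \<le> fl (K \<cdot>\<^sub>o \<eta>)" by (rule le_fl) (rule omul_step[OF \<zeta>(1)])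
    then show False using \<zeta>(2) by simp
  qed
qed

text \<open>The outer induction runs over blocks of length K, the inner one over positions in a
  block. They supply the isomorphisms with earlier blocks and with the current block up to
  x.\<close>

lemma not_le2_interval:
  "a \<le> K \<cdot>\<^sub>o \<eta> \<Longrightarrow> \<zero>\<^sub>o < x \<Longrightarrow> x < K \<Longrightarrow> \<not> R2 a (K \<cdot>\<^sub>o \<eta> +\<^sub>o x)"
proof (induction \<eta> arbitrary: a x rule: less_induct)
  case (less \<eta>)
  note outer = less.IH
  show ?case
    using less.prems
  proof (induction x arbitrary: a rule: less_induct)
    case (less x)
    let ?\<delta> = "K \<cdot>\<^sub>o \<eta>"
    have below: "(R1 z w \<longleftrightarrow> R1 (K \<cdot>\<^sub>o \<zeta> +\<^sub>o z) (K \<cdot>\<^sub>o \<zeta> +\<^sub>o w)) \<and>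
        (R2 z w \<longleftrightarrow> R2 (K \<cdot>\<^sub>o \<zeta> +\<^sub>o z) (K \<cdot>\<^sub>o \<zeta> +\<^sub>o w))"
      if "\<zeta> < \<eta>" "\<zero>\<^sub>o < z" "w \<le> K" for \<zeta> z w
      by (rule translate[where B = K]) (use that mult_K_omul outer in auto)
    \<comment> \<open>The inner hypothesis speaks of positions before x only;
      \<open>translate\<close> then reaches x as well.\<close>
    have here: "(R1 z w \<longleftrightarrow> R1 (?\<delta> +\<^sub>o z) (?\<delta> +\<^sub>o w)) \<and> (R2 z w \<longleftrightarrow> R2 (?\<delta> +\<^sub>o z) (?\<delta> +\<^sub>o w))"
      if "\<zero>\<^sub>o < z" "w \<le> x" for z w
    proof (rule translate[where B = x])
      show "\<not> R2 a (?\<delta> +\<^sub>o b)" if "a \<le> ?\<delta>" "\<zero>\<^sub>o < b" "b < x" for a b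
        using less.IH[OF that(3,1,2)] that(3) less.prems(3) by simp
    qed (use that mult_K_omul in auto)
    show ?case
    proof
      assume R2: "R2 a (?\<delta> +\<^sub>o x)"
      have "?\<delta> < ?\<delta> +\<^sub>o x" using less.prems(2) by simp
      then have R1: "R1 a ?\<delta>"
        using le1_between[OF le2_imp_le1[OF R2] less.prems(1) le_oadd] by simp
      have "a \<noteq> \<zero>\<^sub>o"
        using le2_imp_le1[OF R2] \<open>?\<delta> < ?\<delta> +\<^sub>o x\<close> not_less_ozero by (metis le1_0)
      obtain \<eta>' a' where a': "a = K \<cdot>\<^sub>o \<eta>' +\<^sub>o a'" "a' < K" using ex_omul_oadd[OF K_pos] by blast
      have "\<eta>' \<le> \<eta>"
      proof (rule ccontr)
        assume "\<not> \<eta>' \<le> \<eta>"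
        then have "?\<delta> +\<^sub>o K \<le> a"
          using omul_step[of \<eta> \<eta>' K] le_oadd[of "K \<cdot>\<^sub>o \<eta>'" a'] a'(1) by (metis not_le order.trans)
        moreover have "?\<delta> < ?\<delta> +\<^sub>o K" using K_pos by simp
        ultimately show False using less.prems(1) by (meson leD order.trans)
      qed
      \<comment> \<open>Otherwise a is an interior point of an earlier block and related to the end
        of that block. Pulled back to the first block this relates a' to K, against
        minimality.\<close>
      have a_eq: "a = K \<cdot>\<^sub>o \<eta>'"
      proof (rule ccontr)
        assume ne: "a \<noteq> K \<cdot>\<^sub>o \<eta>'"
        then have "\<zero>\<^sub>o < a'" using a'(1) by (auto simp: ozero_less_iff oadd_ozero)
        have "\<eta>' \<noteq> \<eta>" using less.prems(1) ne a'(1) le_oadd[of ?\<delta> a'] by auto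
        then have "\<eta>' < \<eta>" using \<open>\<eta>' \<le> \<eta>\<close> by simp
        have "R1 a (K \<cdot>\<^sub>o \<eta>' +\<^sub>o K)"
        proof (rule le1_between[OF R1])
          show "a \<le> K \<cdot>\<^sub>o \<eta>' +\<^sub>o K" unfolding a'(1) using a'(2) by simp
        qed (rule omul_step[OF \<open>\<eta>' < \<eta>\<close>])
        then have "R1 a' K" using below[OF \<open>\<eta>' < \<eta>\<close> \<open>\<zero>\<^sub>o < a'\<close>, of K] a'(1) by simp
        then show False using K_minimal a'(2) by (auto simp: minimal1_iff)
      qed
      have "\<eta>' \<noteq> \<zero>\<^sub>o" using \<open>a \<noteq> \<zero>\<^sub>o\<close> a_eq by (auto simp: omul_ozero)
      \<comment> \<open>So finite subsets of (0, K) lie below a, as the upward clause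
        demands.\<close>
      then have "K \<le> a" using omul_mono[of "\<one>\<^sub>o" \<eta>' K] a_eq by (simp add: osuc_le_iff ozero_less_iff)
      have "coverable x Y" if Y: "finite Y" "Y \<subseteq> {\<zero>\<^sub>o<..<K}" "rclosed \<rho> Y" for Y
      proof -
        have Y_pos: "\<zero>\<^sub>o < y" and Y_K: "y < K" if "y \<in> Y" for y using Y(2) that by auto
        have "cofinal_covers a {} Y"
          unfolding cofinal_covers_def
        proof (intro allI impI)
          fix \<gamma> assume "\<gamma> < a"
          then obtain \<zeta> where \<zeta>: "\<zeta> < \<eta>'" "\<gamma> < K \<cdot>\<^sub>o \<zeta> +\<^sub>o K"
            using omul_le_iff[of K \<eta>' \<gamma>] by (auto simp: a_eq not_le[symmetric])
          \<comment> \<open>The position of \<gamma> in the block starting at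
            \<open>K \<cdot>\<^sub>o \<zeta>\<close>, or 0 if \<gamma> lies before that
            block.\<close>
          define g where "g = (if K \<cdot>\<^sub>o \<zeta> \<le> \<gamma> then osub (K \<cdot>\<^sub>o \<zeta>) \<gamma> else \<zero>\<^sub>o)"
          have g: "\<gamma> \<le> K \<cdot>\<^sub>o \<zeta> +\<^sub>o g"
            by (auto simp: g_def oadd_osub oadd_ozero)
          have "g < K"
          proof (cases "K \<cdot>\<^sub>o \<zeta> \<le> \<gamma>")
            case True
            then show ?thesis using \<zeta>(2) oadd_osub[OF True] by (metis g_def oadd_less_cancel)
          qed (simp add: g_def K_pos)
          \<comment> \<open>Shifting Y by s first puts the copy beyond \<gamma>, and closure of K
            under addition keeps it inside the block.\<close>
          then obtain s where s: "sep s" "g \<le> s" "s < K" using ex_sep_below_K by blast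
          let ?h = "\<lambda>y. K \<cdot>\<^sub>o \<zeta> +\<^sub>o (s +\<^sub>o y)"
          have "\<zeta> < \<eta>" using \<zeta>(1) \<open>\<eta>' \<le> \<eta>\<close> by simp
          have sY: "\<zero>\<^sub>o < z \<and> z < K" if "z \<in> (\<lambda>y. s +\<^sub>o y) ` Y" for z
          proof -
            obtain y where y: "y \<in> Y" "z = s +\<^sub>o y" using \<open>z \<in> _\<close> by blast
            have "\<zero>\<^sub>o < z" unfolding y(2) using Y_pos[OF y(1)] le_oadd_right by (rule order.strict_trans2)
            then show ?thesis using oadd_less_K[OF s(3) Y_K[OF y(1)]] y(2) by simp
          qed
          have "cov ?h Y"
          proof (rule cov_comp[of "\<lambda>y. s +\<^sub>o y"])
            show "cov (\<lambda>z. s +\<^sub>o z) Y"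
              by (rule cov_oadd(1)[OF _ sep_translate[OF s(1) Y_pos]]) (use s(1) in \<open>simp_all add: sep_def\<close>)
            show "cov (\<lambda>z. K \<cdot>\<^sub>o \<zeta> +\<^sub>o z) ((\<lambda>y. s +\<^sub>o y) ` Y)"
            proof (rule cov_oadd(1)[OF mult_K_omul])
              fix z w assume "z \<in> (\<lambda>y. s +\<^sub>o y) ` Y" "w \<in> (\<lambda>y. s +\<^sub>o y) ` Y"
              then have "\<zero>\<^sub>o < z" "w \<le> K" using sY by (auto intro: order.strict_implies_order)
              then show "(R1 z w \<longleftrightarrow> R1 (K \<cdot>\<^sub>o \<zeta> +\<^sub>o z) (K \<cdot>\<^sub>o \<zeta> +\<^sub>o w)) \<and>
                  (R2 z w \<longleftrightarrow> R2 (K \<cdot>\<^sub>o \<zeta> +\<^sub>o z) (K \<cdot>\<^sub>o \<zeta> +\<^sub>o w))"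
                by (rule below[OF \<open>\<zeta> < \<eta>\<close>])
            qed
          qed
          moreover have "\<gamma> < ?h y \<and> ?h y < a" if "y \<in> Y" for y
          proof
            have "g < s +\<^sub>o y" using s(2) Y_pos[OF that] less_oadd_iff[of s y] by (meson order.strict_trans1)
            then have "K \<cdot>\<^sub>o \<zeta> +\<^sub>o g < ?h y" by simp
            then show "\<gamma> < ?h y" using g by (rule order.strict_trans1[rotated])
            have "?h y < K \<cdot>\<^sub>o \<zeta> +\<^sub>o K" using oadd_less_K[OF s(3) Y_K[OF that]] by simp
            also have "\<dots> \<le> a" unfolding a_eq by (rule omul_step[OF \<zeta>(1)])
            finally show "?h y < a" .
          qed
          ultimately show "\<exists>h. cov h ({} \<union> Y) \<and> (\<forall>x\<in>{}. h x = x) \<and> (\<forall>y\<in>Y. \<gamma> < h y \<and> h y < a)"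
            by (intro exI[of _ ?h]) simp
        qed
        moreover have "Y \<subseteq> {..<a}" using Y_K \<open>K \<le> a\<close> by (auto intro: order.strict_trans2)
        \<comment> \<open>With X empty the upward clause yields coverings of Y strictly between
          \<open>?\<delta>\<close> and \<open>?\<delta> +\<^sub>o x\<close>; \<open>here\<close>
          pulls them back into (0, x).\<close>
        ultimately have "cofinal_covers (?\<delta> +\<^sub>o x) {} Y"
          using le2_cofinal_covers[OF R2, of "{}" Y] Y by (simp add: set_less_def)
        then obtain h where h: "cov h Y" "\<forall>y\<in>Y. ?\<delta> < h y \<and> h y < ?\<delta> +\<^sub>o x"
          using \<open>?\<delta> < ?\<delta> +\<^sub>o x\<close> unfolding cofinal_covers_def Un_empty_left by blast
        define W where "W = osub ?\<delta> ` h ` Y"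
        have eq: "?\<delta> +\<^sub>o osub ?\<delta> (h y) = h y" if "y \<in> Y" for y
          using h(2) that by (intro oadd_osub) (auto intro: order.strict_implies_order)
        then have hY: "h ` Y = (\<lambda>z. ?\<delta> +\<^sub>o z) ` W" by (force simp: W_def)
        have Wx: "\<zero>\<^sub>o < osub ?\<delta> (h y) \<and> osub ?\<delta> (h y) < x" if "y \<in> Y" for y
          using h(2) that eq[OF that] by (metis less_oadd_iff oadd_less_cancel)
        have "cov (osub ?\<delta>) (h ` Y)"
          unfolding hY
        proof (rule cov_oadd(2)[OF mult_K_omul])
          fix z w assume "z \<in> W" "w \<in> W"
          then have "\<zero>\<^sub>o < z" "w \<le> x" using Wx by (auto simp: W_def intro: order.strict_implies_order)
          then show "(R1 z w \<longleftrightarrow> R1 (?\<delta> +\<^sub>o z) (?\<delta> +\<^sub>o w)) \<and> (R2 z w \<longleftrightarrow> R2 (?\<delta> +\<^sub>o z) (?\<delta> +\<^sub>o w))"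
            by (rule here)
        qed
        then have "cov (\<lambda>y. osub ?\<delta> (h y)) Y" by (rule cov_comp[OF h(1)])
        then show ?thesis using Wx by (auto simp: coverable_def)
      qed
      then show False using ex_not_coverable[OF less.prems(3)] by blast
    qed
  qed
qed

lemma interval_iso:
  fixes \<eta> :: 'o
  defines "\<delta> \<equiv> K \<cdot>\<^sub>o \<eta>"
  shows "resemblance_iso \<rho> {\<one>\<^sub>o..K} {\<delta> +\<^sub>o \<one>\<^sub>o..\<delta> +\<^sub>o K}"
  unfolding resemblance_iso_def
proof (intro exI conjI ballI)
  have \<delta>: "mult \<delta>" unfolding \<delta>_def by (rule mult_K_omul)
  have "{\<delta> +\<^sub>o \<one>\<^sub>o..\<delta> +\<^sub>o K} \<subseteq> (\<lambda>x. \<delta> +\<^sub>o x) ` {\<one>\<^sub>o..K}"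
  proof
    fix z assume z: "z \<in> {\<delta> +\<^sub>o \<one>\<^sub>o..\<delta> +\<^sub>o K}"
    then have "\<delta> \<le> z" using le_oadd[of \<delta> "\<one>\<^sub>o"] by (auto intro: order.trans)
    then obtain w where "z = \<delta> +\<^sub>o w" using ex_oadd by blast
    then show "z \<in> (\<lambda>x. \<delta> +\<^sub>o x) ` {\<one>\<^sub>o..K}" using z by auto
  qed
  then show "bij_betw (\<lambda>x. \<delta> +\<^sub>o x) {\<one>\<^sub>o..K} {\<delta> +\<^sub>o \<one>\<^sub>o..\<delta> +\<^sub>o K}"
    by (auto simp: bij_betw_def intro: inj_onI)
  show "strict_mono_on {\<one>\<^sub>o..K} (\<lambda>x. \<delta> +\<^sub>o x)" by (auto intro: strict_mono_onI)
  fix x y assume xy: "x \<in> {\<one>\<^sub>o..K}" "y \<in> {\<one>\<^sub>o..K}"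
  show "\<forall>\<xi><\<rho>. rfun \<rho> \<xi> x = y \<longleftrightarrow> rfun \<rho> \<xi> (\<delta> +\<^sub>o x) = \<delta> +\<^sub>o y"
    by (simp add: rfun_translate[OF \<delta>])
  have "(R1 x y \<longleftrightarrow> R1 (\<delta> +\<^sub>o x) (\<delta> +\<^sub>o y)) \<and> (R2 x y \<longleftrightarrow> R2 (\<delta> +\<^sub>o x) (\<delta> +\<^sub>o y))"
    by (rule translate[where B = K, OF \<delta>])
      (use xy not_le2_interval in \<open>auto simp: \<delta>_def osuc_le_iff\<close>)
  then show "R1 x y \<longleftrightarrow> R1 (\<delta> +\<^sub>o x) (\<delta> +\<^sub>o y)" "R2 x y \<longleftrightarrow> R2 (\<delta> +\<^sub>o x) (\<delta> +\<^sub>o y)" by blast+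
qed

end

theorem theorem8p1:
  fixes \<rho> \<alpha> \<mu> \<delta> :: "'o::ordinal"
  assumes "additively_indecomposable \<rho>"
    and "less_theta1 \<rho> \<alpha>"
    and "\<alpha> = \<rho> \<cdot>\<^sub>o \<mu>"
    and "oinfinite \<mu>"
    and "additively_indecomposable \<mu>"
    and "odvd (kappa \<rho> \<alpha>) \<delta>"
  shows "not_le2 \<rho> {\<zero>\<^sub>o..\<delta>} {\<delta> +\<^sub>o \<one>\<^sub>o..<\<delta> +\<^sub>o kappa \<rho> \<alpha>} \<and>
    resemblance_iso \<rho> {\<one>\<^sub>o..kappa \<rho> \<alpha>} {\<delta> +\<^sub>o \<one>\<^sub>o..\<delta> +\<^sub>o kappa \<rho> \<alpha>}"
proof -
  interpret recurrence \<rho> \<alpha> \<mu>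
    by unfold_locales (use assms in auto)
  obtain \<eta> where \<delta>: "\<delta> = kappa \<rho> \<alpha> \<cdot>\<^sub>o \<eta>" using assms(6) by (auto simp: odvd_def)
  have "\<not> le2 \<rho> a b" if a: "a \<le> \<delta>" and b: "\<delta> +\<^sub>o \<one>\<^sub>o \<le> b" "b < \<delta> +\<^sub>o kappa \<rho> \<alpha>" for a b
  proof -
    have "\<delta> \<le> b" using le_oadd b(1) by (rule order.trans)
    then obtain x where x: "b = \<delta> +\<^sub>o x" using ex_oadd by blast
    then have "\<zero>\<^sub>o < x" "x < kappa \<rho> \<alpha>" using b by (simp_all add: osuc_le_iff)
    then show ?thesis using not_le2_interval[of a \<eta> x] a unfolding x \<delta> by blast
  qed
  then have "not_le2 \<rho> {\<zero>\<^sub>o..\<delta>} {\<delta> +\<^sub>o \<one>\<^sub>o..<\<delta> +\<^sub>o kappa \<rho> \<alpha>}" by (auto simp: not_le2_def)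
  then show ?thesis using interval_iso[of \<eta>] unfolding \<delta> by blast
qed

end
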